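(* Let $d>0$ be fixed and, for $n>d$, let $G\sim\mathsf{G}(n,d/n)$ be an Erdős–Rényi random graph on vertex set $[n]$ (each of the $\binom n2$ possible edges present independently with probability $d/n$). Let $\mathbf{A}_G$ be its adjacency matrix and $\mathbf{A}^{\mathrm{cen}}_G=\mathbf{A}_G-\mathbb{E}\{\mathbf{A}_G\}$ its centered adjacency matrix. Then there is a non-random function $g:(0,\infty)\to[0,\infty)$ with $g(d)/\sqrt d\to0$ as $d\to\infty$, such that for every $d$ there exists $C=C(d)$ such that, with probability at least $1-Ce^{-n/C}$, $$\Big|\tfrac1n\mathrm{SDP}(\mathbf{A}^{\mathrm{cen}}_G)-2\sqrt d\Big|\le g(d)\quad\text{and}\quad \Big|\tfrac1n\mathrm{SDP}(-\mathbf{A}^{\mathrm{cen}}_G)-2\sqrt d\Big|\le g(d).$$ In the paper's notation: $\frac1n\mathrm{SDP}(\pm\mathbf{A}^{\mathrm{cen}}_G)=2\sqrt d+o_d(\sqrt d)$ with probability at least $1-Ce^{-n/C}$.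
   Context: For a symmetric $n\times n$ real matrix $\mathbf{M}$, $\mathrm{SDP}(\mathbf{M})=\max\{\langle \mathbf{M},\mathbf{X}\rangle:\ \mathbf{X}\in\mathbb{R}^{n\times n},\ \mathbf{X}\succeq0,\ X_{ii}=1\ \forall i\in[n]\}$, where $\langle\mathbf{A},\mathbf{B}\rangle=\mathrm{Tr}(\mathbf{A}^{\mathsf T}\mathbf{B})$. *)

theory Defs
  imports "HOL-Probability.Probability" "Jordan_Normal_Form.Matrix"
begin

hide_const (open) Determinants.trace

text \<open>
  Matrices are those of \<^theory>\<open>Jordan_Normal_Form.Matrix\<close>, since the dimension n varies inside
  the statement. Rows and columns are indexed by 0, ..., n - 1, and the vertex set [n] of a
  graph is taken to be {0, ..., n - 1} accordingly.
\<close>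

definition trace :: "real Matrix.mat \<Rightarrow> real" where
  "trace A = (\<Sum>i<dim_row A. A $$ (i, i))"

definition mat_inner :: "real Matrix.mat \<Rightarrow> real Matrix.mat \<Rightarrow> real" where
  "mat_inner A B = trace (transpose_mat A * B)"

definition psd :: "real Matrix.mat \<Rightarrow> bool" where
  "psd X \<longleftrightarrow> square_mat X \<and> transpose_mat X = X \<and>
     (\<forall>v \<in> carrier_vec (dim_row X). 0 \<le> scalar_prod v (X *\<^sub>v v))"

definition sdp_feasible :: "nat \<Rightarrow> real Matrix.mat set" where
  "sdp_feasible n = {X \<in> carrier_mat n n. psd X \<and> (\<forall>i<n. X $$ (i, i) = 1)}"

text \<open>
  The feasible set is nonempty (it contains the identity) and compact, so the supremum below is
  attained: it is the maximum of the objective, for square M.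
\<close>

definition SDP :: "real Matrix.mat \<Rightarrow> real" where
  "SDP M = (SUP X \<in> sdp_feasible (dim_row M). mat_inner M X)"

text \<open>A simple graph on {0, ..., n - 1} is represented by its set of edges, each a 2-element set.\<close>

definition all_edges :: "nat \<Rightarrow> nat set set" where
  "all_edges n = {e. e \<subseteq> {..<n} \<and> card e = 2}"

definition erdos_renyi :: "nat \<Rightarrow> real \<Rightarrow> nat set set pmf" where
  "erdos_renyi n p =
     map_pmf (\<lambda>f. {e \<in> all_edges n. f e}) (Pi_pmf (all_edges n) False (\<lambda>_. bernoulli_pmf p))"

text \<open>The diagonal vanishes because {i, i} is a singleton and hence never an edge.\<close>

definition adj_mat :: "nat \<Rightarrow> nat set set \<Rightarrow> real Matrix.mat" where
  "adj_mat n G = Matrix.mat n n (\<lambda>(i, j). if {i, j} \<in> G then 1 else 0)"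

definition expected_adj_mat :: "nat \<Rightarrow> real \<Rightarrow> real Matrix.mat" where
  "expected_adj_mat n p =
     Matrix.mat n n (\<lambda>(i, j). measure_pmf.expectation (erdos_renyi n p) (\<lambda>G. adj_mat n G $$ (i, j)))"

definition centered_adj_mat :: "nat \<Rightarrow> real \<Rightarrow> nat set set \<Rightarrow> real Matrix.mat" where
  "centered_adj_mat n p G = adj_mat n G - expected_adj_mat n p"

end

theory Submission
  imports Defs "Jordan_Normal_Form.Determinant"
begin

text \<open>
  Upper bound. Let \<open>X(M)\<close> maximise \<open>\<langle>M, X\<rangle> + ln (det X)\<close> over the feasible set. First-order
  optimality gives \<open>SDP M \<le> \<langle>M, X(M)\<rangle> + n\<close>, and a data-processing inequality for the symmetrised
  divergence of the Gaussians with covariances \<open>X(M)\<close>, \<open>X(M')\<close> shows that changing the entry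
  \<open>M\<^bsub>ij\<^esub>\<close> by \<open>s\<close> moves \<open>X\<^bsub>ij\<^esub>\<close> by at most \<open>\<bar>s\<bar>\<close>. Applied to the centred adjacency matrix divided
  by \<open>sqrt d\<close> and integrated edge by edge, this yields \<open>E SDP \<le> 2 n sqrt d\<close> for every \<open>n > d\<close>.

  Lower bound. A feasible matrix is the Gram matrix of the vectors
  \<open>V\<^bsub>i\<^esub> = \<Sum> (\<plusminus> 1 / sqrt d)\<^bsup>k\<^esup> e\<^bsub>m\<^esub>\<close>, summed over self-avoiding paths of length \<open>k < L\<close> from \<open>i\<close>
  to \<open>m\<close>, for vertices \<open>i\<close> with a tree-like neighbourhood and \<open>\<parallel>V\<^bsub>i\<^esub>\<parallel>\<^sup>2 \<le> L (1 + \<eta>)\<close>. On trees its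
  inner product with the adjacency matrix counts paths, and moments of path counts show that the
  loss from exceptional vertices vanishes as \<open>n\<close>, then \<open>d\<close>, then \<open>L\<close> tend to infinity.

  Changing one edge changes the value by at most 2, so a Bernstein-type exponential moment bound
  for functions of independent Bernoulli variables gives concentration at scale \<open>n\<close>.
\<close>

section \<open>Positive semidefinite matrices and determinants\<close>

text \<open>A maximiser of the SDP itself need not vary continuously with \<open>M\<close>, so its
  correlation with a single edge cannot be controlled; the log-determinant makes the optimum
  Lipschitz at a price of \<open>n\<close>. At strength \<open>r\<close> the price is
  \<open>r * n\<close>, and each of at most \<open>n * n\<close> ordered pairs correlates by at most
  \<open>p / r\<close>. For \<open>r = sqrt d\<close> both totals are \<open>n * sqrt d\<close>,
  whence the constant 2.

  From below the same 2 arises because every edge is used from both ends: the edge weights out of a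
  vertex sum to \<open>d * (N - 1)\<close>, where the path mass \<open>N\<close> is close to
  \<open>L\<close>; a factor \<open>1 / sqrt d\<close> and the normalisation by \<open>L\<close>
  leave \<open>2 * sqrt d * (1 - 1 / L)\<close>. Centring subtracts only \<open>p\<close> times a
  sum over pairs of vertices whose explored neighbourhoods meet. That sum is of order
  \<open>n\<close> for fixed \<open>d\<close> and \<open>L\<close>, so the correction stays bounded.

  Fluctuations of order \<open>n\<close> are affordable: after division by \<open>n\<close> they add
  a constant to \<open>g\<close>, and a constant is negligible against
  \<open>sqrt d\<close>.\<close>

lemma trace_mult:
  assumes "A \<in> carrier_mat n m" "B \<in> carrier_mat m n"
  shows "trace (A * B) = (\<Sum>i<n. \<Sum>j<m. A $$ (i,j) * B $$ (j,i))"
  using assms by (auto simp: trace_def scalar_prod_def atLeast0LessThan intro!: sum.cong)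

lemma trace_mult_comm:
  assumes "A \<in> carrier_mat n m" "B \<in> carrier_mat m n"
  shows "trace (A * B) = trace (B * A)"
  unfolding trace_mult[OF assms] trace_mult[OF assms(2,1)]
  by (subst sum.swap) (simp add: mult.commute)

lemma trace_one: "trace (1\<^sub>m n) = real n"
  by (simp add: trace_def)

lemma trace_diff:
  assumes "A \<in> carrier_mat n n" "B \<in> carrier_mat n n"
  shows "trace (A - B) = trace A - trace B"
  using assms by (auto simp: trace_def sum_subtractf)

lemma mat_inner_eq:
  assumes "A \<in> carrier_mat n n" "B \<in> carrier_mat n n"
  shows "mat_inner A B = (\<Sum>i<n. \<Sum>j<n. A $$ (i,j) * B $$ (i,j))"
proof -
  have "mat_inner A B = (\<Sum>i<n. \<Sum>j<n. A $$ (j,i) * B $$ (j,i))"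
    unfolding mat_inner_def using assms by (subst trace_mult[where n=n and m=n]) auto
  thus ?thesis by (subst sum.swap)
qed

lemma quadratic_form_eq:
  fixes X :: "real Matrix.mat"
  assumes "X \<in> carrier_mat n n" "v \<in> carrier_vec n"
  shows "scalar_prod v (X *\<^sub>v v)
    = (\<Sum>i<n. \<Sum>j<n. vec_index v i * vec_index v j * X $$ (i,j))"
  using assms
  by (auto simp: scalar_prod_def atLeast0LessThan sum_distrib_left mult_ac intro!: sum.cong)

lemma psd_iff:
  assumes X: "X \<in> carrier_mat n n"
  shows "psd X \<longleftrightarrow> (\<forall>i<n. \<forall>j<n. X $$ (i,j) = X $$ (j,i)) \<and>
    (\<forall>z :: nat \<Rightarrow> real. 0 \<le> (\<Sum>i<n. \<Sum>j<n. z i * z j * X $$ (i,j)))"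
proof -
  have 1: "transpose_mat X = X \<longleftrightarrow> (\<forall>i<n. \<forall>j<n. X $$ (i,j) = X $$ (j,i))"
    using X by (auto simp: mat_eq_iff)
  have 2: "(\<forall>v \<in> carrier_vec n. 0 \<le> scalar_prod v (X *\<^sub>v v))
      \<longleftrightarrow> (\<forall>z :: nat \<Rightarrow> real. 0 \<le> (\<Sum>i<n. \<Sum>j<n. z i * z j * X $$ (i,j)))"
  proof safe
    fix z :: "nat \<Rightarrow> real"
    assume "\<forall>v \<in> carrier_vec n. 0 \<le> scalar_prod v (X *\<^sub>v v)"
    hence "0 \<le> scalar_prod (Matrix.vec n z) (X *\<^sub>v Matrix.vec n z)" by simp
    also have "\<dots> = (\<Sum>i<n. \<Sum>j<n. z i * z j * X $$ (i,j))"
      by (subst quadratic_form_eq[OF X]) (auto intro!: sum.cong)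
    finally show "0 \<le> (\<Sum>i<n. \<Sum>j<n. z i * z j * X $$ (i,j))" .
  next
    fix v :: "real Matrix.vec"
    assume "\<forall>z :: nat \<Rightarrow> real. 0 \<le> (\<Sum>i<n. \<Sum>j<n. z i * z j * X $$ (i,j))" "v \<in> carrier_vec n"
    thus "0 \<le> scalar_prod v (X *\<^sub>v v)" by (subst quadratic_form_eq[OF X]) auto
  qed
  show ?thesis unfolding psd_def 1 using X 2 by auto
qed

text \<open>Cholesky factorisation by induction on the index set: \<open>K'\<close> is the Schur
  complement after eliminating \<open>a\<close>. Division by zero is harmless, because a vanishing
  pivot \<open>K a a\<close> forces the whole row of \<open>a\<close> to vanish.\<close>

lemma psd_kernel_gram:
  fixes K :: "'a \<Rightarrow> 'a \<Rightarrow> real"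
  assumes "finite I" "\<And>i j. i \<in> I \<Longrightarrow> j \<in> I \<Longrightarrow> K i j = K j i"
    and "\<And>z. 0 \<le> (\<Sum>i\<in>I. \<Sum>j\<in>I. z i * z j * K i j)"
  shows "\<exists>w. \<forall>i\<in>I. \<forall>j\<in>I. K i j = (\<Sum>a\<in>I. w a i * w a j)"
  using assms
proof (induction I arbitrary: K rule: finite_induct)
  case empty
  thus ?case by simp
next
  case (insert a I)
  define K' where "K' i j = K i j - K a i * K a j / K a a" for i j
  have split: "(\<Sum>i\<in>insert a I. \<Sum>j\<in>insert a I. z i * z j * K i j)
     = z a * z a * K a a + 2 * z a * (\<Sum>j\<in>I. z j * K a j) + (\<Sum>i\<in>I. \<Sum>j\<in>I. z i * z j * K i j)" for z
  proof -
    have "(\<Sum>i\<in>I. z i * z a * K i a) = z a * (\<Sum>i\<in>I. z i * K a i)"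
      by (auto simp: sum_distrib_left insert.prems(1) mult_ac intro!: sum.cong)
    moreover have "(\<Sum>j\<in>I. z a * z j * K a j) = z a * (\<Sum>j\<in>I. z j * K a j)"
      by (auto simp: sum_distrib_left mult_ac intro!: sum.cong)
    ultimately show ?thesis
      using insert.hyps by (simp add: sum.distrib algebra_simps)
  qed
  have Kaa: "K a a \<ge> 0"
  proof -
    have "(\<Sum>j\<in>I. (if j = a then 1 else 0) * K a j) = 0"
      using insert.hyps by (intro sum.neutral) auto
    moreover have "(\<Sum>i\<in>I. \<Sum>j\<in>I. (if i = a then 1 else 0) * (if j = a then 1 else 0) * K i j) = 0"
      using insert.hyps by (intro sum.neutral ballI) auto
    ultimately show ?thesis
      using insert.prems(2)[of "\<lambda>i. if i = a then 1 else 0"] unfolding split by simp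
  qed
  have row: "K a i = 0" if "K a a = 0" "i \<in> I" for i
  proof (rule ccontr)
    assume nz: "K a i \<noteq> 0"
    \<comment> \<open>With a zero pivot the form is affine in the coordinate at \<open>a\<close>;
      this \<open>t\<close> makes its value -1.\<close>
    define t where "t = - (K i i + 1) / (2 * K a i)"
    define z where "z j = (if j = a then t else if j = i then 1 else 0)" for j
    have ia: "i \<noteq> a" using insert.hyps that by auto
    have "(\<Sum>j\<in>I. z j * K a j) = (\<Sum>j\<in>I. if j = i then K a i else 0)"
      using insert.hyps ia by (intro sum.cong) (auto simp: z_def)
    hence 1: "(\<Sum>j\<in>I. z j * K a j) = K a i" using that insert.hyps by simp
    have "(\<Sum>k\<in>I. \<Sum>j\<in>I. z k * z j * K k j) = (\<Sum>k\<in>I. \<Sum>j\<in>I. if k = i then if j = i then K i i else 0 else 0)"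
      using insert.hyps ia by (intro sum.cong) (auto simp: z_def)
    also have "\<dots> = (\<Sum>k\<in>I. if k = i then K i i else 0)"
      using that insert.hyps by (intro sum.cong) auto
    finally have 2: "(\<Sum>k\<in>I. \<Sum>j\<in>I. z k * z j * K k j) = K i i" using that insert.hyps by simp
    have "0 \<le> 2 * t * K a i + K i i"
      using insert.prems(2)[of z] unfolding split 1 2 using that by (simp add: z_def)
    also have "\<dots> = -1" using nz by (simp add: t_def field_simps)
    finally show False by simp
  qed
  have psd': "0 \<le> (\<Sum>i\<in>I. \<Sum>j\<in>I. z i * z j * K' i j)" for z
  proof -
    define s where "s = (\<Sum>j\<in>I. z j * K a j)"
    \<comment> \<open>The coordinate at \<open>a\<close> minimises the form (completing the square);
      for a zero pivot it is simply 0.\<close>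
    define z' where "z' j = (if j = a then - s / K a a else z j)" for j
    have 1: "(\<Sum>j\<in>I. z' j * K a j) = s"
      unfolding s_def using insert.hyps by (intro sum.cong) (auto simp: z'_def)
    have 2: "(\<Sum>i\<in>I. \<Sum>j\<in>I. z' i * z' j * K i j) = (\<Sum>i\<in>I. \<Sum>j\<in>I. z i * z j * K i j)"
      using insert.hyps by (intro sum.cong) (auto simp: z'_def)
    have "(\<Sum>i\<in>I. \<Sum>j\<in>I. z i * z j * K' i j)
        = (\<Sum>i\<in>I. \<Sum>j\<in>I. z i * z j * K i j) - (\<Sum>i\<in>I. \<Sum>j\<in>I. (z i * K a i) * (z j * K a j)) / K a a"
      by (simp add: K'_def algebra_simps sum_subtractf sum_divide_distrib)
    also have "(\<Sum>i\<in>I. \<Sum>j\<in>I. (z i * K a i) * (z j * K a j)) = s * s"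
      unfolding s_def sum_product ..
    finally have 3: "(\<Sum>i\<in>I. \<Sum>j\<in>I. z i * z j * K' i j)
        = (\<Sum>i\<in>I. \<Sum>j\<in>I. z i * z j * K i j) - s * s / K a a" .
    show ?thesis
      using insert.prems(2)[of z'] unfolding split 1 2 3
      by (cases "K a a = 0") (auto simp: z'_def field_simps power2_eq_square)
  qed
  have "\<exists>w. \<forall>i\<in>I. \<forall>j\<in>I. K' i j = (\<Sum>a\<in>I. w a i * w a j)"
    using insert.prems(1) by (intro insert.IH psd') (auto simp: K'_def)
  then obtain w where w: "\<And>i j. i \<in> I \<Longrightarrow> j \<in> I \<Longrightarrow> K' i j = (\<Sum>a\<in>I. w a i * w a j)" by blast
  define w' where "w' b i = (if b = a then K a i / sqrt (K a a) else if i = a then 0 else w b i)" for b i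
  have sq: "K a i / sqrt (K a a) * (K a j / sqrt (K a a)) = K a i * K a j / K a a" for i j
    using Kaa by (simp add: field_simps)
  have "K i j = (\<Sum>b\<in>insert a I. w' b i * w' b j)" if i: "i \<in> insert a I" and j: "j \<in> insert a I" for i j
  proof -
    have s: "(\<Sum>b\<in>insert a I. w' b i * w' b j)
        = K a i * K a j / K a a + (\<Sum>b\<in>I. w' b i * w' b j)"
      using insert.hyps sq by (simp add: w'_def)
    have s2: "(\<Sum>b\<in>I. w' b i * w' b j) = (if i = a \<or> j = a then 0 else K' i j)"
    proof (cases "i = a \<or> j = a")
      case True
      thus ?thesis using insert.hyps by (auto simp: w'_def intro!: sum.neutral)
    next
      case False
      hence "(\<Sum>b\<in>I. w' b i * w' b j) = (\<Sum>b\<in>I. w b i * w b j)"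
        using insert.hyps by (intro sum.cong) (auto simp: w'_def)
      thus ?thesis using False w i j by simp
    qed
    show ?thesis
    proof (cases "i = a \<or> j = a")
      case False
      thus ?thesis unfolding s s2 by (simp add: K'_def)
    next
      case True
      have "K i j = K a i * K a j / K a a"
      proof (cases "K a a = 0")
        case 0: True
        have "K a k = 0" if "k \<in> insert a I" for k using row[OF 0] that 0 by blast
        thus ?thesis using True i j insert.prems(1)[OF i j] by auto
      next
        case False
        thus ?thesis using True insert.prems(1)[OF i j] by auto
      qed
      thus ?thesis unfolding s s2 using True by simp
    qed
  qed
  thus ?case by blast
qed

text \<open>A Gram factorisation of \<open>B\<close> turns the trace into a sum of values of the
  quadratic form of \<open>A\<close>.\<close>

lemma trace_mult_psd_nonneg:
  assumes A: "A \<in> carrier_mat n n" "psd A" and B: "B \<in> carrier_mat n n" "psd B"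
  shows "0 \<le> trace (A * B)"
proof -
  have "\<exists>w. \<forall>i\<in>{..<n}. \<forall>j\<in>{..<n}. B $$ (i,j) = (\<Sum>a\<in>{..<n}. w a i * w a j)"
    using psd_iff[OF B(1)] B(2) by (intro psd_kernel_gram) auto
  then obtain w where w: "\<And>i j. i < n \<Longrightarrow> j < n \<Longrightarrow> B $$ (i,j) = (\<Sum>a<n. w a i * w a j)" by auto
  have "trace (A * B) = (\<Sum>i<n. \<Sum>j<n. \<Sum>a<n. w a i * w a j * A $$ (i,j))"
    unfolding trace_mult[OF A(1) B(1)]
    by (intro sum.cong refl) (simp add: w sum_distrib_left mult_ac)
  also have "\<dots> = (\<Sum>i<n. \<Sum>a<n. \<Sum>j<n. w a i * w a j * A $$ (i,j))"
    by (intro sum.cong refl sum.swap)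
  also have "\<dots> = (\<Sum>a<n. \<Sum>i<n. \<Sum>j<n. w a i * w a j * A $$ (i,j))"
    by (rule sum.swap)
  also have "\<dots> \<ge> 0"
  proof (rule sum_nonneg)
    fix a
    show "0 \<le> (\<Sum>i<n. \<Sum>j<n. w a i * w a j * A $$ (i,j))"
      using psd_iff[OF A(1)] A(2) by blast
  qed
  finally show ?thesis .
qed

lemma psd_congruence:
  assumes X: "X \<in> carrier_mat n n" "psd X" and P: "P \<in> carrier_mat n n"
  shows "psd (transpose_mat P * X * P)"
proof -
  have sym: "transpose_mat X = X" using X by (simp add: psd_def)
  have "transpose_mat (transpose_mat P * X * P) = transpose_mat P * X * P"
    using X P by (simp add: sym transpose_mult[of _ n n _ n] assoc_mult_mat[of _ n n _ n _ n])
  moreover have "0 \<le> scalar_prod v ((transpose_mat P * X * P) *\<^sub>v v)" if v: "v \<in> carrier_vec n" for v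
  proof -
    have "scalar_prod v ((transpose_mat P * X * P) *\<^sub>v v)
        = scalar_prod v (transpose_mat P *\<^sub>v (X *\<^sub>v (P *\<^sub>v v)))"
      using X P v by (simp add: assoc_mult_mat_vec[of _ n n _ n])
    also have "\<dots> = scalar_prod (transpose_mat P *\<^sub>v (X *\<^sub>v (P *\<^sub>v v))) v"
      using X P v by (intro comm_scalar_prod[of _ n]) auto
    also have "\<dots> = scalar_prod (X *\<^sub>v (P *\<^sub>v v)) (P *\<^sub>v v)"
      using X P v by (intro transpose_vec_mult_scalar[of _ n n]) auto
    also have "\<dots> = scalar_prod (P *\<^sub>v v) (X *\<^sub>v (P *\<^sub>v v))"
      using X P v by (intro comm_scalar_prod[of _ n]) auto
    also have "\<dots> \<ge> 0" using X P v by (auto simp: psd_def)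
    finally show ?thesis .
  qed
  ultimately show ?thesis using P by (auto simp: psd_def)
qed

text \<open>Jacobi's formula at the identity, read off the Leibniz expansion: a permutation other
  than \<open>id\<close> moves some \<open>j\<close> and also \<open>p j\<close>, so its product has
  at least two factors vanishing at 0 and contributes nothing to the derivative.\<close>

lemma has_field_derivative_det_one_plus:
  assumes K: "K \<in> carrier_mat n n"
  shows "((\<lambda>t. Determinant.det (1\<^sub>m n + t \<cdot>\<^sub>m K)) has_field_derivative trace K) (at (0::real))"
proof -
  define f where "f p i t = (if i = p i then 1 else 0) + t * K $$ (i, p i)" for p i and t :: real
  have det: "Determinant.det (1\<^sub>m n + t \<cdot>\<^sub>m K)
      = (\<Sum>p | p permutes {0..<n}. signof p * (\<Prod>i\<in>{0..<n}. f p i t))" for t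
  proof -
    have "Determinant.det (1\<^sub>m n + t \<cdot>\<^sub>m K)
      = (\<Sum>p | p permutes {0..<n}. signof p * (\<Prod>i\<in>{0..<n}. (1\<^sub>m n + t \<cdot>\<^sub>m K) $$ (i, p i)))"
      using K by (intro det_def') auto
    also have "\<dots> = (\<Sum>p | p permutes {0..<n}. signof p * (\<Prod>i\<in>{0..<n}. f p i t))"
      using K by (intro sum.cong prod.cong refl arg_cong2[where f="(*)"])
        (auto simp: f_def permutes_in_image)
    finally show ?thesis .
  qed
  have der: "((\<lambda>t. \<Prod>i\<in>{0..<n}. f p i t) has_field_derivative
      (if p = id then trace K else 0)) (at 0)" if p: "p permutes {0..<n}" for p
  proof -
    have "((\<lambda>t. \<Prod>i\<in>{0..<n}. f p i t) has_field_derivative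
        (\<Sum>i\<in>{0..<n}. K $$ (i, p i) * (\<Prod>j\<in>{0..<n} - {i}. f p j 0))) (at 0)"
      unfolding f_def by (intro has_field_derivative_prod) (auto intro!: derivative_eq_intros)
    moreover have "(\<Sum>i\<in>{0..<n}. K $$ (i, p i) * (\<Prod>j\<in>{0..<n} - {i}. f p j 0))
        = (if p = id then trace K else 0)"
    proof (cases "p = id")
      case True
      thus ?thesis using K by (simp add: f_def trace_def atLeast0LessThan)
    next
      case False
      have "(\<Prod>j\<in>{0..<n} - {i}. f p j 0) = 0" if "i < n" for i
      proof -
        obtain j where j: "p j \<noteq> j" using False by (auto simp: fun_eq_iff)
        have inj: "inj p" using p permutes_inj by blast
        have jn: "j < n" using j p by (metis atLeastLessThan_iff leI permutes_not_in zero_le)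
        have pjn: "p j < n" using p jn permutes_in_image[OF p, of j] by simp
        have "p (p j) \<noteq> p j" using j inj by (metis injD)
        hence "\<exists>k\<in>{0..<n} - {i}. p k \<noteq> k"
          using j jn pjn by (cases "i = j") auto
        then obtain k where "k \<in> {0..<n} - {i}" "p k \<noteq> k" by blast
        thus ?thesis by (intro prod_zero bexI[of _ k]) (auto simp: f_def)
      qed
      hence "(\<Sum>i\<in>{0..<n}. K $$ (i, p i) * (\<Prod>j\<in>{0..<n} - {i}. f p j 0)) = 0"
        by (intro sum.neutral) simp
      thus ?thesis using False by simp
    qed
    ultimately show ?thesis by simp
  qed
  have "((\<lambda>t. \<Sum>p | p permutes {0..<n}. signof p * (\<Prod>i\<in>{0..<n}. f p i t)) has_field_derivative
      (\<Sum>p | p permutes {0..<n}. signof p * (if p = id then trace K else 0))) (at 0)"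
    by (intro DERIV_sum DERIV_cmult der) auto
  moreover have "(\<Sum>p | p permutes {0..<n}. signof p * (if p = id then trace K else 0)) = trace K"
  proof -
    have "(\<Sum>p | p permutes {0..<n}. signof p * (if p = id then trace K else 0))
        = (\<Sum>p | p permutes {0..<n}. if p = id then signof p * trace K else 0)"
      by (intro sum.cong) auto
    also have "\<dots> = trace K"
      by (subst sum.delta) (auto simp: finite_permutations permutes_id)
    finally show ?thesis .
  qed
  ultimately show ?thesis unfolding det by simp
qed

section \<open>The log-determinant regularisation\<close>

lemma sdp_feasible_iff:
  "X \<in> sdp_feasible n \<longleftrightarrow> X \<in> carrier_mat n n \<and> (\<forall>i<n. X $$ (i,i) = 1) \<and>
    (\<forall>i<n. \<forall>j<n. X $$ (i,j) = X $$ (j,i)) \<and>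
    (\<forall>z :: nat \<Rightarrow> real. 0 \<le> (\<Sum>i<n. \<Sum>j<n. z i * z j * X $$ (i,j)))"
  using psd_iff[of X n] unfolding sdp_feasible_def by blast

lemma one_mat_sdp_feasible: "1\<^sub>m n \<in> sdp_feasible n"
proof -
  have "(\<Sum>i<n. \<Sum>j<n. z i * z j * (1\<^sub>m n :: real Matrix.mat) $$ (i,j)) = (\<Sum>i<n. z i * z i)" for z
    by (intro sum.cong refl) (simp add: if_distrib cong: if_cong)
  thus ?thesis unfolding sdp_feasible_iff by (auto intro!: sum_nonneg)
qed

text \<open>The form is evaluated at a vector with entry 1 at \<open>i\<close> and entry
  \<open>s\<close> at \<open>j\<close>, for both signs \<open>s\<close>.\<close>

lemma sdp_feasible_entry_bound:
  assumes X: "X \<in> sdp_feasible n" and i: "i < n" and j: "j < n"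
  shows "\<bar>X $$ (i,j)\<bar> \<le> 1"
proof (cases "i = j")
  case True
  thus ?thesis using X i by (simp add: sdp_feasible_iff)
next
  case False
  have *: "0 \<le> 2 + 2 * s * X $$ (i,j)" if "s * s = 1" for s :: real
  proof -
    define z where "z k = (if k = i then 1 else if k = j then s else 0)" for k
    have "(\<Sum>k<n. \<Sum>l<n. z k * z l * X $$ (k,l))
        = (\<Sum>k\<in>{i,j}. \<Sum>l<n. z k * z l * X $$ (k,l))"
      using i j by (intro sum.mono_neutral_right) (auto simp: z_def)
    also have "\<dots> = (\<Sum>k\<in>{i,j}. \<Sum>l\<in>{i,j}. z k * z l * X $$ (k,l))"
      using i j by (intro sum.cong sum.mono_neutral_right) (auto simp: z_def)
    also have "\<dots> = 2 + 2 * s * X $$ (i,j)"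
      using X i j False that by (simp add: z_def sdp_feasible_iff)
    finally have eq: "(\<Sum>k<n. \<Sum>l<n. z k * z l * X $$ (k,l)) = 2 + 2 * s * X $$ (i,j)" .
    have "0 \<le> (\<Sum>k<n. \<Sum>l<n. z k * z l * X $$ (k,l))"
      using X unfolding sdp_feasible_iff by blast
    thus ?thesis unfolding eq .
  qed
  show ?thesis using *[of 1] *[of "-1"] by auto
qed

lemma sdp_feasible_convex:
  assumes X: "X \<in> sdp_feasible n" and Y: "Y \<in> sdp_feasible n" and t: "0 \<le> t" "t \<le> 1"
  shows "X + t \<cdot>\<^sub>m (Y - X) \<in> sdp_feasible n"
proof -
  have c: "X \<in> carrier_mat n n" "Y \<in> carrier_mat n n" using X Y by (auto simp: sdp_feasible_iff)
  have "(\<Sum>i<n. \<Sum>j<n. z i * z j * (X + t \<cdot>\<^sub>m (Y - X)) $$ (i,j))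
      = (1 - t) * (\<Sum>i<n. \<Sum>j<n. z i * z j * X $$ (i,j)) + t * (\<Sum>i<n. \<Sum>j<n. z i * z j * Y $$ (i,j))" for z
    unfolding sum_distrib_left sum.distrib[symmetric] using c
    by (intro sum.cong refl) (auto simp: algebra_simps)
  moreover have "0 \<le> (1 - t) * (\<Sum>i<n. \<Sum>j<n. z i * z j * X $$ (i,j))
      + t * (\<Sum>i<n. \<Sum>j<n. z i * z j * Y $$ (i,j))" for z
    using X Y t by (intro add_nonneg_nonneg mult_nonneg_nonneg) (auto simp: sdp_feasible_iff)
  moreover have "(X + t \<cdot>\<^sub>m (Y - X)) $$ (i,i) = 1" if "i < n" for i
    using X Y that c by (auto simp: sdp_feasible_iff)
  moreover have "(X + t \<cdot>\<^sub>m (Y - X)) $$ (i,j) = (X + t \<cdot>\<^sub>m (Y - X)) $$ (j,i)" if "i < n" "j < n" for i j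
  proof -
    have "X $$ (i,j) = X $$ (j,i)" "Y $$ (i,j) = Y $$ (j,i)"
      using X Y that by (auto simp: sdp_feasible_iff)
    thus ?thesis using that c by auto
  qed
  ultimately show ?thesis using c unfolding sdp_feasible_iff by (simp add: minus_carrier_mat)
qed

text \<open>Matrices are encoded as functions on index pairs so that the product topology applies.
  Demanding 0 outside the square places the set in a cube, which is compact by Tychonoff; the
  remaining constraints are closed conditions on finitely many coordinates each.\<close>

lemma compact_sdp_feasible_fun:
  "compact {f :: nat \<times> nat \<Rightarrow> real. (\<forall>p. p \<notin> {..<n} \<times> {..<n} \<longrightarrow> f p = 0) \<and> Matrix.mat n n f \<in> sdp_feasible n}"
  (is "compact ?K")
proof -
  have cont: "continuous_on UNIV (\<lambda>f :: nat \<times> nat \<Rightarrow> real. f p)" for p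
    by (rule continuous_on_product_coordinates)
  define C :: "(nat \<times> nat \<Rightarrow> real) set" where "C = PiE UNIV (\<lambda>p. {-1..1})"
  have "compactin (product_topology (\<lambda>i :: nat \<times> nat. euclidean) UNIV) C"
    unfolding C_def by (subst compactin_PiE) auto
  hence "compact C" by (simp add: euclidean_product_topology)
  moreover have "closed ?K"
  proof -
    have eq: "?K = (\<Inter>p\<in>- ({..<n} \<times> {..<n}). {f. f p = 0}) \<inter> (\<Inter>i\<in>{..<n}. {f. f (i,i) = 1})
      \<inter> (\<Inter>i\<in>{..<n}. \<Inter>j\<in>{..<n}. {f. f (i,j) = f (j,i)})
      \<inter> (\<Inter>z. {f. 0 \<le> (\<Sum>i<n. \<Sum>j<n. z i * z j * f (i,j))})"
      by (auto simp: sdp_feasible_iff)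
    show ?thesis unfolding eq
      by (intro closed_Int closed_INT ballI closed_Collect_eq closed_Collect_le continuous_intros cont)
  qed
  moreover have "?K \<subseteq> C"
  proof
    fix f assume f: "f \<in> ?K"
    have "\<bar>f p\<bar> \<le> 1" for p
    proof (cases "p \<in> {..<n} \<times> {..<n}")
      case False
      hence "f p = 0" using f by blast
      thus ?thesis by simp
    next
      case True
      then obtain i j where p: "p = (i,j)" "i < n" "j < n" by auto
      have "Matrix.mat n n f \<in> sdp_feasible n" using f by simp
      from sdp_feasible_entry_bound[OF this p(2,3)] show ?thesis using p by simp
    qed
    thus "f \<in> C" by (auto simp: C_def abs_le_iff minus_le_iff)
  qed
  ultimately show ?thesis
    using closed_Int_compact[of ?K C] by (simp add: inf.absorb1)
qed

text \<open>
  This maximises \<open>mat_inner M X + ln (det X)\<close>; exponentiating keeps the objective continuous up to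
  the boundary of the feasible set.
\<close>

lemma log_det_maximizer:
  fixes M :: "real Matrix.mat"
  assumes M: "M \<in> carrier_mat n n"
  obtains X where "X \<in> sdp_feasible n" "0 < Determinant.det X"
    "\<And>Y. Y \<in> sdp_feasible n \<Longrightarrow>
      exp (mat_inner M Y) * Determinant.det Y \<le> exp (mat_inner M X) * Determinant.det X"
proof -
  define K where "K = {f :: nat \<times> nat \<Rightarrow> real.
    (\<forall>p. p \<notin> {..<n} \<times> {..<n} \<longrightarrow> f p = 0) \<and> Matrix.mat n n f \<in> sdp_feasible n}"
  define \<Phi> where "\<Phi> f = exp (\<Sum>i<n. \<Sum>j<n. M $$ (i,j) * f (i,j)) *
    (\<Sum>p | p permutes {0..<n}. signof p * (\<Prod>i\<in>{0..<n}. f (i, p i)))" for f :: "nat \<times> nat \<Rightarrow> real"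
  define emb where "emb X = (\<lambda>p. if p \<in> {..<n} \<times> {..<n} then X $$ p else 0)" for X :: "real Matrix.mat"
  have \<Phi>: "\<Phi> f = exp (mat_inner M (Matrix.mat n n f)) * Determinant.det (Matrix.mat n n f)" for f
  proof -
    have "Determinant.det (Matrix.mat n n f)
        = (\<Sum>p | p permutes {0..<n}. signof p * (\<Prod>i\<in>{0..<n}. Matrix.mat n n f $$ (i, p i)))"
      by (intro det_def') auto
    also have "\<dots> = (\<Sum>p | p permutes {0..<n}. signof p * (\<Prod>i\<in>{0..<n}. f (i, p i)))"
      by (intro sum.cong prod.cong refl arg_cong2[where f="(*)"]) (auto simp: permutes_in_image)
    finally show ?thesis unfolding \<Phi>_def using mat_inner_eq[OF M, of "Matrix.mat n n f"] by simp
  qed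
  have emb: "Matrix.mat n n (emb X) = X" if "X \<in> carrier_mat n n" for X
    using that by (auto simp: emb_def mat_eq_iff)
  have embK: "emb X \<in> K" if "X \<in> sdp_feasible n" for X
    using emb[of X] that by (auto simp: K_def sdp_feasible_def emb_def)
  have cont: "continuous_on A (\<lambda>f :: nat \<times> nat \<Rightarrow> real. f p)" for p A
    by (rule continuous_on_subset[OF continuous_on_product_coordinates]) auto
  have "continuous_on K \<Phi>"
    unfolding \<Phi>_def by (intro continuous_intros cont)
  then obtain f where f: "f \<in> K" "\<And>g. g \<in> K \<Longrightarrow> \<Phi> g \<le> \<Phi> f"
    using continuous_attains_sup[of K \<Phi>] compact_sdp_feasible_fun[of n] embK[OF one_mat_sdp_feasible]
    unfolding K_def by blast
  define X where "X = Matrix.mat n n f"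
  have max: "exp (mat_inner M Y) * Determinant.det Y \<le> exp (mat_inner M X) * Determinant.det X"
    if "Y \<in> sdp_feasible n" for Y
    using f(2)[OF embK[OF that]] emb[of Y] that by (simp add: \<Phi> X_def sdp_feasible_def)
  \<comment> \<open>The identity matrix is a competitor with determinant 1, so the maximal value is
    positive.\<close>
  have "0 < exp (mat_inner M X) * Determinant.det X"
    using max[OF one_mat_sdp_feasible] by (intro less_le_trans[OF _ max[OF one_mat_sdp_feasible]]) simp
  hence "0 < Determinant.det X" by (simp add: zero_less_mult_iff)
  thus ?thesis using that max f(1) by (auto simp: K_def X_def)
qed

section \<open>First-order optimality of the regularised problem\<close>

lemma mat_inner_add_smult:
  assumes "M \<in> carrier_mat n n" "X \<in> carrier_mat n n" "H \<in> carrier_mat n n"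
  shows "mat_inner M (X + t \<cdot>\<^sub>m H) = mat_inner M X + t * mat_inner M H"
proof -
  have "mat_inner M (X + t \<cdot>\<^sub>m H) = (\<Sum>i<n. \<Sum>j<n. M $$ (i,j) * (X + t \<cdot>\<^sub>m H) $$ (i,j))"
    using assms by (intro mat_inner_eq) auto
  also have "\<dots> = mat_inner M X + t * mat_inner M H"
    unfolding mat_inner_eq[OF assms(1,2)] mat_inner_eq[OF assms(1,3)]
      sum_distrib_left sum.distrib[symmetric]
    using assms by (intro sum.cong refl) (auto simp: algebra_simps)
  finally show ?thesis .
qed

text \<open>The objective is differentiated along the segment from \<open>X\<close> to
  \<open>Y\<close>, which stays feasible by convexity. Writing
  \<open>X + t \<cdot>\<^sub>m H\<close> as
  \<open>X * (1\<^sub>m n + t \<cdot>\<^sub>m (Xi * H))\<close> reduces the determinant to its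
  derivative at the identity. A positive slope would contradict maximality, and the positive value
  of the objective at \<open>X\<close> factors out of the slope.\<close>

lemma log_det_optimum:
  fixes M :: "real Matrix.mat"
  assumes M: "M \<in> carrier_mat n n"
  obtains X Xi where "X \<in> sdp_feasible n" "Xi \<in> carrier_mat n n" "X * Xi = 1\<^sub>m n" "Xi * X = 1\<^sub>m n"
    "\<And>Y. Y \<in> sdp_feasible n \<Longrightarrow> mat_inner M (Y - X) + trace (Xi * (Y - X)) \<le> 0"
proof -
  from log_det_maximizer[OF M] obtain X where X: "X \<in> sdp_feasible n" "0 < Determinant.det X"
    and max: "\<And>Y. Y \<in> sdp_feasible n \<Longrightarrow>
      exp (mat_inner M Y) * Determinant.det Y \<le> exp (mat_inner M X) * Determinant.det X" by blast
  have Xc: "X \<in> carrier_mat n n" using X by (simp add: sdp_feasible_def)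
  obtain Xi where Xi: "Xi \<in> carrier_mat n n" "X * Xi = 1\<^sub>m n" "Xi * X = 1\<^sub>m n"
  proof -
    have "X \<in> Units (ring_mat TYPE(real) n ())"
      using det_non_zero_imp_unit[OF Xc, of "()"] X(2) by simp
    thus ?thesis using that by (auto simp: Units_def ring_mat_def)
  qed
  have "mat_inner M (Y - X) + trace (Xi * (Y - X)) \<le> 0" if Y: "Y \<in> sdp_feasible n" for Y
  proof -
    define H where "H = Y - X"
    have Yc: "Y \<in> carrier_mat n n" using Y by (simp add: sdp_feasible_def)
    have H: "H \<in> carrier_mat n n" unfolding H_def by (rule minus_carrier_mat[OF Xc])
    define \<phi> where "\<phi> t = exp (mat_inner M X + t * mat_inner M H) *
      (Determinant.det X * Determinant.det (1\<^sub>m n + t \<cdot>\<^sub>m (Xi * H)))" for t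
    have \<phi>: "\<phi> t = exp (mat_inner M (X + t \<cdot>\<^sub>m H)) * Determinant.det (X + t \<cdot>\<^sub>m H)" for t
    proof -
      have "X * (1\<^sub>m n + t \<cdot>\<^sub>m (Xi * H)) = X * 1\<^sub>m n + X * (t \<cdot>\<^sub>m (Xi * H))"
        using Xc Xi H by (intro mult_add_distrib_mat[of _ n n _ n]) auto
      also have "X * (t \<cdot>\<^sub>m (Xi * H)) = t \<cdot>\<^sub>m (X * (Xi * H))"
        using Xc Xi H by (intro mult_smult_distrib[of _ n n _ n]) auto
      also have "X * (Xi * H) = H"
        using Xc Xi H by (simp add: assoc_mult_mat[symmetric, of _ n n _ n _ n])
      finally have "X + t \<cdot>\<^sub>m H = X * (1\<^sub>m n + t \<cdot>\<^sub>m (Xi * H))" using Xc by simp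
      thus ?thesis unfolding \<phi>_def mat_inner_add_smult[OF M Xc H]
        using Xc Xi H by (simp add: det_mult[of _ n])
    qed
    have der: "(\<phi> has_field_derivative
        (exp (mat_inner M X) * Determinant.det X) * (mat_inner M H + trace (Xi * H))) (at 0)"
    proof -
      have K: "Xi * H \<in> carrier_mat n n" using Xi H by simp
      have d0: "Determinant.det (1\<^sub>m n + 0 \<cdot>\<^sub>m (Xi * H)) = 1"
      proof -
        have "1\<^sub>m n + 0 \<cdot>\<^sub>m (Xi * H) = 1\<^sub>m n"
            using Xi H by (intro eq_matI) auto
        thus ?thesis by simp
      qed
      have "((\<lambda>t. exp (mat_inner M X + t * mat_inner M H)) has_field_derivative
          exp (mat_inner M X) * mat_inner M H) (at 0)"
        by (auto intro!: derivative_eq_intros)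
      from DERIV_mult[OF this DERIV_cmult[OF has_field_derivative_det_one_plus[OF K], of "Determinant.det X"]]
      show ?thesis unfolding \<phi>_def by (simp add: d0 algebra_simps)
    qed
    show ?thesis
    proof (rule ccontr)
      assume "\<not> ?thesis"
      hence "0 < (exp (mat_inner M X) * Determinant.det X) * (mat_inner M H + trace (Xi * H))"
        using X(2) by (simp add: H_def)
      from DERIV_pos_inc_right[OF der this] obtain e where
        e: "e > 0" "\<And>h. 0 < h \<Longrightarrow> h < e \<Longrightarrow> \<phi> 0 < \<phi> (0 + h)" by blast
      define h where "h = min (e / 2) 1"
      have h: "0 < h" "h < e" "h \<le> 1" using e(1) by (auto simp: h_def)
      have "\<phi> h \<le> exp (mat_inner M X) * Determinant.det X"
        unfolding \<phi> H_def using h by (intro max sdp_feasible_convex X Y) auto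
      moreover have "\<phi> 0 = exp (mat_inner M X) * Determinant.det X"
      proof -
        have "X + 0 \<cdot>\<^sub>m H = X" using Xc H by (auto simp: mat_eq_iff)
        thus ?thesis by (simp add: \<phi>)
      qed
      ultimately show False using e(2)[of h] h by simp
    qed
  qed
  thus ?thesis using that X(1) Xi by blast
qed

text \<open>Congruence of \<open>X\<close> by \<open>Xi\<close> gives the transpose of
  \<open>Xi\<close>, which is then symmetric because \<open>psd\<close> includes symmetry.\<close>

lemma psd_inverse:
  assumes X: "X \<in> carrier_mat n n" "psd X" and Xi: "Xi \<in> carrier_mat n n" "X * Xi = 1\<^sub>m n"
  shows "psd Xi"
proof -
  have "psd (transpose_mat Xi * X * Xi)" by (rule psd_congruence[OF X Xi(1)])
  also have "transpose_mat Xi * X * Xi = transpose_mat Xi * (X * Xi)"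
    using X Xi(1) by (intro assoc_mult_mat[of _ n n _ n _ n]) auto
  also have "\<dots> = transpose_mat Xi" using Xi by simp
  finally have 1: "psd (transpose_mat Xi)" .
  hence "transpose_mat (transpose_mat Xi) = transpose_mat Xi" by (simp add: psd_def)
  thus ?thesis using 1 by simp
qed

text \<open>The choice is made by the variational inequality rather than by maximality: in this form
  optima for different \<open>M\<close> can be compared.\<close>

definition reg_optimum :: "nat \<Rightarrow> real Matrix.mat \<Rightarrow> real Matrix.mat" where
  "reg_optimum n M = (SOME X. X \<in> sdp_feasible n \<and> (\<exists>Xi \<in> carrier_mat n n. X * Xi = 1\<^sub>m n \<and> Xi * X = 1\<^sub>m n \<and>
     (\<forall>Y \<in> sdp_feasible n. mat_inner M (Y - X) + trace (Xi * (Y - X)) \<le> 0)))"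

lemma reg_optimum:
  assumes "M \<in> carrier_mat n n"
  shows "reg_optimum n M \<in> sdp_feasible n"
    and "\<exists>Xi \<in> carrier_mat n n. reg_optimum n M * Xi = 1\<^sub>m n \<and> Xi * reg_optimum n M = 1\<^sub>m n \<and>
     (\<forall>Y \<in> sdp_feasible n. mat_inner M (Y - reg_optimum n M) + trace (Xi * (Y - reg_optimum n M)) \<le> 0)"
proof -
  have "\<exists>X. X \<in> sdp_feasible n \<and> (\<exists>Xi \<in> carrier_mat n n. X * Xi = 1\<^sub>m n \<and> Xi * X = 1\<^sub>m n \<and>
     (\<forall>Y \<in> sdp_feasible n. mat_inner M (Y - X) + trace (Xi * (Y - X)) \<le> 0))"
    using log_det_optimum[OF assms] by metis
  from someI_ex[OF this] show "reg_optimum n M \<in> sdp_feasible n"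
    and "\<exists>Xi \<in> carrier_mat n n. reg_optimum n M * Xi = 1\<^sub>m n \<and> Xi * reg_optimum n M = 1\<^sub>m n \<and>
     (\<forall>Y \<in> sdp_feasible n. mat_inner M (Y - reg_optimum n M) + trace (Xi * (Y - reg_optimum n M)) \<le> 0)"
    unfolding reg_optimum_def by blast+
qed

section \<open>Price and stability of the regularised optimum\<close>

lemma mat_inner_diff_right:
  assumes "M \<in> carrier_mat n n" "X \<in> carrier_mat n n" "Y \<in> carrier_mat n n"
  shows "mat_inner M (Y - X) = mat_inner M Y - mat_inner M X"
proof -
  have "mat_inner M (Y - X) = (\<Sum>i<n. \<Sum>j<n. M $$ (i,j) * (Y - X) $$ (i,j))"
    using assms by (intro mat_inner_eq) (auto simp: minus_carrier_mat)
  thus ?thesis unfolding mat_inner_eq[OF assms(1,2)] mat_inner_eq[OF assms(1,3)]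
    using assms by (simp add: algebra_simps sum_subtractf)
qed

lemma trace_mult_diff_right:
  assumes "M \<in> carrier_mat n n" "X \<in> carrier_mat n n" "Y \<in> carrier_mat n n"
  shows "trace (M * (Y - X)) = trace (M * Y) - trace (M * X)"
  using assms by (simp add: mult_minus_distrib_mat[of _ n n _ n] trace_diff[of _ n])

text \<open>In the optimality condition the barrier contributes
  \<open>trace (Xi * Y) - trace (Xi * X)\<close>. The first trace is nonnegative and the second is
  \<open>n\<close>, which is the entire price.\<close>

lemma mat_inner_le_reg_optimum:
  assumes M: "M \<in> carrier_mat n n" and Y: "Y \<in> sdp_feasible n"
  shows "mat_inner M Y \<le> mat_inner M (reg_optimum n M) + real n"
proof -
  define X where "X = reg_optimum n M"
  obtain Xi where Xi: "Xi \<in> carrier_mat n n" "X * Xi = 1\<^sub>m n" "Xi * X = 1\<^sub>m n"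
    and opt: "mat_inner M (Y - X) + trace (Xi * (Y - X)) \<le> 0"
    using reg_optimum(2)[OF M] Y unfolding X_def by blast
  have X: "X \<in> carrier_mat n n" "psd X"
    using reg_optimum(1)[OF M] by (auto simp: X_def sdp_feasible_def)
  have Yc: "Y \<in> carrier_mat n n" "psd Y" using Y by (auto simp: sdp_feasible_def)
  have "0 \<le> trace (Xi * Y)"
    by (intro trace_mult_psd_nonneg[of _ n] Xi Yc psd_inverse[OF X Xi(1,2)])
  hence "mat_inner M Y \<le> mat_inner M X + real n"
    using opt unfolding mat_inner_diff_right[OF M X(1) Yc(1)]
      trace_mult_diff_right[OF Xi(1) X(1) Yc(1)] Xi(3) trace_one by simp
  thus ?thesis by (simp add: X_def)
qed

text \<open>
  Data processing for the symmetrised relative entropy of two centred Gaussians: the test matrix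
  \<open>C\<close> plays the role of \<open>Xi - Yi\<close> and may be supported on few coordinates.
\<close>

lemma symmetric_divergence_lower_bound:
  assumes X: "X \<in> carrier_mat n n" "psd X" and Y: "Y \<in> carrier_mat n n" "psd Y"
    and Xi: "Xi \<in> carrier_mat n n" "X * Xi = 1\<^sub>m n" "Xi * X = 1\<^sub>m n"
    and Yi: "Yi \<in> carrier_mat n n" "Y * Yi = 1\<^sub>m n" "Yi * Y = 1\<^sub>m n"
    and C: "C \<in> carrier_mat n n" "transpose_mat C = C"
  shows "2 * trace (C * (Y - X)) - trace (C * X * (C * Y))
    \<le> trace (Xi * Y) + trace (Yi * X) - 2 * real n"
proof -
  define Q where "Q = Xi - Yi"
  define P where "P = Q - C"
  note c = X(1) Y(1) Xi(1) Yi(1) C(1)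
  have Q: "Q \<in> carrier_mat n n" unfolding Q_def using c by (intro minus_carrier_mat)
  have P: "P \<in> carrier_mat n n" unfolding P_def using c by (intro minus_carrier_mat)
  have QX: "Q * X = 1\<^sub>m n - Yi * X" unfolding Q_def
    using c Xi(3) by (simp add: minus_mult_distrib_mat[of _ n n _ _ n])
  have QY: "Q * Y = Xi * Y - 1\<^sub>m n" unfolding Q_def
    using c Yi(3) by (simp add: minus_mult_distrib_mat[of _ n n _ _ n])
  have "transpose_mat Xi = Xi" "transpose_mat Yi = Yi"
    using psd_inverse[OF X Xi(1,2)] psd_inverse[OF Y Yi(1,2)] by (auto simp: psd_def)
  hence Pt: "transpose_mat P = P" unfolding P_def Q_def
    using c C(2) by (simp add: transpose_minus[of _ n n] minus_carrier_mat)
  \<comment> \<open>The form \<open>trace (Q * X * (Q * Y))\<close> equals the divergence on the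
    right-hand side. Its nonnegativity at \<open>Q - C\<close> in place of \<open>Q\<close> is the
    claim, since both cross terms equal \<open>trace (C * (Y - X))\<close>.\<close>
  have "0 \<le> trace (transpose_mat P * X * P * Y)"
    using P X Y by (intro trace_mult_psd_nonneg[of _ n] psd_congruence[of _ n]) auto
  also have "transpose_mat P * X * P * Y = (P * X) * (P * Y)"
    unfolding Pt using P X Y by (intro assoc_mult_mat[of _ n n _ n _ n]) auto
  also have "(P * X) * (P * Y) = (Q * X - C * X) * (Q * Y - C * Y)"
    unfolding P_def using Q c by (simp add: minus_mult_distrib_mat[of _ n n _ _ n])
  also have "\<dots> = (Q * X) * (Q * Y) - (C * X) * (Q * Y) - ((Q * X) * (C * Y) - (C * X) * (C * Y))"
    using Q c by (simp add: minus_mult_distrib_mat[of _ n n _ _ n] mult_minus_distrib_mat[of _ n n _ n]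
        minus_carrier_mat mult_carrier_mat[of _ n n _ n])
  also have "trace \<dots> = trace ((Q * X) * (Q * Y)) - trace ((Q * X) * (C * Y))
      - trace ((C * X) * (Q * Y)) + trace ((C * X) * (C * Y))"
    using Q c by (simp add: trace_diff[of _ n] minus_carrier_mat mult_carrier_mat[of _ n n _ n])
  also have "trace ((Q * X) * (Q * Y)) = trace (Xi * Y) + trace (Yi * X) - 2 * real n"
  proof -
    have "(Yi * X) * (Xi * Y) = Yi * (X * (Xi * Y))"
      using c by (intro assoc_mult_mat[of _ n n _ n _ n]) auto
    also have "X * (Xi * Y) = Y"
      using c Xi by (simp add: assoc_mult_mat[symmetric, of _ n n _ n _ n])
    finally have e: "(Yi * X) * (Xi * Y) = 1\<^sub>m n" using Yi by simp
    have "(Q * X) * (Q * Y) = Xi * Y - (Yi * X) * (Xi * Y) - (1\<^sub>m n - Yi * X)"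
      unfolding QX QY using c
      by (simp add: minus_mult_distrib_mat[of _ n n _ _ n] mult_minus_distrib_mat[of _ n n _ n]
        minus_carrier_mat mult_carrier_mat[of _ n n _ n])
    thus ?thesis unfolding e using c
      by (simp add: trace_diff[of _ n] trace_one minus_carrier_mat mult_carrier_mat[of _ n n _ n])
  qed
  also have "trace ((Q * X) * (C * Y)) = trace (C * (Y - X))"
  proof -
    have "trace ((Yi * X) * (C * Y)) = trace ((C * Y) * (Yi * X))"
      using c by (intro trace_mult_comm[of _ n n]) auto
    also have "(C * Y) * (Yi * X) = C * (Y * (Yi * X))"
      using c by (intro assoc_mult_mat[of _ n n _ n _ n]) auto
    also have "Y * (Yi * X) = X"
      using c Yi by (simp add: assoc_mult_mat[symmetric, of _ n n _ n _ n])
    finally have e: "trace ((Yi * X) * (C * Y)) = trace (C * X)" .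
    have "(Q * X) * (C * Y) = C * Y - (Yi * X) * (C * Y)"
      unfolding QX using c by (simp add: minus_mult_distrib_mat[of _ n n _ _ n])
    thus ?thesis using c e
      by (simp add: trace_diff[of _ n] trace_mult_diff_right[of _ n] mult_carrier_mat[of _ n n _ n])
  qed
  also have "trace ((C * X) * (Q * Y)) = trace (C * (Y - X))"
  proof -
    have "(C * X) * (Xi * Y) = C * (X * (Xi * Y))"
      using c by (intro assoc_mult_mat[of _ n n _ n _ n]) auto
    also have "X * (Xi * Y) = Y"
      using c Xi by (simp add: assoc_mult_mat[symmetric, of _ n n _ n _ n])
    finally have e: "(C * X) * (Xi * Y) = C * Y" .
    have "(C * X) * (Q * Y) = C * Y - C * X"
      unfolding QY using c e by (simp add: mult_minus_distrib_mat[of _ n n _ n])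
    thus ?thesis using c
      by (simp add: trace_diff[of _ n] trace_mult_diff_right[of _ n] mult_carrier_mat[of _ n n _ n])
  qed
  finally show ?thesis by simp
qed

lemma mat_inner_pair_perturbation:
  assumes M: "M \<in> carrier_mat n n" and M': "M' \<in> carrier_mat n n" and Z: "Z \<in> carrier_mat n n"
    and i: "i < n" and j: "j < n" and ij: "i \<noteq> j"
    and pert: "\<And>k l. k < n \<Longrightarrow> l < n \<Longrightarrow> M' $$ (k,l) = M $$ (k,l) + (if {k,l} = {i,j} then s else 0)"
  shows "mat_inner M' Z = mat_inner M Z + s * Z $$ (i,j) + s * Z $$ (j,i)"
proof -
  have "(if {k,l} = {i,j} then s else 0) * Z $$ (k,l)
      = (if k = i then if l = j then s * Z $$ (i,j) else 0 else 0)
      + (if k = j then if l = i then s * Z $$ (j,i) else 0 else 0)" for k l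
    using ij by (auto simp: doubleton_eq_iff)
  hence "mat_inner M' Z = (\<Sum>k<n. \<Sum>l<n. M $$ (k,l) * Z $$ (k,l)
      + ((if k = i then if l = j then s * Z $$ (i,j) else 0 else 0)
      + (if k = j then if l = i then s * Z $$ (j,i) else 0 else 0)))"
    unfolding mat_inner_eq[OF M' Z] by (intro sum.cong refl) (simp add: pert distrib_right)
  also have "\<dots> = mat_inner M Z + s * Z $$ (i,j) + s * Z $$ (j,i)"
  proof -
    have "(\<Sum>k<n. \<Sum>l<n. if k = a then if l = b then w else 0 else 0) = w"
      if "a < n" "b < n" for a b and w :: real
    proof -
      have "(\<Sum>k<n. \<Sum>l<n. if k = a then if l = b then w else 0 else 0)
          = (\<Sum>k<n. if k = a then w else 0)"
        using that by (intro sum.cong) auto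
      thus ?thesis using that by simp
    qed
    thus ?thesis using i j by (simp add: sum.distrib mat_inner_eq[OF M Z])
  qed
  finally show ?thesis .
qed

text \<open>Each optimum is tested against the other. In the sum of the two inequalities
  \<open>M\<close> cancels, and the divergence is at most \<open>2 * s * D\<close>. The divergence
  bound with a test matrix supported on \<open>{i,j}\<close> gives at least
  \<open>2 * D * D\<close>, hence \<open>D * D \<le> s * D\<close>.\<close>

lemma reg_optimum_perturbation:
  assumes M: "M \<in> carrier_mat n n" and M': "M' \<in> carrier_mat n n"
    and i: "i < n" and j: "j < n" and ij: "i \<noteq> j"
    and pert: "\<And>k l. k < n \<Longrightarrow> l < n \<Longrightarrow> M' $$ (k,l) = M $$ (k,l) + (if {k,l} = {i,j} then s else 0)"
  shows "\<bar>reg_optimum n M' $$ (i,j) - reg_optimum n M $$ (i,j)\<bar> \<le> \<bar>s\<bar>"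
proof -
  define X where "X = reg_optimum n M"
  define Y where "Y = reg_optimum n M'"
  have Xf: "X \<in> sdp_feasible n" and Yf: "Y \<in> sdp_feasible n"
    using reg_optimum(1)[OF M] reg_optimum(1)[OF M'] by (auto simp: X_def Y_def)
  have X: "X \<in> carrier_mat n n" "psd X" and Y: "Y \<in> carrier_mat n n" "psd Y"
    using Xf Yf by (auto simp: sdp_feasible_def)
  obtain Xi where Xi: "Xi \<in> carrier_mat n n" "X * Xi = 1\<^sub>m n" "Xi * X = 1\<^sub>m n"
    and optX: "mat_inner M (Y - X) + trace (Xi * (Y - X)) \<le> 0"
    using reg_optimum(2)[OF M] Yf unfolding X_def by blast
  obtain Yi where Yi: "Yi \<in> carrier_mat n n" "Y * Yi = 1\<^sub>m n" "Yi * Y = 1\<^sub>m n"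
    and optY: "mat_inner M' (X - Y) + trace (Yi * (X - Y)) \<le> 0"
    using reg_optimum(2)[OF M'] Xf unfolding Y_def by blast
  define x where "x = X $$ (i,j)"
  define y where "y = Y $$ (i,j)"
  define D where "D = y - x"
  define u where "u = (x + y) / 2"
  have ents: "X $$ (i,i) = 1" "X $$ (j,j) = 1" "X $$ (i,j) = x" "X $$ (j,i) = x"
      "Y $$ (i,i) = 1" "Y $$ (j,j) = 1" "Y $$ (i,j) = y" "Y $$ (j,i) = y"
    using Xf Yf i j by (auto simp: sdp_feasible_iff x_def y_def)
  have M'M: "mat_inner M' Z = mat_inner M Z + s * Z $$ (i,j) + s * Z $$ (j,i)" if "Z \<in> carrier_mat n n" for Z
    using mat_inner_pair_perturbation[OF M M' that i j ij pert] .
  have tr: "trace (Xi * Y) + trace (Yi * X) - 2 * real n \<le> 2 * s * D"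
    using optX optY
    unfolding mat_inner_diff_right[OF M X(1) Y(1)] mat_inner_diff_right[OF M' Y(1) X(1)]
      trace_mult_diff_right[OF Xi(1) X(1) Y(1)] trace_mult_diff_right[OF Yi(1) Y(1) X(1)]
      Xi(3) Yi(3) trace_one M'M[OF X(1)] M'M[OF Y(1)] ents D_def
    by (simp add: algebra_simps)
  \<comment> \<open>The diagonal \<open>- u * D\<close> matters when \<open>\<bar>x\<bar>\<close> and \<open>\<bar>y\<bar>\<close> are close to 1: with diagonal 0 the
    resulting bound is void there.\<close>
  define C where "C = Matrix.mat n n (\<lambda>(k,l). if {k,l} = {i,j} then D
    else if k = l \<and> (k = i \<or> k = j) then - u * D else 0)"
  have C: "C \<in> carrier_mat n n" "transpose_mat C = C"
    by (auto simp: C_def mat_eq_iff insert_commute)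
  have Cent: "C $$ (i,j) = D" "C $$ (j,i) = D" "C $$ (i,i) = - u * D" "C $$ (j,j) = - u * D"
    using i j ij by (auto simp: C_def insert_commute)
  have C0: "C $$ (k,l) = 0" if "k < n" "l < n" "k \<notin> {i,j} \<or> l \<notin> {i,j}" for k l
    using that by (auto simp: C_def doubleton_eq_iff)
  have mv: "(C * Z) $$ (k,l) = (\<Sum>m\<in>{i,j}. C $$ (k,m) * Z $$ (m,l))"
    if "Z \<in> carrier_mat n n" "k < n" "l < n" for Z k l
  proof -
    have "(C * Z) $$ (k,l) = (\<Sum>m<n. C $$ (k,m) * Z $$ (m,l))"
      using C that by (simp add: scalar_prod_def atLeast0LessThan)
    also have "\<dots> = (\<Sum>m\<in>{i,j}. C $$ (k,m) * Z $$ (m,l))"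
      using i j C0 that by (intro sum.mono_neutral_right) auto
    finally show ?thesis .
  qed
  have CZ0: "(C * Z) $$ (k,l) = 0" if "Z \<in> carrier_mat n n" "k < n" "l < n" "k \<notin> {i,j}" for Z k l
    using that i j by (subst mv) (auto intro!: sum.neutral C0)
  have t1: "trace (C * (Y - X)) = 2 * D * D"
  proof -
    have YX: "Y - X \<in> carrier_mat n n" by (rule minus_carrier_mat[OF X(1)])
    have "trace (C * (Y - X)) = (\<Sum>k<n. (C * (Y - X)) $$ (k,k))" using C by (simp add: trace_def)
    also have "\<dots> = (\<Sum>k\<in>{i,j}. (C * (Y - X)) $$ (k,k))"
      using i j YX by (intro sum.mono_neutral_right) (auto simp: CZ0)
    also have "\<dots> = 2 * D * D"
      using i j ij X Y YX by (simp add: mv Cent ents D_def)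
    finally show ?thesis .
  qed
  have t2: "trace (C * X * (C * Y)) = D * D * (2 * (1 + u * u) * (1 + x * y) - 4 * u * (x + y))"
  proof -
    have "trace (C * X * (C * Y)) = (\<Sum>k<n. \<Sum>l<n. (C * X) $$ (k,l) * (C * Y) $$ (l,k))"
      using C X Y by (intro trace_mult) auto
    also have "\<dots> = (\<Sum>k\<in>{i,j}. \<Sum>l<n. (C * X) $$ (k,l) * (C * Y) $$ (l,k))"
      using i j X Y by (intro sum.mono_neutral_right) (auto simp: CZ0 simp del: index_mult_mat)
    also have "\<dots> = (\<Sum>k\<in>{i,j}. \<Sum>l\<in>{i,j}. (C * X) $$ (k,l) * (C * Y) $$ (l,k))"
      using i j X Y by (intro sum.cong sum.mono_neutral_right) (auto simp: CZ0 simp del: index_mult_mat)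
    also have "\<dots> = D * D * (2 * (1 + u * u) * (1 + x * y) - 4 * u * (x + y))"
      using i j ij X Y by (simp add: mv Cent ents del: index_mult_mat) (simp add: algebra_simps)
    finally show ?thesis .
  qed
  have "2 * (2 * D * D) - D * D * (2 * (1 + u * u) * (1 + x * y) - 4 * u * (x + y)) \<le> 2 * s * D"
    using symmetric_divergence_lower_bound[OF X Y Xi Yi C] tr unfolding t1 t2 by simp
  \<comment> \<open>With \<open>v = u * u \<le> 1\<close> one has \<open>u * (x + y) = 2 * v\<close>
    and \<open>x * y \<le> v\<close>, so it suffices that
    \<open>(1 + v) * (1 + v) \<le> 1 + 4 * v\<close>.\<close>
  moreover have "2 * (1 + u * u) * (1 + x * y) - 4 * u * (x + y) \<le> 2"
  proof -
    have "\<bar>x\<bar> \<le> 1" "\<bar>y\<bar> \<le> 1"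
      using sdp_feasible_entry_bound[OF Xf i j] sdp_feasible_entry_bound[OF Yf i j] by (auto simp: x_def y_def)
    hence "\<bar>u\<bar> \<le> 1" by (auto simp: u_def)
    hence u: "u\<^sup>2 \<le> 1" by (simp add: abs_square_le_1)
    have "x * y = u\<^sup>2 - ((x - y) / 2)\<^sup>2" by (simp add: u_def power2_eq_square field_simps)
    hence xy: "x * y \<le> u\<^sup>2" by simp
    have "(1 + u\<^sup>2) * (1 + x * y) \<le> (1 + u\<^sup>2) * (1 + u\<^sup>2)"
      using xy by (intro mult_left_mono) auto
    also have "\<dots> = 1 + 2 * u\<^sup>2 + u\<^sup>2 * u\<^sup>2" by (simp add: algebra_simps)
    also have "\<dots> \<le> 1 + 2 * u\<^sup>2 + u\<^sup>2 * 2" using u by (intro add_mono mult_left_mono) auto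
    also have "\<dots> = 1 + 2 * u * (x + y)" by (simp add: u_def power2_eq_square field_simps)
    finally have "(1 + u * u) * (1 + x * y) \<le> 1 + 2 * u * (x + y)"
      by (simp add: power2_eq_square)
    thus ?thesis by (simp add: algebra_simps)
  qed
  hence "D * D * (2 * (1 + u * u) * (1 + x * y) - 4 * u * (x + y)) \<le> D * D * 2"
    by (intro mult_left_mono) auto
  ultimately have "D * D \<le> s * D" by simp
  hence "\<bar>D\<bar> * \<bar>D\<bar> \<le> \<bar>s\<bar> * \<bar>D\<bar>"
    using abs_ge_self[of "s * D"] unfolding abs_mult[symmetric] by simp
  hence "\<bar>D\<bar> \<le> \<bar>s\<bar>"
    by (cases "D = 0") (auto intro: mult_right_le_imp_le[of _ "\<bar>D\<bar>"] simp del: abs_mult_self_eq)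
  thus ?thesis by (simp add: D_def x_def y_def X_def Y_def)
qed

section \<open>Concentration for products of Bernoulli measures\<close>

abbreviation bernoulli_product :: "'a set \<Rightarrow> real \<Rightarrow> ('a \<Rightarrow> bool) pmf" where
  "bernoulli_product A p \<equiv> Pi_pmf A False (\<lambda>_. bernoulli_pmf p)"

lemma finite_set_bernoulli_product:
  assumes "finite A"
  shows "finite (set_pmf (bernoulli_product A p))"
proof -
  have fin: "finite (PiE_dflt A False (set_pmf \<circ> (\<lambda>_. bernoulli_pmf p)))"
    using assms by (intro finite_PiE_dflt) simp_all
  show ?thesis by (rule finite_subset[OF set_Pi_pmf_subset'[OF assms] fin])
qed

lemma integrable_bernoulli_product:
  fixes g :: "_ \<Rightarrow> real"
  shows "finite A \<Longrightarrow> integrable (measure_pmf (bernoulli_product A p)) g"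
  by (intro integrable_measure_pmf_finite finite_set_bernoulli_product)

lemma expectation_bernoulli_product_insert:
  fixes g :: "_ \<Rightarrow> real"
  assumes A: "finite A" "e \<notin> A" and p: "0 \<le> p" "p \<le> 1"
  shows "measure_pmf.expectation (bernoulli_product (insert e A) p) g =
    measure_pmf.expectation (bernoulli_product A p) (\<lambda>f. p * g (f(e := True)) + (1 - p) * g (f(e := False)))"
proof -
  have "measure_pmf.expectation (bernoulli_product (insert e A) p) g
      = measure_pmf.expectation (bernoulli_pmf p \<bind>
          (\<lambda>y. map_pmf (\<lambda>f. f(e := y)) (bernoulli_product A p))) g"
    unfolding Pi_pmf_insert'[OF A] by (simp add: map_pmf_def)
  also have "\<dots> = (\<Sum>a\<in>UNIV. pmf (bernoulli_pmf p) a *\<^sub>R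
      measure_pmf.expectation (map_pmf (\<lambda>f. f(e := a)) (bernoulli_product A p)) g)"
    using finite_set_bernoulli_product[OF A(1)] by (intro pmf_expectation_bind) auto
  also have "\<dots> = p * measure_pmf.expectation (bernoulli_product A p) (\<lambda>f. g (f(e := True)))
      + (1 - p) * measure_pmf.expectation (bernoulli_product A p) (\<lambda>f. g (f(e := False)))"
    using p by (simp add: UNIV_bool)
  also have "\<dots> = measure_pmf.expectation (bernoulli_product A p)
      (\<lambda>f. p * g (f(e := True)) + (1 - p) * g (f(e := False)))"
    by (subst Bochner_Integration.integral_add)
      (simp_all add: integrable_bernoulli_product A)
  finally show ?thesis .
qed

lemma expectation_bernoulli_product_cond:
  fixes g :: "_ \<Rightarrow> real"
  assumes A: "finite A" "e \<in> A" and p: "0 \<le> p" "p \<le> 1"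
  shows "measure_pmf.expectation (bernoulli_product A p) g =
    measure_pmf.expectation (bernoulli_product A p) (\<lambda>f. p * g (f(e := True)) + (1 - p) * g (f(e := False)))"
proof -
  define A' where "A' = A - {e}"
  have A': "finite A'" "e \<notin> A'" "A = insert e A'" using A by (auto simp: A'_def)
  show ?thesis unfolding A'(3) expectation_bernoulli_product_insert[OF A'(1,2) p]
    by (simp add: algebra_simps)
qed

text \<open>Discrete integration by parts: the centred coordinate has mean zero given all the
  others, so only the discrete derivative of \<open>Z\<close> in that coordinate survives.\<close>

lemma expectation_centered_coordinate:
  fixes Z :: "_ \<Rightarrow> real"
  assumes A: "finite A" "e \<in> A" and p: "0 \<le> p" "p \<le> 1"
  shows "measure_pmf.expectation (bernoulli_product A p) (\<lambda>f. (of_bool (f e) - p) * Z f) =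
    p * (1 - p) * measure_pmf.expectation (bernoulli_product A p) (\<lambda>f. Z (f(e := True)) - Z (f(e := False)))"
  unfolding expectation_bernoulli_product_cond[OF A p, of "\<lambda>f. (of_bool (f e) - p) * Z f"]
    Bochner_Integration.integral_mult_right_zero[symmetric]
  by (intro Bochner_Integration.integral_cong) (auto simp: algebra_simps)

section \<open>Exponential moments and tail bounds\<close>

lemma exp_le_quadratic:
  fixes x :: real
  assumes "\<bar>x\<bar> \<le> 1"
  shows "exp x \<le> 1 + x + x\<^sup>2"
proof (cases "0 \<le> x")
  case True
  thus ?thesis using exp_bound[of x] assms by simp
next
  case False
  define y where "y = - x"
  have y: "0 \<le> y" "y \<le> 1" using False assms by (auto simp: y_def)
  \<comment> \<open>The first factor is a Taylor lower bound for \<open>exp y\<close>, so the second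
    bounds \<open>exp (- y)\<close> from above.\<close>
  have "1 \<le> (1 + y + y\<^sup>2 / 2) * (1 - y + y\<^sup>2)"
  proof -
    have "(1 + y + y\<^sup>2 / 2) * (1 - y + y\<^sup>2) = 1 + y\<^sup>2 / 2 + y ^ 3 / 2 + y ^ 4 / 2"
      by (simp add: field_simps power2_eq_square power3_eq_cube power4_eq_xxxx)
    thus ?thesis using y by simp
  qed
  also have "\<dots> \<le> exp y * (1 - y + y\<^sup>2)"
  proof (intro mult_right_mono)
    show "1 + y + y\<^sup>2 / 2 \<le> exp y" using exp_lower_Taylor_quadratic[OF y(1)] by simp
    show "0 \<le> 1 - y + y\<^sup>2" using y by simp
  qed
  finally have "exp (- y) * 1 \<le> exp (- y) * (exp y * (1 - y + y\<^sup>2))"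
    by (intro mult_left_mono) auto
  hence "exp (- y) \<le> 1 - y + y\<^sup>2" by (simp add: mult.assoc[symmetric] exp_add[symmetric])
  thus ?thesis by (simp add: y_def)
qed

text \<open>The variance factor \<open>p\<close> is kept, as in Bernstein's inequality. A
  range-based bound of Hoeffding type would lose it, and the sum over about \<open>n * n\<close>
  edges with \<open>p = d / n\<close> would no longer be linear in \<open>n\<close>.\<close>

lemma bernoulli_mgf_bound:
  fixes u v l \<delta> p :: real
  assumes p: "0 \<le> p" "p \<le> 1" and uv: "\<bar>u - v\<bar> \<le> \<delta>" and l: "\<bar>l\<bar> * \<delta> \<le> 1"
  shows "p * exp (l * u) + (1 - p) * exp (l * v)
    \<le> exp (l * (p * u + (1 - p) * v) + p * (l * \<delta>)\<^sup>2)"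
proof -
  define m where "m = p * u + (1 - p) * v"
  define D where "D = l * (u - v)"
  have D: "\<bar>D\<bar> \<le> \<bar>l * \<delta>\<bar>" "\<bar>l * \<delta>\<bar> \<le> 1"
  proof -
    have "0 \<le> \<delta>" using uv by linarith
    thus "\<bar>l * \<delta>\<bar> \<le> 1" using l by (simp add: abs_mult)
    have "\<bar>l\<bar> * \<bar>u - v\<bar> \<le> \<bar>l\<bar> * \<delta>" by (rule mult_left_mono[OF uv]) simp
    thus "\<bar>D\<bar> \<le> \<bar>l * \<delta>\<bar>" using \<open>0 \<le> \<delta>\<close> by (simp add: D_def abs_mult)
  qed
  have b1: "\<bar>(1 - p) * D\<bar> \<le> 1"
  proof -
    have "\<bar>(1 - p) * D\<bar> = (1 - p) * \<bar>D\<bar>" using p by (simp add: abs_mult)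
    also have "\<dots> \<le> 1 * 1" using p D by (intro mult_mono) auto
    finally show ?thesis by simp
  qed
  have b2: "\<bar>- p * D\<bar> \<le> 1"
  proof -
    have "\<bar>- p * D\<bar> = p * \<bar>D\<bar>" using p by (simp add: abs_mult)
    also have "\<dots> \<le> 1 * 1" using p D by (intro mult_mono) auto
    finally show ?thesis by simp
  qed
  have "p * exp (l * u) + (1 - p) * exp (l * v)
      = exp (l * m) * (p * exp ((1 - p) * D) + (1 - p) * exp (- p * D))"
  proof -
    have "l * u = l * m + (1 - p) * D" "l * v = l * m + - p * D"
      by (simp_all add: m_def D_def algebra_simps)
    thus ?thesis by (simp only: exp_add distrib_left mult.left_commute)
  qed
  also have "p * exp ((1 - p) * D) + (1 - p) * exp (- p * D)
      \<le> p * (1 + (1 - p) * D + ((1 - p) * D)\<^sup>2) + (1 - p) * (1 + - p * D + (- p * D)\<^sup>2)"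
    using p exp_le_quadratic[OF b1] exp_le_quadratic[OF b2] by (intro add_mono mult_left_mono) auto
  also have "\<dots> = 1 + p * (1 - p) * D\<^sup>2" by (simp add: power2_eq_square algebra_simps)
  also have "p * (1 - p) * D\<^sup>2 \<le> p * 1 * (l * \<delta>)\<^sup>2"
    using p D by (intro mult_mono abs_le_square_iff[THEN iffD1]) auto
  also have "1 + p * 1 * (l * \<delta>)\<^sup>2 \<le> exp (p * (l * \<delta>)\<^sup>2)" using exp_ge_add_one_self by simp
  finally show ?thesis by (simp add: m_def exp_add)
qed

text \<open>The coordinates are integrated out one at a time. The averaged function \<open>h\<close>
  is a convex combination of restrictions of \<open>g\<close> and so keeps the bound
  \<open>\<delta>\<close>, while each step costs the exponent
  \<open>p * (l * \<delta>)\<^sup>2\<close>.\<close>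

lemma bernoulli_product_mgf:
  fixes g :: "_ \<Rightarrow> real"
  assumes "finite A" and p: "0 \<le> p" "p \<le> 1" and l: "\<bar>l\<bar> * \<delta> \<le> 1"
    and "\<And>e f. e \<in> A \<Longrightarrow> \<bar>g (f(e := True)) - g (f(e := False))\<bar> \<le> \<delta>"
  shows "measure_pmf.expectation (bernoulli_product A p) (\<lambda>f. exp (l * g f))
    \<le> exp (l * measure_pmf.expectation (bernoulli_product A p) g + real (card A) * p * (l * \<delta>)\<^sup>2)"
  using assms(1,5)
proof (induction A arbitrary: g rule: finite_induct)
  case empty
  thus ?case by simp
next
  case (insert e A)
  define h where "h f = p * g (f(e := True)) + (1 - p) * g (f(e := False))" for f
  have Eh: "measure_pmf.expectation (bernoulli_product (insert e A) p) g
      = measure_pmf.expectation (bernoulli_product A p) h"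
    unfolding h_def by (rule expectation_bernoulli_product_insert[OF insert.hyps p])
  have lip: "\<bar>h (f(e' := True)) - h (f(e' := False))\<bar> \<le> \<delta>" if "e' \<in> A" for e' f
  proof -
    have ne: "e' \<noteq> e" using that insert.hyps by auto
    have "\<bar>g ((f(e := b))(e' := True)) - g ((f(e := b))(e' := False))\<bar> \<le> \<delta>" for b
      using insert.prems that by blast
    note b = this[of True] this[of False]
    have "h (f(e' := True)) - h (f(e' := False))
        = p * (g ((f(e := True))(e' := True)) - g ((f(e := True))(e' := False)))
        + (1 - p) * (g ((f(e := False))(e' := True)) - g ((f(e := False))(e' := False)))"
      using ne by (simp add: h_def fun_upd_twist algebra_simps)
    also have "\<bar>\<dots>\<bar> \<le> p * \<delta> + (1 - p) * \<delta>"
      using p b by (intro order.trans[OF abs_triangle_ineq] add_mono) (auto simp: abs_mult intro!: mult_left_mono)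
    finally show ?thesis by (simp add: algebra_simps)
  qed
  have "measure_pmf.expectation (bernoulli_product (insert e A) p) (\<lambda>f. exp (l * g f))
      = measure_pmf.expectation (bernoulli_product A p)
          (\<lambda>f. p * exp (l * g (f(e := True))) + (1 - p) * exp (l * g (f(e := False))))"
    by (rule expectation_bernoulli_product_insert[OF insert.hyps p])
  also have "\<dots> \<le> measure_pmf.expectation (bernoulli_product A p) (\<lambda>f. exp (p * (l * \<delta>)\<^sup>2) * exp (l * h f))"
  proof (intro integral_mono integrable_bernoulli_product insert.hyps)
    fix f
    have "\<bar>g (f(e := True)) - g (f(e := False))\<bar> \<le> \<delta>" using insert.prems by blast
    from bernoulli_mgf_bound[OF p this l]
    show "p * exp (l * g (f(e := True))) + (1 - p) * exp (l * g (f(e := False)))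
        \<le> exp (p * (l * \<delta>)\<^sup>2) * exp (l * h f)"
      by (simp only: h_def exp_add mult.commute)
  qed
  also have "\<dots> = exp (p * (l * \<delta>)\<^sup>2) * measure_pmf.expectation (bernoulli_product A p) (\<lambda>f. exp (l * h f))"
    by simp
  also have "\<dots> \<le> exp (p * (l * \<delta>)\<^sup>2) *
      exp (l * measure_pmf.expectation (bernoulli_product A p) h + real (card A) * p * (l * \<delta>)\<^sup>2)"
    by (intro mult_left_mono insert.IH lip) auto
  also have "\<dots> = exp (l * measure_pmf.expectation (bernoulli_product A p) h
      + real (card (insert e A)) * p * (l * \<delta>)\<^sup>2)"
    using insert.hyps by (simp add: mult_exp_exp) (simp add: algebra_simps)
  finally show ?case unfolding Eh .
qed

text \<open>Chernoff's argument; since \<open>l\<close> may have either sign, it covers the upper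
  and the lower tail.\<close>

lemma bernoulli_product_one_sided_tail:
  fixes g :: "_ \<Rightarrow> real"
  assumes A: "finite A" and p: "0 \<le> p" "p \<le> 1" and l: "\<bar>l\<bar> * \<delta> \<le> 1"
    and lip: "\<And>e f. e \<in> A \<Longrightarrow> \<bar>g (f(e := True)) - g (f(e := False))\<bar> \<le> \<delta>"
  shows "measure_pmf.prob (bernoulli_product A p)
      {f. l * (g f - measure_pmf.expectation (bernoulli_product A p) g) \<ge> t}
    \<le> exp (real (card A) * p * (l * \<delta>)\<^sup>2 - t)"
proof -
  let ?M = "bernoulli_product A p"
  define m where "m = measure_pmf.expectation ?M g"
  have "measure_pmf.prob ?M {f. l * (g f - m) \<ge> t} = measure_pmf.prob ?M {f \<in> space ?M. exp (l * g f) \<ge> exp (t + l * m)}"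
    by (simp add: algebra_simps)
  also have "\<dots> \<le> measure_pmf.expectation ?M (\<lambda>f. exp (l * g f)) / exp (t + l * m)"
    by (intro integral_Markov_inequality_measure[of _ _ UNIV] integrable_bernoulli_product A) auto
  also have "\<dots> \<le> exp (l * m + real (card A) * p * (l * \<delta>)\<^sup>2) / exp (t + l * m)"
    unfolding m_def by (intro divide_right_mono bernoulli_product_mgf assms) auto
  also have "\<dots> = exp (real (card A) * p * (l * \<delta>)\<^sup>2 - t)"
    by (simp add: exp_diff[symmetric])
  finally show ?thesis by (simp add: m_def)
qed

lemma bernoulli_product_concentration:
  fixes g :: "_ \<Rightarrow> real"
  assumes A: "finite A" and p: "0 \<le> p" "p \<le> 1" and l: "0 < l" "l * \<delta> \<le> 1"
    and lip: "\<And>e f. e \<in> A \<Longrightarrow> \<bar>g (f(e := True)) - g (f(e := False))\<bar> \<le> \<delta>"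
  shows "measure_pmf.prob (bernoulli_product A p)
      {f. \<bar>g f - measure_pmf.expectation (bernoulli_product A p) g\<bar> \<ge> t}
    \<le> 2 * exp (real (card A) * p * (l * \<delta>)\<^sup>2 - l * t)"
proof -
  let ?M = "bernoulli_product A p"
  define m where "m = measure_pmf.expectation ?M g"
  have "measure_pmf.prob ?M {f. \<bar>g f - m\<bar> \<ge> t}
      \<le> measure_pmf.prob ?M ({f. l * (g f - m) \<ge> l * t} \<union> {f. (- l) * (g f - m) \<ge> l * t})"
  proof (intro measure_pmf.finite_measure_mono subsetI)
    fix f assume "f \<in> {f. \<bar>g f - m\<bar> \<ge> t}"
    hence "t \<le> g f - m \<or> t \<le> - (g f - m)" by auto
    hence "l * t \<le> l * (g f - m) \<or> l * t \<le> l * (- (g f - m))"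
      using l(1) by (auto intro: mult_left_mono)
    thus "f \<in> {f. l * (g f - m) \<ge> l * t} \<union> {f. (- l) * (g f - m) \<ge> l * t}"
      by (simp add: algebra_simps)
  qed simp
  also have "\<dots> \<le> measure_pmf.prob ?M {f. l * (g f - m) \<ge> l * t} + measure_pmf.prob ?M {f. (- l) * (g f - m) \<ge> l * t}"
    by (intro measure_Un_le) auto
  also have "\<dots> \<le> exp (real (card A) * p * (l * \<delta>)\<^sup>2 - l * t) + exp (real (card A) * p * ((- l) * \<delta>)\<^sup>2 - l * t)"
    using bernoulli_product_one_sided_tail[OF A p _ lip, of l "l * t"]
      bernoulli_product_one_sided_tail[OF A p _ lip, of "- l" "l * t"] l
    unfolding m_def by (intro add_mono) simp_all
  finally show ?thesis by (simp add: m_def)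
qed

section \<open>Self-avoiding paths in random graphs\<close>

fun path_edges :: "'a list \<Rightarrow> 'a set set" where
  "path_edges (x # y # zs) = insert {x,y} (path_edges (y # zs))"
| "path_edges _ = {}"

text \<open>The start is left out of the list, so the length of the list is the number of edges and
  the trivial walk is \<open>[]\<close>.\<close>

definition sa_walks :: "nat \<Rightarrow> nat \<Rightarrow> nat \<Rightarrow> nat list set" where
  "sa_walks n i k = {ys. length ys = k \<and> distinct (i # ys) \<and> set ys \<subseteq> {..<n}}"

definition sa_paths :: "nat \<Rightarrow> nat set set \<Rightarrow> nat \<Rightarrow> nat \<Rightarrow> nat list set" where
  "sa_paths n G i k = {ys \<in> sa_walks n i k. path_edges (i # ys) \<subseteq> G}"

lemma finite_sa_walks: "finite (sa_walks n i k)"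
  by (rule finite_subset[OF _ finite_lists_length_eq[of "{..<n}" k]]) (auto simp: sa_walks_def)

lemma finite_sa_paths: "finite (sa_paths n G i k)"
  unfolding sa_paths_def using finite_sa_walks by simp

lemma finite_path_edges: "finite (path_edges xs)"
  by (induction xs rule: path_edges.induct) auto

lemma Union_path_edges: "\<Union> (path_edges xs) \<subseteq> set xs"
  by (induction xs rule: path_edges.induct) auto

lemma path_edges_append:
  "path_edges (xs @ y # ys) = path_edges (xs @ [y]) \<union> path_edges (y # ys)"
  by (induction xs rule: path_edges.induct) auto

lemma path_edges_rev: "path_edges (rev xs) = path_edges xs"
proof (induction xs rule: path_edges.induct)
  case (1 x y zs)
  have "path_edges (rev (x # y # zs)) = path_edges (rev zs @ y # [x])" by simp
  also have "\<dots> = path_edges (rev (y # zs)) \<union> path_edges [y,x]"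
    by (subst path_edges_append) simp
  finally show ?case using 1 by (auto simp: insert_commute)
qed auto

lemma path_edges_subset_all_edges:
  "distinct xs \<Longrightarrow> set xs \<subseteq> {..<n} \<Longrightarrow> path_edges xs \<subseteq> all_edges n"
  by (induction xs rule: path_edges.induct) (auto simp: all_edges_def)

lemma card_path_edges: "distinct xs \<Longrightarrow> card (path_edges xs) = length xs - 1"
proof (induction xs rule: path_edges.induct)
  case (1 x y zs)
  have "{x,y} \<notin> path_edges (y # zs)" using Union_path_edges[of "y # zs"] 1(2) by auto
  thus ?case using 1 finite_path_edges[of "y # zs"] by simp
qed auto

text \<open>The sharper bound at the head carries the induction: a prepended vertex adds one edge at
  the old head, whose degree must still have been at most 1.\<close>

lemma path_edges_degree:
  "distinct xs \<Longrightarrow> finite {w. {u,w} \<in> path_edges xs} \<and> card {w. {u,w} \<in> path_edges xs} \<le> 2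
    \<and> (xs \<noteq> [] \<longrightarrow> u = hd xs \<longrightarrow> card {w. {u,w} \<in> path_edges xs} \<le> 1)"
proof (induction xs rule: path_edges.induct)
  case (1 x y zs)
  let ?E = "path_edges (y # zs)"
  have IH: "finite {w. {u,w} \<in> ?E}" "card {w. {u,w} \<in> ?E} \<le> 2"
    "u = y \<Longrightarrow> card {w. {u,w} \<in> ?E} \<le> 1"
    using 1 by auto
  have x: "{x,w} \<notin> ?E" for w using Union_path_edges[of "y # zs"] 1(2) by auto
  consider "u = x" | "u = y" "u \<noteq> x" | "u \<noteq> x" "u \<noteq> y" by blast
  thus ?case
  proof cases
    case 1
    have eq: "{w. {u,w} \<in> path_edges (x # y # zs)} = {y}"
      using 1 x \<open>distinct (x # y # zs)\<close> by (auto simp: doubleton_eq_iff)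
    show ?thesis unfolding eq by simp
  next
    case 2
    have "{w. {u,w} \<in> path_edges (x # y # zs)} = insert x {w. {u,w} \<in> ?E}"
      using 2 by (auto simp: doubleton_eq_iff)
    moreover have "card (insert x {w. {u,w} \<in> ?E}) \<le> Suc (card {w. {u,w} \<in> ?E})"
      by (rule card_insert_le_m1) simp_all
    ultimately show ?thesis using IH 2 by (auto simp: card_insert_if)
  next
    case 3
    hence "{w. {u,w} \<in> path_edges (x # y # zs)} = {w. {u,w} \<in> ?E}"
      by (auto simp: doubleton_eq_iff)
    thus ?thesis using IH 3 by simp
  qed
qed auto

section \<open>Moments of self-avoiding path counts\<close>

lemma sum_sa_walks_Suc:
  fixes f :: "nat list \<Rightarrow> real"
  shows "(\<Sum>ys\<in>sa_walks n i (Suc k). f ys)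
    = (\<Sum>w\<in>{..<n} - {i}. \<Sum>zs\<in>{zs\<in>sa_walks n w k. i \<notin> set zs}. f (w # zs))"
proof -
  have "(\<Sum>ys\<in>sa_walks n i (Suc k). f ys)
      = (\<Sum>(w,zs)\<in>(SIGMA w:{..<n} - {i}. {zs\<in>sa_walks n w k. i \<notin> set zs}). f (w # zs))"
  proof (rule sum.reindex_bij_witness[of _ "\<lambda>(w,zs). w # zs" "\<lambda>ys. (hd ys, tl ys)"])
    fix ys assume "ys \<in> sa_walks n i (Suc k)"
    then obtain w zs where "ys = w # zs" "length zs = k" "distinct (i # w # zs)" "set (w # zs) \<subseteq> {..<n}"
      by (auto simp: sa_walks_def length_Suc_conv)
    thus "(case (hd ys, tl ys) of (w,zs) \<Rightarrow> w # zs) = ys"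
      "(hd ys, tl ys) \<in> (SIGMA w:{..<n} - {i}. {zs\<in>sa_walks n w k. i \<notin> set zs})"
      "(case (hd ys, tl ys) of (w,zs) \<Rightarrow> f (w # zs)) = f ys"
      by (auto simp: sa_walks_def)
  qed (auto simp: sa_walks_def)
  also have "\<dots> = (\<Sum>w\<in>{..<n} - {i}. \<Sum>zs\<in>{zs\<in>sa_walks n w k. i \<notin> set zs}. f (w # zs))"
    by (subst sum.Sigma) (auto simp: finite_sa_walks)
  finally show ?thesis .
qed

text \<open>
  Each step of the walk contributes a factor \<open>p\<close> unless it reuses an edge of \<open>F\<close>, for which there
  are at most \<open>\<Delta>\<close> choices.
\<close>

lemma sum_sa_walks_weight_le:
  assumes p: "0 \<le> p" "p \<le> (1::real)" and F: "finite F"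
    and deg: "\<And>u. finite {w. {u,w} \<in> F} \<and> card {w. {u,w} \<in> F} \<le> \<Delta>"
  shows "(\<Sum>ys\<in>sa_walks n i k. p ^ card (F \<union> path_edges (i # ys))) \<le> p ^ card F * (real n * p + real \<Delta>) ^ k"
proof (induction k arbitrary: i)
  case 0
  have "sa_walks n i 0 = {[]}" by (auto simp: sa_walks_def)
  thus ?case by simp
next
  case (Suc k)
  define wt where "wt w = (if {i,w} \<in> F then 1 else p)" for w
  define B where "B = p ^ card F * (real n * p + real \<Delta>) ^ k"
  have B: "B \<ge> 0" using p by (auto simp: B_def)
  have step: "p ^ card (F \<union> path_edges (i # w # zs)) = wt w * p ^ card (F \<union> path_edges (w # zs))"
    if "i \<noteq> w" "i \<notin> set zs" for w zs
  proof -
    have "{i,w} \<notin> path_edges (w # zs)" using Union_path_edges[of "w # zs"] that by auto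
    thus ?thesis using F finite_path_edges[of "w # zs"] by (auto simp: wt_def insert_absorb)
  qed
  have "(\<Sum>ys\<in>sa_walks n i (Suc k). p ^ card (F \<union> path_edges (i # ys)))
      = (\<Sum>w\<in>{..<n} - {i}. \<Sum>zs\<in>{zs\<in>sa_walks n w k. i \<notin> set zs}. wt w * p ^ card (F \<union> path_edges (w # zs)))"
    unfolding sum_sa_walks_Suc using step by (intro sum.cong refl) auto
  also have "\<dots> \<le> (\<Sum>w\<in>{..<n} - {i}. \<Sum>zs\<in>sa_walks n w k. wt w * p ^ card (F \<union> path_edges (w # zs)))"
    using p by (intro sum_mono sum_mono2) (auto simp: finite_sa_walks wt_def)
  also have "\<dots> \<le> (\<Sum>w\<in>{..<n} - {i}. wt w * B)"
    unfolding sum_distrib_left[symmetric] B_def using p Suc.IH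
    by (intro sum_mono mult_left_mono) (auto simp: wt_def)
  also have "\<dots> \<le> (\<Sum>w<n. wt w * B)"
    using p B by (intro sum_mono2) (auto simp: wt_def)
  also have "\<dots> = (\<Sum>w<n. wt w) * B" by (simp add: sum_distrib_right)
  also have "(\<Sum>w<n. wt w) \<le> real n * p + real \<Delta>"
  proof -
    have "(\<Sum>w<n. wt w) \<le> (\<Sum>w<n. p + of_bool ({i,w} \<in> F))"
      using p by (intro sum_mono) (auto simp: wt_def)
    also have "\<dots> = real n * p + real (card ({..<n} \<inter> {w. {i,w} \<in> F}))"
      by (simp add: sum.distrib sum_of_bool_eq)
    also have "card ({..<n} \<inter> {w. {i,w} \<in> F}) \<le> card {w. {i,w} \<in> F}"
      using deg by (intro card_mono) auto
    finally show ?thesis using deg[of i] by (simp add: order.trans)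
  qed
  finally show ?case using B by (simp add: B_def mult_ac mult_left_mono mult_right_mono)
qed

lemma finite_all_edges: "finite (all_edges n)"
  by (rule finite_subset[of _ "Pow {..<n}"]) (auto simp: all_edges_def)

lemma finite_set_erdos_renyi: "finite (set_pmf (erdos_renyi n p))"
proof -
  have "set_pmf (erdos_renyi n p) \<subseteq> Pow (all_edges n)"
    by (auto simp: erdos_renyi_def)
  thus ?thesis using finite_all_edges finite_subset by blast
qed

lemma integrable_erdos_renyi:
  fixes g :: "_ \<Rightarrow> real"
  shows "integrable (measure_pmf (erdos_renyi n p)) g"
  by (intro integrable_measure_pmf_finite finite_set_erdos_renyi)

lemma expectation_erdos_renyi_mono:
  fixes g h :: "_ \<Rightarrow> real"
  assumes "\<And>G. g G \<le> h G"
  shows "measure_pmf.expectation (erdos_renyi n p) g \<le> measure_pmf.expectation (erdos_renyi n p) h"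
  using assms by (intro integral_mono integrable_erdos_renyi) auto

lemma expectation_erdos_renyi_sum:
  fixes g :: "_ \<Rightarrow> _ \<Rightarrow> real"
  shows "measure_pmf.expectation (erdos_renyi n p) (\<lambda>G. \<Sum>x\<in>S. g x G)
    = (\<Sum>x\<in>S. measure_pmf.expectation (erdos_renyi n p) (g x))"
  by (intro Bochner_Integration.integral_sum integrable_erdos_renyi)

lemma prob_erdos_renyi_superset:
  assumes F: "F \<subseteq> all_edges n" and p: "0 \<le> p" "p \<le> 1"
  shows "measure_pmf.prob (erdos_renyi n p) {G. F \<subseteq> G} = p ^ card F"
proof -
  have "measure_pmf.prob (erdos_renyi n p) {G. F \<subseteq> G}
      = measure_pmf.prob (Pi_pmf (all_edges n) False (\<lambda>_. bernoulli_pmf p))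
          (Pi (all_edges n) (\<lambda>e. if e \<in> F then {True} else UNIV))"
    unfolding erdos_renyi_def measure_map_pmf using F
    by (intro arg_cong[where f="measure_pmf.prob _"]) (auto simp: Pi_iff split: if_splits)
  also have "\<dots> = (\<Prod>e\<in>all_edges n. measure_pmf.prob (bernoulli_pmf p) (if e \<in> F then {True} else UNIV))"
    by (rule measure_Pi_pmf_Pi[OF finite_all_edges])
  also have "\<dots> = (\<Prod>e\<in>all_edges n. if e \<in> F then p else 1)"
    using p by (intro prod.cong) (auto simp: measure_pmf_single)
  also have "\<dots> = (\<Prod>e\<in>F. p)"
    using F finite_all_edges by (subst prod.inter_restrict[symmetric]) (auto simp: Int_absorb1)
  finally show ?thesis by simp
qed

lemma expectation_erdos_renyi_superset:
  assumes F: "F \<subseteq> all_edges n" and p: "0 \<le> p" "p \<le> 1"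
  shows "measure_pmf.expectation (erdos_renyi n p) (\<lambda>G. of_bool (F \<subseteq> G)) = p ^ card F"
proof -
  have "measure_pmf.expectation (erdos_renyi n p) (\<lambda>G. of_bool (F \<subseteq> G))
      = measure_pmf.expectation (erdos_renyi n p) (indicator {G. F \<subseteq> G})"
    by (intro Bochner_Integration.integral_cong) (auto simp: indicator_def)
  also have "\<dots> = p ^ card F" using prob_erdos_renyi_superset[OF assms] by simp
  finally show ?thesis .
qed

text \<open>Paths from a common root may share edges, so they are exposed one by one. The set
  \<open>F\<close> collects the edges already revealed, and each path raises its degrees by at most
  2, which produces the summand \<open>2 * real (length ks)\<close>.\<close>

lemma expectation_prod_sa_paths_le:
  assumes p: "0 \<le> p" "p \<le> 1" and i: "i < n"
    and F: "F \<subseteq> all_edges n"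
    and deg: "\<And>u. finite {w. {u,w} \<in> F} \<and> card {w. {u,w} \<in> F} \<le> \<Delta>"
  shows "measure_pmf.expectation (erdos_renyi n p)
      (\<lambda>G. of_bool (F \<subseteq> G) * (\<Prod>k\<leftarrow>ks. real (card (sa_paths n G i k))))
    \<le> p ^ card F * (real n * p + real \<Delta> + 2 * real (length ks)) ^ sum_list ks"
  using F deg
proof (induction ks arbitrary: F \<Delta>)
  case Nil
  thus ?case using expectation_erdos_renyi_superset[OF _ p] by simp
next
  case (Cons k ks)
  define R where "R G = (\<Prod>k\<leftarrow>ks. real (card (sa_paths n G i k)))" for G
  define c where "c = real n * p + real \<Delta> + 2 * real (length (k # ks))"
  have c: "c = real n * p + real (\<Delta> + 2) + 2 * real (length ks)" by (simp add: c_def)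
  have fF: "finite F" using Cons.prems(1) finite_all_edges finite_subset by blast
  have "of_bool (F \<subseteq> G) * (\<Prod>k\<leftarrow>k # ks. real (card (sa_paths n G i k)))
      = (\<Sum>ys\<in>sa_walks n i k. of_bool (F \<union> path_edges (i # ys) \<subseteq> G) * R G)" for G
  proof -
    have "real (card (sa_paths n G i k)) = (\<Sum>ys\<in>sa_walks n i k. of_bool (path_edges (i # ys) \<subseteq> G))"
      using finite_sa_walks[of n i k] by (simp add: sa_paths_def sum_of_bool_eq Int_def)
    thus ?thesis by (auto simp: R_def sum_distrib_right)
  qed
  hence "measure_pmf.expectation (erdos_renyi n p)
      (\<lambda>G. of_bool (F \<subseteq> G) * (\<Prod>k\<leftarrow>k # ks. real (card (sa_paths n G i k))))
    = (\<Sum>ys\<in>sa_walks n i k. measure_pmf.expectation (erdos_renyi n p)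
        (\<lambda>G. of_bool (F \<union> path_edges (i # ys) \<subseteq> G) * R G))"
    by (simp add: expectation_erdos_renyi_sum)
  also have "\<dots> \<le> (\<Sum>ys\<in>sa_walks n i k. p ^ card (F \<union> path_edges (i # ys)) * c ^ sum_list ks)"
  proof (intro sum_mono)
    fix ys assume ys: "ys \<in> sa_walks n i k"
    hence d: "distinct (i # ys)" "set (i # ys) \<subseteq> {..<n}" using i by (auto simp: sa_walks_def)
    have E: "F \<union> path_edges (i # ys) \<subseteq> all_edges n"
      using Cons.prems(1) path_edges_subset_all_edges[OF d] by simp
    have "finite {w. {u,w} \<in> F \<union> path_edges (i # ys)} \<and>
        card {w. {u,w} \<in> F \<union> path_edges (i # ys)} \<le> \<Delta> + 2" for u
    proof -
      have "{w. {u,w} \<in> F \<union> path_edges (i # ys)} = {w. {u,w} \<in> F} \<union> {w. {u,w} \<in> path_edges (i # ys)}"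
        by auto
      moreover have "card ({w. {u,w} \<in> F} \<union> {w. {u,w} \<in> path_edges (i # ys)})
          \<le> card {w. {u,w} \<in> F} + card {w. {u,w} \<in> path_edges (i # ys)}"
        by (rule card_Un_le)
      ultimately show ?thesis
        using Cons.prems(2)[of u] path_edges_degree[OF d(1), of u] by (auto intro: order.trans)
    qed
    from Cons.IH[OF E this]
    show "measure_pmf.expectation (erdos_renyi n p) (\<lambda>G. of_bool (F \<union> path_edges (i # ys) \<subseteq> G) * R G)
      \<le> p ^ card (F \<union> path_edges (i # ys)) * c ^ sum_list ks"
      unfolding R_def c .
  qed
  also have "\<dots> = (\<Sum>ys\<in>sa_walks n i k. p ^ card (F \<union> path_edges (i # ys))) * c ^ sum_list ks"
    by (simp add: sum_distrib_right)
  also have "\<dots> \<le> (p ^ card F * (real n * p + real \<Delta>) ^ k) * c ^ sum_list ks"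
    using p by (intro mult_right_mono sum_sa_walks_weight_le fF Cons.prems(2)) (auto simp: c_def)
  also have "\<dots> \<le> (p ^ card F * c ^ k) * c ^ sum_list ks"
    using p by (intro mult_right_mono mult_left_mono power_mono) (auto simp: c_def)
  finally show ?case by (simp add: c_def power_add mult_ac)
qed

lemma expectation_prod_sa_paths_le':
  assumes "0 \<le> p" "p \<le> 1" "i < n"
  shows "measure_pmf.expectation (erdos_renyi n p) (\<lambda>G. \<Prod>k\<leftarrow>ks. real (card (sa_paths n G i k)))
    \<le> (real n * p + 2 * real (length ks)) ^ sum_list ks"
  using expectation_prod_sa_paths_le[OF assms, of "{}" 0 ks] by simp

text \<open>The number of self-avoiding walks is a falling factorial with each factor at least
  \<open>n - k\<close>, and every walk of length \<open>k\<close> has \<open>k\<close> distinct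
  edges.\<close>

lemma expectation_card_sa_paths_ge:
  assumes p: "0 \<le> p" "p \<le> 1" and i: "i < n" and k: "k \<le> n"
  shows "(real (n - k) * p) ^ k \<le> measure_pmf.expectation (erdos_renyi n p) (\<lambda>G. real (card (sa_paths n G i k)))"
proof -
  have "measure_pmf.expectation (erdos_renyi n p) (\<lambda>G. real (card (sa_paths n G i k)))
      = (\<Sum>ys\<in>sa_walks n i k. measure_pmf.expectation (erdos_renyi n p) (\<lambda>G. of_bool (path_edges (i # ys) \<subseteq> G)))"
    unfolding expectation_erdos_renyi_sum[symmetric] using finite_sa_walks[of n i k]
    by (simp add: sa_paths_def sum_of_bool_eq Int_def)
  also have "\<dots> = (\<Sum>ys\<in>sa_walks n i k. p ^ k)"
  proof (intro sum.cong refl)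
    fix ys assume "ys \<in> sa_walks n i k"
    hence d: "distinct (i # ys)" "set (i # ys) \<subseteq> {..<n}" "length ys = k" using i by (auto simp: sa_walks_def)
    show "measure_pmf.expectation (erdos_renyi n p) (\<lambda>G. of_bool (path_edges (i # ys) \<subseteq> G)) = p ^ k"
      using card_path_edges[OF d(1)] d(3)
      by (subst expectation_erdos_renyi_superset[OF path_edges_subset_all_edges[OF d(1,2)] p]) simp
  qed
  also have "\<dots> = real (card (sa_walks n i k)) * p ^ k" by simp
  also have "sa_walks n i k = {ys. length ys = k \<and> distinct ys \<and> set ys \<subseteq> {..<n} - {i}}"
    by (auto simp: sa_walks_def)
  also have "card \<dots> = \<Prod>{n - k..n - 1}" if "k < n"
    using that i by (subst card_lists_distinct_length_eq) (auto simp: Suc_diff_Suc)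
  hence "(n - k) ^ k \<le> card {ys. length ys = k \<and> distinct ys \<and> set ys \<subseteq> {..<n} - {i}}"
  proof (cases "k < n")
    case True
    have "(n - k) ^ k = (\<Prod>j\<in>{n - k..n - 1}. n - k)" using True by simp
    also have "\<dots> \<le> \<Prod>{n - k..n - 1}" by (intro prod_mono) auto
    finally show ?thesis using \<open>k < n \<Longrightarrow> _\<close> True by simp
  next
    case False
    \<comment> \<open>Here the claimed bound is \<open>0 ^ n\<close> with \<open>n > 0\<close>,
      hence 0.\<close>
    hence "k = n" using k by simp
    thus ?thesis using i by (cases n) auto
  qed
  hence "real (n - k) ^ k * p ^ k \<le> real (card {ys. length ys = k \<and> distinct ys \<and> set ys \<subseteq> {..<n} - {i}}) * p ^ k"
    using p by (intro mult_right_mono) (auto simp: of_nat_power[symmetric] simp del: of_nat_power)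
  finally show ?thesis by (simp add: power_mult_distrib)
qed

section \<open>The upper bound\<close>

text \<open>The sign lets one argument treat the centred adjacency matrix and its negative
  together.\<close>

definition signed_mat :: "nat \<Rightarrow> real \<Rightarrow> real \<Rightarrow> nat set set \<Rightarrow> real Matrix.mat" where
  "signed_mat n p \<sigma> G = \<sigma> \<cdot>\<^sub>m centered_adj_mat n p G"

definition edge_set :: "nat \<Rightarrow> (nat set \<Rightarrow> bool) \<Rightarrow> nat set set" where
  "edge_set n f = {e \<in> all_edges n. f e}"

lemma erdos_renyi_eq: "erdos_renyi n p = map_pmf (edge_set n) (bernoulli_product (all_edges n) p)"
  by (simp add: erdos_renyi_def edge_set_def[abs_def])

lemma edge_set_subset: "edge_set n f \<subseteq> all_edges n"
  by (auto simp: edge_set_def)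

lemma pair_in_all_edges: "i < n \<Longrightarrow> j < n \<Longrightarrow> i \<noteq> j \<Longrightarrow> {i,j} \<in> all_edges n"
  by (simp add: all_edges_def)

lemma expected_adj_mat_entry:
  assumes p: "0 \<le> p" "p \<le> 1" and ij: "i < n" "j < n"
  shows "expected_adj_mat n p $$ (i,j) = (if i = j then 0 else p)"
proof -
  have "measure_pmf.expectation (erdos_renyi n p) (\<lambda>G. Defs.adj_mat n G $$ (i,j))
      = measure_pmf.expectation (erdos_renyi n p) (\<lambda>G. if i = j then 0 else of_bool ({{i,j}} \<subseteq> G))"
  proof (intro integral_cong_AE)
    show "AE G in measure_pmf (erdos_renyi n p). Defs.adj_mat n G $$ (i,j) = (if i = j then 0 else of_bool ({{i,j}} \<subseteq> G))"
      using ij by (auto simp: AE_measure_pmf_iff erdos_renyi_eq Defs.adj_mat_def edge_set_def all_edges_def)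
  qed auto
  also have "\<dots> = (if i = j then 0 else p)"
    using expectation_erdos_renyi_superset[of "{{i,j}}" n p] p pair_in_all_edges[OF ij] by auto
  finally show ?thesis using ij by (simp add: expected_adj_mat_def)
qed

lemma signed_mat_carrier: "signed_mat n p \<sigma> G \<in> carrier_mat n n"
  by (simp add: signed_mat_def centered_adj_mat_def Defs.adj_mat_def expected_adj_mat_def minus_carrier_mat)

lemma signed_mat_entry:
  assumes p: "0 \<le> p" "p \<le> 1" and G: "G \<subseteq> all_edges n" and ij: "i < n" "j < n"
  shows "signed_mat n p \<sigma> G $$ (i,j) = (if i = j then 0 else \<sigma> * (of_bool ({i,j} \<in> G) - p))"
proof -
  have "{i} \<notin> G" using G by (auto simp: all_edges_def)
  moreover have "expected_adj_mat n p \<in> carrier_mat n n" by (simp add: expected_adj_mat_def)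
  ultimately show ?thesis
    using expected_adj_mat_entry[OF p ij] ij
    by (auto simp: signed_mat_def centered_adj_mat_def Defs.adj_mat_def)
qed

lemma smult_one_mat: "1 \<cdot>\<^sub>m (A :: real Matrix.mat) = A"
  by (auto simp: mat_eq_iff)

lemma signed_mat_1: "signed_mat n p 1 G = centered_adj_mat n p G"
  by (simp add: signed_mat_def smult_one_mat)

lemma signed_mat_minus_1: "signed_mat n p (-1) G = - centered_adj_mat n p G"
  by (auto simp: signed_mat_def mat_eq_iff)

section \<open>The SDP value as a function of the matrix\<close>

lemma bdd_above_mat_inner_sdp_feasible:
  assumes M: "M \<in> carrier_mat n n"
  shows "bdd_above (mat_inner M ` sdp_feasible n)"
proof (intro bdd_aboveI2)
  fix X assume X: "X \<in> sdp_feasible n"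
  hence Xc: "X \<in> carrier_mat n n" by (simp add: sdp_feasible_def)
  show "mat_inner M X \<le> (\<Sum>i<n. \<Sum>j<n. \<bar>M $$ (i,j)\<bar>)"
    unfolding mat_inner_eq[OF M Xc]
  proof (intro sum_mono)
    fix i j assume "i \<in> {..<n}" "j \<in> {..<n}"
    hence "\<bar>M $$ (i,j)\<bar> * \<bar>X $$ (i,j)\<bar> \<le> \<bar>M $$ (i,j)\<bar> * 1"
      using sdp_feasible_entry_bound[OF X] by (intro mult_left_mono) auto
    thus "M $$ (i,j) * X $$ (i,j) \<le> \<bar>M $$ (i,j)\<bar>"
      using abs_ge_self[of "M $$ (i,j) * X $$ (i,j)"] by (simp add: abs_mult)
  qed
qed

lemma mat_inner_le_SDP:
  assumes M: "M \<in> carrier_mat n n" and X: "X \<in> sdp_feasible n"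
  shows "mat_inner M X \<le> SDP M"
  unfolding SDP_def using M X bdd_above_mat_inner_sdp_feasible[OF M]
  by (intro cSUP_upper) auto

lemma SDP_diff_le:
  assumes M: "M \<in> carrier_mat n n" and M': "M' \<in> carrier_mat n n"
    and le: "\<And>X. X \<in> sdp_feasible n \<Longrightarrow> mat_inner M' X \<le> mat_inner M X + c"
  shows "SDP M' \<le> SDP M + c"
proof -
  have "SDP M' = (SUP X \<in> sdp_feasible n. mat_inner M' X)" using M' by (simp add: SDP_def)
  also have "\<dots> \<le> SDP M + c"
    using one_mat_sdp_feasible[of n] le mat_inner_le_SDP[OF M]
    by (intro cSUP_least) (auto intro: order.trans[OF le add_right_mono])
  finally show ?thesis .
qed

lemma signed_mat_update:
  assumes p: "0 \<le> p" "p \<le> 1" and ij: "i < n" "j < n" "i \<noteq> j" and kl: "k < n" "l < n"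
  shows "signed_mat n p \<sigma> (edge_set n (f({i,j} := True))) $$ (k,l)
    = signed_mat n p \<sigma> (edge_set n (f({i,j} := False))) $$ (k,l) + (if {k,l} = {i,j} then \<sigma> else 0)"
  unfolding signed_mat_entry[OF p edge_set_subset kl]
  using pair_in_all_edges[OF ij] ij by (auto simp: edge_set_def algebra_simps doubleton_eq_iff insert_commute)

text \<open>Switching an edge moves two symmetric entries by \<open>\<sigma>\<close>, and each is
  paired with an entry of \<open>X\<close> of modulus at most 1, uniformly over the feasible
  set.\<close>

lemma SDP_signed_mat_lipschitz:
  assumes p: "0 \<le> p" "p \<le> 1" and \<sigma>: "\<bar>\<sigma>\<bar> = 1" and e: "e \<in> all_edges n"
  shows "\<bar>SDP (signed_mat n p \<sigma> (edge_set n (f(e := True)))) - SDP (signed_mat n p \<sigma> (edge_set n (f(e := False))))\<bar> \<le> 2"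
proof -
  obtain i j where ij: "e = {i,j}" "i \<noteq> j" using e by (auto simp: all_edges_def card_2_iff)
  have ijn: "i < n" "j < n" using e ij by (auto simp: all_edges_def)
  let ?M = "signed_mat n p \<sigma> (edge_set n (f(e := False)))"
  let ?M' = "signed_mat n p \<sigma> (edge_set n (f(e := True)))"
  have *: "\<bar>mat_inner ?M' X - mat_inner ?M X\<bar> \<le> 2" if X: "X \<in> sdp_feasible n" for X
  proof -
    have Xc: "X \<in> carrier_mat n n" using X by (simp add: sdp_feasible_def)
    have "mat_inner ?M' X = mat_inner ?M X + \<sigma> * X $$ (i,j) + \<sigma> * X $$ (j,i)"
      unfolding ij(1) using p ij(2) ijn
      by (intro mat_inner_pair_perturbation[OF signed_mat_carrier signed_mat_carrier Xc] signed_mat_update) auto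
    hence "\<bar>mat_inner ?M' X - mat_inner ?M X\<bar> = \<bar>\<sigma> * X $$ (i,j) + \<sigma> * X $$ (j,i)\<bar>" by simp
    also have "\<dots> \<le> \<bar>X $$ (i,j)\<bar> + \<bar>X $$ (j,i)\<bar>"
      using abs_triangle_ineq[of "\<sigma> * X $$ (i,j)" "\<sigma> * X $$ (j,i)"] \<sigma> by (simp add: abs_mult)
    finally show ?thesis
      using sdp_feasible_entry_bound[OF X ijn] sdp_feasible_entry_bound[OF X ijn(2,1)] by linarith
  qed
  have "SDP ?M' \<le> SDP ?M + 2" "SDP ?M \<le> SDP ?M' + 2"
    using * by (intro SDP_diff_le[OF signed_mat_carrier signed_mat_carrier]; force simp: abs_le_iff)+
  thus ?thesis by (simp add: abs_le_iff)
qed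

text \<open>Regularising the problem for \<open>M / r\<close> amounts to a barrier of strength
  \<open>r\<close>: the price grows to \<open>r * n\<close>, while the reaction of the optimum to a
  change of \<open>M\<close> shrinks by the factor \<open>1 / r\<close>.\<close>

lemma SDP_le_scaled_reg_optimum:
  assumes M: "M \<in> carrier_mat n n" and r: "r > 0"
  shows "SDP M \<le> mat_inner M (reg_optimum n ((1 / r) \<cdot>\<^sub>m M)) + r * real n"
proof -
  define X where "X = reg_optimum n ((1 / r) \<cdot>\<^sub>m M)"
  have M': "(1 / r) \<cdot>\<^sub>m M \<in> carrier_mat n n" using M by simp
  have sc: "mat_inner ((1 / r) \<cdot>\<^sub>m M) Y = mat_inner M Y / r" if "Y \<in> carrier_mat n n" for Y
    unfolding mat_inner_eq[OF M that] mat_inner_eq[OF M' that] sum_divide_distrib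
    using M by (intro sum.cong refl) auto
  have Xc: "X \<in> carrier_mat n n"
    using reg_optimum(1)[OF M'] by (simp add: X_def sdp_feasible_def)
  have "mat_inner M Y \<le> mat_inner M X + r * real n" if Y: "Y \<in> sdp_feasible n" for Y
  proof -
    have Yc: "Y \<in> carrier_mat n n" using Y by (simp add: sdp_feasible_def)
    have "mat_inner M Y / r \<le> mat_inner M X / r + real n"
      using mat_inner_le_reg_optimum[OF M' Y] unfolding X_def[symmetric] sc[OF Yc] sc[OF Xc] .
    thus ?thesis using r by (simp add: field_simps)
  qed
  thus ?thesis unfolding SDP_def X_def[symmetric] using M one_mat_sdp_feasible[of n]
    by (intro cSUP_least) auto
qed

text \<open>
  Conditioning on all other edges, the correlation of the edge \<open>{i,j}\<close> with the entry \<open>X $$ (i,j)\<close>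
  of the regularised optimum is \<open>p * (1 - p)\<close> times the jump of that entry, at most \<open>1 / r\<close>.
\<close>

lemma expectation_SDP_le:
  assumes p: "0 < p" "p \<le> 1" and \<sigma>: "\<bar>\<sigma>\<bar> = 1"
  shows "measure_pmf.expectation (erdos_renyi n p) (\<lambda>G. SDP (signed_mat n p \<sigma> G))
    \<le> 2 * sqrt (real n * p) * real n"
proof (cases "n = 0")
  case True
  \<comment> \<open>For \<open>n = 0\<close> the strength chosen below would be 0. Strength 1 serves
    here, since its price is a multiple of \<open>n\<close>.\<close>
  have "SDP (signed_mat n p \<sigma> G) \<le> 0" for G
    using SDP_le_scaled_reg_optimum[OF signed_mat_carrier[of n p \<sigma> G], of 1]
      reg_optimum(1)[of "(1/1) \<cdot>\<^sub>m signed_mat n p \<sigma> G" n] True signed_mat_carrier[of n p \<sigma> G]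
    by (auto simp: mat_inner_eq[of _ 0] sdp_feasible_def)
  thus ?thesis using True expectation_erdos_renyi_mono[of "\<lambda>G. SDP (signed_mat n p \<sigma> G)" "\<lambda>_. 0" n p] by simp
next
  case False
  have p': "0 \<le> p" "p \<le> 1" using p by auto
  \<comment> \<open>This balances the price \<open>r * n\<close> against the total correlation
    \<open>n * n * p / r\<close>.\<close>
  define r where "r = sqrt (real n * p)"
  have r: "r > 0" using p False by (simp add: r_def)
  define M where "M f = signed_mat n p \<sigma> (edge_set n f)" for f
  define X where "X f = reg_optimum n ((1 / r) \<cdot>\<^sub>m M f)" for f
  let ?P = "bernoulli_product (all_edges n) p"
  have M: "M f \<in> carrier_mat n n" for f unfolding M_def by (rule signed_mat_carrier)
  have M': "(1 / r) \<cdot>\<^sub>m M f \<in> carrier_mat n n" for f using M by simp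
  have Xc: "X f \<in> carrier_mat n n" for f
    using reg_optimum(1)[OF M'] by (auto simp: X_def sdp_feasible_def)
  have jump: "\<bar>X (f({i,j} := True)) $$ (i,j) - X (f({i,j} := False)) $$ (i,j)\<bar> \<le> 1 / r"
    if ij: "i < n" "j < n" "i \<noteq> j" for i j f
  proof -
    have "\<bar>X (f({i,j} := True)) $$ (i,j) - X (f({i,j} := False)) $$ (i,j)\<bar> \<le> \<bar>\<sigma> / r\<bar>"
      unfolding X_def
    proof (rule reg_optimum_perturbation[OF M' M' ij])
      fix k l assume kl: "k < n" "l < n"
      show "((1 / r) \<cdot>\<^sub>m M (f({i,j} := True))) $$ (k,l)
        = ((1 / r) \<cdot>\<^sub>m M (f({i,j} := False))) $$ (k,l) + (if {k,l} = {i,j} then \<sigma> / r else 0)"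
        using kl M[of "f({i,j} := True)"] M[of "f({i,j} := False)"] signed_mat_update[OF p' ij kl, of \<sigma> f]
        by (auto simp: M_def add_divide_distrib)
    qed
    thus ?thesis using \<sigma> r by simp
  qed
  have entry: "measure_pmf.expectation ?P (\<lambda>f. M f $$ (i,j) * X f $$ (i,j)) \<le> p / r"
    if ij: "i < n" "j < n" for i j
  proof (cases "i = j")
    case True
    hence "M f $$ (i,j) = 0" for f using signed_mat_entry[OF p' edge_set_subset ij] by (simp add: M_def)
    thus ?thesis using p r by simp
  next
    case ne: False
    let ?Z = "\<lambda>f. \<sigma> * X f $$ (i,j)"
    have "measure_pmf.expectation ?P (\<lambda>f. M f $$ (i,j) * X f $$ (i,j))
        = measure_pmf.expectation ?P (\<lambda>f. (of_bool (f {i,j}) - p) * ?Z f)"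
      using signed_mat_entry[OF p' edge_set_subset ij] ne pair_in_all_edges[OF ij ne]
      by (simp add: M_def edge_set_def mult_ac)
    also have "\<dots> = p * (1 - p) * measure_pmf.expectation ?P (\<lambda>f. ?Z (f({i,j} := True)) - ?Z (f({i,j} := False)))"
      by (rule expectation_centered_coordinate[OF finite_all_edges pair_in_all_edges[OF ij ne] p'])
    also have "\<dots> \<le> p * (1 - p) * (1 / r)"
    proof (intro mult_left_mono measure_pmf.integral_le_const integrable_bernoulli_product finite_all_edges AE_I2)
      fix f
      have "?Z (f({i,j} := True)) - ?Z (f({i,j} := False))
          = \<sigma> * (X (f({i,j} := True)) $$ (i,j) - X (f({i,j} := False)) $$ (i,j))"
        by (simp add: algebra_simps)
      also have "\<dots> \<le> \<bar>\<sigma>\<bar> * \<bar>X (f({i,j} := True)) $$ (i,j) - X (f({i,j} := False)) $$ (i,j)\<bar>"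
        unfolding abs_mult[symmetric] by (rule abs_ge_self)
      also have "\<dots> \<le> 1 / r" using jump[OF ij ne] \<sigma> by simp
      finally show "?Z (f({i,j} := True)) - ?Z (f({i,j} := False)) \<le> 1 / r" .
    qed (use p in auto)
    also have "\<dots> \<le> p * 1 * (1 / r)" using p r by (intro mult_right_mono mult_left_mono) auto
    finally show ?thesis by simp
  qed
  have "measure_pmf.expectation (erdos_renyi n p) (\<lambda>G. SDP (signed_mat n p \<sigma> G))
      = measure_pmf.expectation ?P (\<lambda>f. SDP (M f))"
    by (simp add: erdos_renyi_eq M_def)
  also have "\<dots> \<le> measure_pmf.expectation ?P (\<lambda>f. (\<Sum>i<n. \<Sum>j<n. M f $$ (i,j) * X f $$ (i,j)) + r * real n)"
    using SDP_le_scaled_reg_optimum[OF M r]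
    by (intro integral_mono integrable_bernoulli_product finite_all_edges)
      (simp add: X_def[symmetric] mat_inner_eq[OF M Xc])
  also have "\<dots> = (\<Sum>i<n. \<Sum>j<n. measure_pmf.expectation ?P (\<lambda>f. M f $$ (i,j) * X f $$ (i,j))) + r * real n"
    by (simp add: Bochner_Integration.integral_add integrable_bernoulli_product finite_all_edges
        Bochner_Integration.integral_sum)
  also have "\<dots> \<le> (\<Sum>i<n. \<Sum>j<n. p / r) + r * real n"
    by (intro add_mono sum_mono entry) auto
  also have "(\<Sum>i<n. \<Sum>j<n. p / r) = real n * (real n * p) / r" by simp
  also have "real n * p = r * r" using p by (simp add: r_def)
  also have "real n * (r * r) / r + r * real n = 2 * r * real n" using r by simp
  finally show ?thesis by (simp add: r_def)
qed

lemma SDP_nonneg: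
  assumes p: "0 \<le> p" "p \<le> 1" and G: "G \<subseteq> all_edges n"
  shows "0 \<le> SDP (signed_mat n p \<sigma> G)"
proof -
  have "mat_inner (signed_mat n p \<sigma> G) (1\<^sub>m n) = (\<Sum>i<n. \<Sum>j<n. 0)"
    unfolding mat_inner_eq[OF signed_mat_carrier one_carrier_mat]
    by (intro sum.cong refl) (simp add: signed_mat_entry[OF p G])
  thus ?thesis using mat_inner_le_SDP[OF signed_mat_carrier one_mat_sdp_feasible, of n p \<sigma> G] by simp
qed

text \<open>There are at most \<open>n * n\<close> edges and the Lipschitz constant is 2, so for
  fixed \<open>n * p\<close> both terms of the exponent are linear in \<open>n\<close> when
  \<open>t\<close> is.\<close>

lemma SDP_concentration:
  assumes p: "0 \<le> p" "p \<le> 1" and \<sigma>: "\<bar>\<sigma>\<bar> = 1" and l: "0 < l" "2 * l \<le> 1"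
  shows "measure_pmf.prob (erdos_renyi n p)
      {G. \<bar>SDP (signed_mat n p \<sigma> G) - measure_pmf.expectation (erdos_renyi n p) (\<lambda>G. SDP (signed_mat n p \<sigma> G))\<bar> \<ge> t}
    \<le> 2 * exp (4 * real n * (real n * p) * l\<^sup>2 - l * t)"
proof -
  have cd: "card (all_edges n) \<le> n * n"
  proof -
    have "all_edges n \<subseteq> (\<lambda>(i,j). {i,j}) ` ({..<n} \<times> {..<n})"
      by (auto simp: all_edges_def card_2_iff image_iff)
    hence "card (all_edges n) \<le> card ((\<lambda>(i,j). {i,j}) ` ({..<n} \<times> {..<n}))"
      by (intro card_mono) auto
    also have "\<dots> \<le> card ({..<n} \<times> {..<n})" by (intro card_image_le) auto
    finally show ?thesis by simp
  qed
  let ?P = "bernoulli_product (all_edges n) p"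
  define g where "g f = SDP (signed_mat n p \<sigma> (edge_set n f))" for f
  have "measure_pmf.prob (erdos_renyi n p)
      {G. \<bar>SDP (signed_mat n p \<sigma> G) - measure_pmf.expectation (erdos_renyi n p) (\<lambda>G. SDP (signed_mat n p \<sigma> G))\<bar> \<ge> t}
    = measure_pmf.prob ?P {f. \<bar>g f - measure_pmf.expectation ?P g\<bar> \<ge> t}"
    by (simp add: erdos_renyi_eq measure_map_pmf vimage_def g_def[abs_def])
  also have "\<dots> \<le> 2 * exp (real (card (all_edges n)) * p * (l * 2)\<^sup>2 - l * t)"
    using l unfolding g_def
    by (intro bernoulli_product_concentration finite_all_edges p SDP_signed_mat_lipschitz \<sigma>) auto
  also have "\<dots> \<le> 2 * exp (4 * real n * (real n * p) * l\<^sup>2 - l * t)"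
  proof -
    have "real (card (all_edges n)) * p * (l * 2)\<^sup>2 \<le> real (n * n) * p * (l * 2)\<^sup>2"
      using cd p by (intro mult_right_mono) (auto simp: of_nat_mult[symmetric] simp del: of_nat_mult)
    thus ?thesis by (simp add: power_mult_distrib algebra_simps)
  qed
  finally show ?thesis .
qed

section \<open>The lower bound\<close>

text \<open>Any cycle met by a short exploration from \<open>i\<close> produces a lollipop, so its absence makes the
  neighbourhood of \<open>i\<close> a tree.\<close>

definition lollipop :: "nat \<Rightarrow> nat set set \<Rightarrow> nat \<Rightarrow> nat \<Rightarrow> bool" where
  "lollipop n G i R \<longleftrightarrow> (\<exists>k\<le>R. \<exists>ys\<in>sa_paths n G i k. \<exists>x\<in>set (butlast (i # ys)).
     {last (i # ys), x} \<in> G - path_edges (i # ys))"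

lemma sa_paths_iff:
  "ys \<in> sa_paths n G i k \<longleftrightarrow>
    length ys = k \<and> distinct (i # ys) \<and> set ys \<subseteq> {..<n} \<and> path_edges (i # ys) \<subseteq> G"
  by (auto simp: sa_paths_def sa_walks_def)

text \<open>Two distinct paths with the same ends close a cycle. Let \<open>x\<close> be their last
  common vertex before they part towards \<open>b\<close> and \<open>c\<close>, and let
  \<open>y\<close> be the first vertex of the second branch lying on the first. The walk
  \<open>W\<close> reaches \<open>x\<close>, follows the second path to \<open>y\<close> and returns
  along the first to \<open>b\<close>; it is self-avoiding, and the edge \<open>{b,x}\<close> is its
  chord.\<close>

lemma sa_path_unique:
  assumes nl: "\<not> lollipop n G i R" and ys: "ys \<in> sa_paths n G i k" and zs: "zs \<in> sa_paths n G i l"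
    and last: "last (i # ys) = last (i # zs)" and R: "k + l \<le> R"
  shows "ys = zs"
proof (rule ccontr)
  assume "ys \<noteq> zs"
  define P where "P = i # ys"
  define Q where "Q = i # zs"
  have PQ: "P \<noteq> Q" "distinct P" "distinct Q" "last P = last Q" "P \<noteq> []" "Q \<noteq> []" "hd P = i" "hd Q = i"
    "path_edges P \<subseteq> G" "path_edges Q \<subseteq> G" "length P = Suc k" "length Q = Suc l"
    using \<open>ys \<noteq> zs\<close> ys zs last by (auto simp: P_def Q_def sa_paths_iff)
  \<comment> \<open>Neither path can extend the other, since their common endpoint would occur twice
    in the longer one; so they branch properly.\<close>
  have noprefix: "\<not> strict_prefix A B" if "distinct B" "last A = last B" "A \<noteq> []" for A B :: "nat list"
  proof
    assume "strict_prefix A B"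
    then obtain z zs where "B = A @ z # zs" by (elim strict_prefixE')
    moreover have "last A \<in> set A" using that(3) by (rule last_in_set)
    ultimately show False using that by (metis disjoint_iff distinct_append last_appendR last_in_set list.distinct(1))
  qed
  have "P \<parallel> Q"
    using noprefix[of Q P] noprefix[of P Q] PQ by (auto simp: parallel_def strict_prefix_def)
  then obtain as b bs c cs where dec: "b \<noteq> c" "P = as @ b # bs" "Q = as @ c # cs"
    using parallel_decomp by blast
  have "as \<noteq> []" using dec PQ by auto
  then obtain as' x where as: "as = as' @ [x]" by (metis rev_exhaust)
  have "last Q \<in> set (b # bs)" using PQ(4) dec by (metis last_appendR last_in_set list.distinct(1))
  moreover have "last Q \<in> set (c # cs)" using dec by (metis last_appendR last_in_set list.distinct(1))
  ultimately have "\<exists>y\<in>set (c # cs). y \<in> set (b # bs)" by blast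
  then obtain us y vs where us: "c # cs = us @ y # vs" "y \<in> set (b # bs)" "\<And>u. u \<in> set us \<Longrightarrow> u \<notin> set (b # bs)"
    using split_list_first_prop[of "c # cs" "\<lambda>y. y \<in> set (b # bs)"] by blast
  obtain qs rs where qs: "b # bs = qs @ y # rs" using us(2) split_list by metis
  define t where "t = us @ y # rev qs"
  define W where "W = as' @ x # t"
  have P: "P = as' @ x # qs @ y # rs" using dec(2) as qs by simp
  have Q: "Q = as' @ x # us @ y # vs" using dec(3) as us(1) by simp
  have distW: "distinct W"
    using PQ(2,3) us(3) unfolding W_def t_def P Q qs by auto
  have hdt: "hd t = c" using us(1) by (cases us) (auto simp: t_def)
  have tne: "t \<noteq> []" by (simp add: t_def)
  have lastt: "last t = b" using qs by (cases qs) (auto simp: t_def)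
  have hdW: "W = i # tl W"
    using PQ(7) unfolding W_def P by (cases as') auto
  have pe1: "path_edges W \<subseteq> path_edges P \<union> path_edges Q"
  proof -
    have "path_edges W = path_edges ((as' @ x # us) @ [y]) \<union> path_edges (y # rev qs)"
      unfolding W_def t_def using path_edges_append[of "as' @ x # us" y "rev qs"] by simp
    also have "path_edges (y # rev qs) = path_edges (qs @ [y])"
      using path_edges_rev[of "qs @ [y]"] by simp
    also have "path_edges (qs @ [y]) \<subseteq> path_edges P"
      unfolding P using path_edges_append[of "as' @ x # qs" y rs] path_edges_append[of "as' @ [x]" "hd (qs @ [y])" "tl (qs @ [y])"]
        path_edges_append[of "as'" x "qs @ [y]"] by (cases qs) auto
    also have "path_edges ((as' @ x # us) @ [y]) \<subseteq> path_edges Q"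
      unfolding Q using path_edges_append[of "as' @ x # us" y vs] by simp
    finally show ?thesis by blast
  qed
  have chord: "{b,x} \<in> path_edges P"
    unfolding dec(2) as using path_edges_append[of as' x "b # bs"] by (simp add: insert_commute)
  \<comment> \<open>Up to \<open>x\<close> the walk avoids \<open>b\<close>, after \<open>x\<close>
    it avoids \<open>x\<close>, and the edge leaving \<open>x\<close> goes to \<open>c\<close>,
    which differs from \<open>b\<close>.\<close>
  have nchord: "{b,x} \<notin> path_edges W"
  proof
    assume "{b,x} \<in> path_edges W"
    moreover have "path_edges W = path_edges (as' @ [x]) \<union> path_edges (x # t)"
      unfolding W_def by (rule path_edges_append)
    moreover have "b \<in> set t" using lastt tne last_in_set by metis
    hence "b \<notin> set (as' @ [x])" using distW by (auto simp: W_def)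
    hence "{b,x} \<notin> path_edges (as' @ [x])" using Union_path_edges[of "as' @ [x]"] by auto
    ultimately have "{b,x} \<in> path_edges (x # t)" by simp
    moreover obtain h t' where t: "t = h # t'" using tne by (cases t) auto
    moreover have "x \<notin> set t" using distW by (auto simp: W_def)
    hence "{b,x} \<notin> path_edges t" using Union_path_edges[of t] by auto
    ultimately have "{b,x} = {x,h}" by simp
    hence "b = h" by (auto simp: doubleton_eq_iff)
    thus False using hdt dec(1) t by simp
  qed
  have lastW: "last W = b" using lastt tne by (simp add: W_def)
  have lenW: "length W \<le> Suc R"
  proof -
    have "length W + 1 \<le> length P + length Q" unfolding W_def t_def P Q by simp
    thus ?thesis using PQ R by simp
  qed
  have setW: "set W \<subseteq> set P \<union> set Q" unfolding W_def t_def P Q by auto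
  have "x \<in> set (butlast W)"
  proof -
    have "butlast W = as' @ x # butlast t" using tne by (simp add: W_def butlast_append)
    thus ?thesis by simp
  qed
  moreover obtain U where WU: "W = i # U" using hdW by blast
  have "U \<in> sa_paths n G i (length U)"
  proof -
    have "i \<notin> set U" using distW WU by simp
    moreover have "set W \<subseteq> insert i {..<n}"
      using setW ys zs by (auto simp: P_def Q_def sa_paths_iff)
    ultimately have "set U \<subseteq> {..<n}" unfolding WU by auto
    moreover have "path_edges W \<subseteq> G" using pe1 PQ(9,10) by blast
    ultimately show ?thesis using distW unfolding sa_paths_iff WU by simp
  qed
  moreover have "length U \<le> R" using lenW by (simp add: WU)
  moreover have "{last W, x} \<in> G - path_edges W" using chord nchord PQ(9) by (auto simp: lastW)
  ultimately have "lollipop n G i R" unfolding lollipop_def WU by blast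
  thus False using nl by simp
qed

lemma card_sa_walks_le: "card (sa_walks n i k) \<le> n ^ k"
proof -
  have "card (sa_walks n i k) \<le> card {ys. set ys \<subseteq> {..<n} \<and> length ys = k}"
    by (intro card_mono finite_lists_length_eq) (auto simp: sa_walks_def)
  thus ?thesis by (simp add: card_lists_length_eq)
qed

text \<open>First moment: a lollipop with \<open>k\<close> path edges has \<open>k\<close> free
  vertices but \<open>k + 1\<close> edges. The surplus edge leaves a factor \<open>p\<close>, so the
  probability is of order \<open>1 / n\<close> for fixed \<open>n * p\<close> and
  \<open>R\<close>.\<close>

lemma expectation_lollipop_le:
  assumes p: "0 \<le> p" "p \<le> 1" and i: "i < n"
  shows "measure_pmf.expectation (erdos_renyi n p) (\<lambda>G. of_bool (lollipop n G i R))
    \<le> real (Suc R) ^ 2 * (1 + real n * p) ^ R * p"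
proof -
  define X where "X ys = {x \<in> set (butlast (i # ys)). {last (i # ys), x} \<notin> path_edges (i # ys)}" for ys
  define F where "F ys x = insert {last (i # ys), x} (path_edges (i # ys))" for ys x
  have cX: "finite (X ys)" "card (X ys) \<le> length ys" for ys
  proof -
    show "finite (X ys)" by (simp add: X_def)
    have "card (X ys) \<le> card (set (butlast (i # ys)))" unfolding X_def by (intro card_mono) auto
    also have "\<dots> \<le> length (butlast (i # ys))" by (rule card_length)
    finally show "card (X ys) \<le> length ys" by (simp del: butlast.simps)
  qed
  have "measure_pmf.expectation (erdos_renyi n p) (\<lambda>G. of_bool (lollipop n G i R) :: real)
    \<le> measure_pmf.expectation (erdos_renyi n p)
        (\<lambda>G. \<Sum>k\<le>R. \<Sum>ys\<in>sa_walks n i k. \<Sum>x\<in>X ys. of_bool (F ys x \<subseteq> G))"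
  proof (intro expectation_erdos_renyi_mono)
    fix G
    show "of_bool (lollipop n G i R) \<le> (\<Sum>k\<le>R. \<Sum>ys\<in>sa_walks n i k. \<Sum>x\<in>X ys. of_bool (F ys x \<subseteq> G) :: real)"
    proof (cases "lollipop n G i R")
      case True
      then obtain k ys x where k: "k \<le> R" and ys: "ys \<in> sa_paths n G i k" and x: "x \<in> set (butlast (i # ys))"
        and chord: "{last (i # ys), x} \<in> G - path_edges (i # ys)"
        unfolding lollipop_def by blast
      have xX: "x \<in> X ys" using x chord by (simp add: X_def)
      have yw: "ys \<in> sa_walks n i k" and "F ys x \<subseteq> G" using ys chord by (auto simp: F_def sa_paths_def)
      hence "1 = (of_bool (F ys x \<subseteq> G) :: real)" by simp
      also have "\<dots> \<le> (\<Sum>x\<in>X ys. of_bool (F ys x \<subseteq> G))"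
        by (rule member_le_sum[OF xX]) (auto simp: cX)
      also have "\<dots> \<le> (\<Sum>ys\<in>sa_walks n i k. \<Sum>x\<in>X ys. of_bool (F ys x \<subseteq> G))"
        by (rule member_le_sum[OF yw]) (auto simp: finite_sa_walks intro!: sum_nonneg)
      also have "\<dots> \<le> (\<Sum>k\<le>R. \<Sum>ys\<in>sa_walks n i k. \<Sum>x\<in>X ys. of_bool (F ys x \<subseteq> G))"
        using k by (intro member_le_sum[of k]) (auto intro!: sum_nonneg)
      finally show ?thesis by simp
    qed (auto intro!: sum_nonneg)
  qed
  also have "\<dots> = (\<Sum>k\<le>R. \<Sum>ys\<in>sa_walks n i k. \<Sum>x\<in>X ys. measure_pmf.expectation (erdos_renyi n p) (\<lambda>G. of_bool (F ys x \<subseteq> G)))"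
    by (simp add: expectation_erdos_renyi_sum)
  also have "\<dots> = (\<Sum>k\<le>R. \<Sum>ys\<in>sa_walks n i k. \<Sum>x\<in>X ys. p ^ Suc k)"
  proof (intro sum.cong refl)
    fix k ys x assume ys: "ys \<in> sa_walks n i k" and x: "x \<in> X ys"
    hence d: "distinct (i # ys)" "set (i # ys) \<subseteq> {..<n}" "length ys = k" using i by (auto simp: sa_walks_def)
    have "x \<in> set (i # ys)" using x in_set_butlastD unfolding X_def by fast
    moreover have "x \<noteq> last (i # ys)"
    proof -
      have "distinct (butlast (i # ys) @ [last (i # ys)])" using d(1) by (metis append_butlast_last_id list.distinct(1))
      thus ?thesis using x by (auto simp: X_def)
    qed
    moreover have "last (i # ys) \<in> set (i # ys)" by (rule last_in_set) simp
    ultimately have "{last (i # ys), x} \<in> all_edges n"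
      using d(2) by (intro pair_in_all_edges) blast+
    hence sub: "F ys x \<subseteq> all_edges n"
      using path_edges_subset_all_edges[OF d(1,2)] by (simp add: F_def)
    have "card (F ys x) = Suc k"
      using x card_path_edges[OF d(1)] finite_path_edges[of "i # ys"] d(3) by (simp add: F_def X_def)
    thus "measure_pmf.expectation (erdos_renyi n p) (\<lambda>G. of_bool (F ys x \<subseteq> G)) = p ^ Suc k"
      using expectation_erdos_renyi_superset[OF sub p] by simp
  qed
  also have "\<dots> \<le> (\<Sum>k\<le>R. \<Sum>ys\<in>sa_walks n i k. real (Suc R) * p ^ Suc k)"
  proof (intro sum_mono)
    fix k ys assume "k \<in> {..R}" "ys \<in> sa_walks n i k"
    hence "card (X ys) \<le> Suc R" using cX(2)[of ys] by (auto simp: sa_walks_def)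
    thus "(\<Sum>x\<in>X ys. p ^ Suc k) \<le> real (Suc R) * p ^ Suc k"
      using p by (simp add: mult_right_mono del: power_Suc of_nat_Suc)
  qed
  also have "\<dots> = (\<Sum>k\<le>R. real (card (sa_walks n i k)) * (real (Suc R) * p ^ Suc k))" by simp
  also have "\<dots> \<le> (\<Sum>k\<le>R. real (Suc R) * (1 + real n * p) ^ R * p)"
  proof (intro sum_mono)
    fix k assume k: "k \<in> {..R}"
    have "real (card (sa_walks n i k)) \<le> real (n ^ k)" using card_sa_walks_le[of n i k] by (simp only: of_nat_le_iff)
    hence "real (card (sa_walks n i k)) * (real (Suc R) * p ^ Suc k) \<le> real n ^ k * (real (Suc R) * p ^ Suc k)"
      using p by (intro mult_right_mono) auto
    also have "\<dots> = real (Suc R) * (real n * p) ^ k * p" by (simp add: power_mult_distrib)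
    also have "(real n * p) ^ k \<le> (1 + real n * p) ^ k" using p by (intro power_mono) auto
    also have "(1 + real n * p) ^ k \<le> (1 + real n * p) ^ R" using k p by (intro power_increasing) auto
    finally show "real (card (sa_walks n i k)) * (real (Suc R) * p ^ Suc k) \<le> real (Suc R) * (1 + real n * p) ^ R * p"
      using p by (simp add: mult_left_mono mult_right_mono)
  qed
  also have "\<dots> = real (Suc R) ^ 2 * (1 + real n * p) ^ R * p" by (simp add: power2_eq_square)
  finally show ?thesis .
qed

section \<open>Weighted path counts and path vectors\<close>

definition rooted_paths :: "nat \<Rightarrow> nat set set \<Rightarrow> nat \<Rightarrow> nat \<Rightarrow> nat list set" where
  "rooted_paths n G L i = (\<Union>k<L. sa_paths n G i k)"

definition path_mass :: "nat \<Rightarrow> nat set set \<Rightarrow> nat \<Rightarrow> real \<Rightarrow> nat \<Rightarrow> real" where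
  "path_mass n G L d i = (\<Sum>k<L. real (card (sa_paths n G i k)) / d ^ k)"

lemma rooted_paths_iff:
  "ys \<in> rooted_paths n G L i \<longleftrightarrow>
    length ys < L \<and> distinct (i # ys) \<and> set ys \<subseteq> {..<n} \<and> path_edges (i # ys) \<subseteq> G"
  by (auto simp: rooted_paths_def sa_paths_iff)

lemma finite_rooted_paths: "finite (rooted_paths n G L i)"
  unfolding rooted_paths_def by (auto simp: finite_sa_paths)

lemma sum_rooted_paths:
  fixes h :: "nat \<Rightarrow> real"
  shows "(\<Sum>ys\<in>rooted_paths n G L i. h (length ys)) = (\<Sum>k<L. real (card (sa_paths n G i k)) * h k)"
proof -
  have "(\<Sum>ys\<in>rooted_paths n G L i. h (length ys)) = (\<Sum>k<L. \<Sum>ys\<in>sa_paths n G i k. h (length ys))"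
    unfolding rooted_paths_def by (rule sum.UNION_disjoint) (auto simp: finite_sa_paths sa_paths_iff)
  also have "\<dots> = (\<Sum>k<L. \<Sum>ys\<in>sa_paths n G i k. h k)"
    by (intro sum.cong refl) (auto simp: sa_paths_iff)
  finally show ?thesis by simp
qed

lemma path_mass_eq: "path_mass n G L d i = (\<Sum>ys\<in>rooted_paths n G L i. 1 / d ^ length ys)"
  using sum_rooted_paths[of "\<lambda>k. 1 / d ^ k" n G L i] by (simp add: path_mass_def)

lemma path_mass_nonneg: "0 \<le> d \<Longrightarrow> 0 \<le> path_mass n G L d i"
  by (auto simp: path_mass_def intro!: sum_nonneg)

text \<open>\<open>Suc L\<close> admits lengths up to \<open>L\<close>, one more than occurs in
  \<open>path_vec\<close>: a path from a neighbour, prolonged by the joining edge, is then still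
  covered. Two such lengths add up to at most \<open>2 * L\<close>.\<close>

lemma rooted_path_unique:
  assumes "\<not> lollipop n G i (2 * L)" "ys \<in> rooted_paths n G (Suc L) i" "zs \<in> rooted_paths n G (Suc L) i"
    and "last (i # ys) = last (i # zs)"
  shows "ys = zs"
  using assms sa_path_unique[OF assms(1), of ys "length ys" zs "length zs"]
  by (auto simp: rooted_paths_iff sa_paths_iff)

text \<open>In a tree, the paths from the two ends of an edge to a common vertex differ by exactly
  that edge. If \<open>zs\<close> avoids \<open>i\<close>, then \<open>j # zs\<close> is the path
  from \<open>i\<close>; otherwise uniqueness of the path from \<open>j\<close> to \<open>i\<close>
  makes \<open>i\<close> the first step of \<open>zs\<close>.\<close>

lemma rooted_path_step:
  assumes nli: "\<not> lollipop n G i (2 * L)" and nlj: "\<not> lollipop n G j (2 * L)"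
    and ij: "i \<noteq> j" "{i,j} \<in> G" "i < n" "j < n"
    and ys: "ys \<in> rooted_paths n G L i" and zs: "zs \<in> rooted_paths n G L j"
    and last: "last (i # ys) = last (j # zs)"
  shows "ys = j # zs \<or> zs = i # ys"
proof (cases "i \<in> set zs")
  case False
  hence "j # zs \<in> rooted_paths n G (Suc L) i" using zs ij by (auto simp: rooted_paths_iff)
  hence "ys = j # zs"
    using ys last by (intro rooted_path_unique[OF nli]) (auto simp: rooted_paths_iff)
  thus ?thesis by simp
next
  case True
  then obtain us vs where zs_eq: "zs = us @ i # vs" by (metis split_list)
  have E: "path_edges (j # us @ [i]) \<subseteq> G" "path_edges (i # vs) \<subseteq> G"
    using zs path_edges_append[of "j # us" i vs] by (auto simp: rooted_paths_iff zs_eq)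
  have "us @ [i] = [i]"
  proof (rule rooted_path_unique[OF nlj])
    show "us @ [i] \<in> rooted_paths n G (Suc L) j"
      using zs E by (auto simp: rooted_paths_iff zs_eq)
    show "[i] \<in> rooted_paths n G (Suc L) j"
      using zs ij by (auto simp: rooted_paths_iff zs_eq insert_commute)
  qed simp
  hence us: "us = []" by simp
  have "ys = vs"
  proof (rule rooted_path_unique[OF nli])
    show "ys \<in> rooted_paths n G (Suc L) i" using ys by (auto simp: rooted_paths_iff)
    show "vs \<in> rooted_paths n G (Suc L) i" using zs E by (auto simp: rooted_paths_iff zs_eq)
    show "last (i # ys) = last (i # vs)" using last by (simp add: zs_eq)
  qed
  thus ?thesis using us by (simp add: zs_eq)
qed

text \<open>
  For \<open>w = \<plusminus> 1 / sqrt d\<close> these are the rows of a truncated Green's function of the tree around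
  \<open>i\<close>: neighbouring rows have correlations of the sign of \<open>w\<close>.
\<close>

definition path_vec :: "nat \<Rightarrow> nat set set \<Rightarrow> nat \<Rightarrow> real \<Rightarrow> nat \<Rightarrow> nat \<Rightarrow> real" where
  "path_vec n G L w i m = (\<Sum>ys\<in>{ys \<in> rooted_paths n G L i. last (i # ys) = m}. w ^ length ys)"

lemma last_rooted_path_less:
  "i < n \<Longrightarrow> ys \<in> rooted_paths n G L i \<Longrightarrow> last (i # ys) < n"
proof -
  assume "i < n" "ys \<in> rooted_paths n G L i"
  hence "set (i # ys) \<subseteq> {..<n}" by (auto simp: rooted_paths_iff)
  moreover have "last (i # ys) \<in> set (i # ys)" by (rule last_in_set) simp
  ultimately show "last (i # ys) < n" by blast
qed

lemma path_vec_inner: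
  assumes "i < n" "j < n"
  shows "(\<Sum>m<n. path_vec n G L w i m * path_vec n G L w j m)
    = (\<Sum>(ys,zs)\<in>{(ys,zs). ys \<in> rooted_paths n G L i \<and> zs \<in> rooted_paths n G L j \<and> last (i # ys) = last (j # zs)}.
        w ^ length ys * w ^ length zs)"
proof -
  let ?R = "rooted_paths n G L"
  have "(\<Sum>m<n. path_vec n G L w i m * path_vec n G L w j m)
      = (\<Sum>m<n. \<Sum>(ys,zs)\<in>{ys \<in> ?R i. last (i # ys) = m} \<times> {zs \<in> ?R j. last (j # zs) = m}. w ^ length ys * w ^ length zs)"
    unfolding path_vec_def sum_product sum.cartesian_product ..
  also have "\<dots> = (\<Sum>(ys,zs)\<in>(\<Union>m<n. {ys \<in> ?R i. last (i # ys) = m} \<times> {zs \<in> ?R j. last (j # zs) = m}). w ^ length ys * w ^ length zs)"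
    by (rule sum.UNION_disjoint[symmetric]) (auto simp: finite_rooted_paths)
  also have "(\<Union>m<n. {ys \<in> ?R i. last (i # ys) = m} \<times> {zs \<in> ?R j. last (j # zs) = m})
      = {(ys,zs). ys \<in> ?R i \<and> zs \<in> ?R j \<and> last (i # ys) = last (j # zs)}"
    using last_rooted_path_less[OF assms(2)] by (auto simp del: last.simps)
  finally show ?thesis .
qed

lemma path_vec_norm:
  assumes i: "i < n" and nl: "\<not> lollipop n G i (2 * L)" and w: "w * w = 1 / d"
  shows "(\<Sum>m<n. path_vec n G L w i m * path_vec n G L w i m) = path_mass n G L d i"
proof -
  let ?R = "rooted_paths n G L i"
  have "{(ys,zs). ys \<in> ?R \<and> zs \<in> ?R \<and> last (i # ys) = last (i # zs)} = (\<lambda>ys. (ys,ys)) ` ?R"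
    (is "?S = ?D")
  proof (intro equalityI subsetI)
    fix x assume "x \<in> ?S"
    then obtain ys zs where x: "x = (ys,zs)" "ys \<in> ?R" "zs \<in> ?R" "last (i # ys) = last (i # zs)" by blast
    moreover have "ys = zs"
      using x by (intro rooted_path_unique[OF nl]) (auto simp: rooted_paths_iff)
    ultimately show "x \<in> ?D" by blast
  qed blast
  hence "(\<Sum>m<n. path_vec n G L w i m * path_vec n G L w i m) = (\<Sum>(ys,zs)\<in>(\<lambda>ys. (ys,ys)) ` ?R. w ^ length ys * w ^ length zs)"
    unfolding path_vec_inner[OF i i] by simp
  also have "\<dots> = (\<Sum>ys\<in>?R. w ^ length ys * w ^ length ys)"
    by (subst sum.reindex) (auto simp: inj_on_def)
  also have "\<dots> = (\<Sum>ys\<in>?R. 1 / d ^ length ys)"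
    by (simp add: power_mult_distrib[symmetric] w power_one_over)
  finally show ?thesis by (simp add: path_mass_eq)
qed

text \<open>The exponent omits the first edge, because the weights of \<open>j # zs\<close> and
  \<open>zs\<close> multiply to \<open>w / d ^ length zs\<close>.\<close>

definition step_mass :: "nat \<Rightarrow> nat set set \<Rightarrow> nat \<Rightarrow> real \<Rightarrow> nat \<Rightarrow> nat \<Rightarrow> real" where
  "step_mass n G L d i j = (\<Sum>zs\<in>{zs. j # zs \<in> rooted_paths n G L i}. 1 / d ^ length zs)"

lemma finite_step_paths: "finite {zs. j # zs \<in> rooted_paths n G L i}"
  by (rule finite_subset[of _ "tl ` rooted_paths n G L i"]) (force simp: finite_rooted_paths image_iff)+

lemma step_mass_nonneg: "0 \<le> d \<Longrightarrow> 0 \<le> step_mass n G L d i j"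
  by (auto simp: step_mass_def intro!: sum_nonneg)

text \<open>Only the pairs \<open>(j # zs, zs)\<close> and \<open>(ys, i # ys)\<close> share an
  endpoint. Their total length is odd, so one factor \<open>w\<close> survives and carries the
  sign.\<close>

lemma path_vec_adjacent:
  assumes nli: "\<not> lollipop n G i (2 * L)" and nlj: "\<not> lollipop n G j (2 * L)"
    and ij: "i \<noteq> j" "{i,j} \<in> G" "i < n" "j < n" and w: "w * w = 1 / d"
  shows "(\<Sum>m<n. path_vec n G L w i m * path_vec n G L w j m)
    = w * (step_mass n G L d i j + step_mass n G L d j i)"
proof -
  let ?R = "rooted_paths n G L"
  define A where "A = {zs. j # zs \<in> ?R i}"
  define B where "B = {ys. i # ys \<in> ?R j}"
  have finA: "finite A" "finite B" unfolding A_def B_def by (rule finite_step_paths)+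
  have A: "zs \<in> ?R j" if "zs \<in> A" for zs using that by (auto simp: A_def rooted_paths_iff)
  have B: "ys \<in> ?R i" if "ys \<in> B" for ys using that by (auto simp: B_def rooted_paths_iff)
  have "{(ys,zs). ys \<in> ?R i \<and> zs \<in> ?R j \<and> last (i # ys) = last (j # zs)}
      = (\<lambda>zs. (j # zs, zs)) ` A \<union> (\<lambda>ys. (ys, i # ys)) ` B" (is "?S = _")
  proof (intro equalityI subsetI)
    fix x assume "x \<in> ?S"
    then obtain ys zs where x: "x = (ys,zs)" "ys \<in> ?R i" "zs \<in> ?R j" "last (i # ys) = last (j # zs)" by auto
    from rooted_path_step[OF nli nlj ij this(2-4)]
    show "x \<in> (\<lambda>zs. (j # zs, zs)) ` A \<union> (\<lambda>ys. (ys, i # ys)) ` B"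
      using x by (auto simp: A_def B_def)
  next
    fix x assume "x \<in> (\<lambda>zs. (j # zs, zs)) ` A \<union> (\<lambda>ys. (ys, i # ys)) ` B"
    thus "x \<in> ?S"
    proof (elim UnE imageE)
      fix zs assume "x = (j # zs, zs)" "zs \<in> A"
      moreover have "j # zs \<in> ?R i" "zs \<in> ?R j" using A \<open>zs \<in> A\<close> by (simp_all add: A_def)
      ultimately show "x \<in> ?S" by simp
    next
      fix ys assume "x = (ys, i # ys)" "ys \<in> B"
      moreover have "i # ys \<in> ?R j" "ys \<in> ?R i" using B \<open>ys \<in> B\<close> by (simp_all add: B_def)
      ultimately show "x \<in> ?S" by simp
    qed
  qed
  hence "(\<Sum>m<n. path_vec n G L w i m * path_vec n G L w j m)
      = (\<Sum>(ys,zs)\<in>(\<lambda>zs. (j # zs, zs)) ` A \<union> (\<lambda>ys. (ys, i # ys)) ` B. w ^ length ys * w ^ length zs)"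
    unfolding path_vec_inner[OF ij(3,4)] by simp
  also have "\<dots> = (\<Sum>(ys,zs)\<in>(\<lambda>zs. (j # zs, zs)) ` A. w ^ length ys * w ^ length zs)
      + (\<Sum>(ys,zs)\<in>(\<lambda>ys. (ys, i # ys)) ` B. w ^ length ys * w ^ length zs)"
  proof (rule sum.union_disjoint)
    show "(\<lambda>zs. (j # zs, zs)) ` A \<inter> (\<lambda>ys. (ys, i # ys)) ` B = {}"
    proof (intro equals0I)
      fix x assume "x \<in> (\<lambda>zs. (j # zs, zs)) ` A \<inter> (\<lambda>ys. (ys, i # ys)) ` B"
      then obtain ys zs where "ys = j # zs" "zs = i # ys" by auto
      thus False using arg_cong[of ys "j # zs" length] arg_cong[of zs "i # ys" length] by simp
    qed
  qed (use finA in auto)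
  also have "(\<Sum>(ys,zs)\<in>(\<lambda>zs. (j # zs, zs)) ` A. w ^ length ys * w ^ length zs) = (\<Sum>zs\<in>A. w * (1 / d ^ length zs))"
    by (subst sum.reindex) (auto simp: inj_on_def mult.assoc power_mult_distrib[symmetric] w power_one_over)
  also have "(\<Sum>(ys,zs)\<in>(\<lambda>ys. (ys, i # ys)) ` B. w ^ length ys * w ^ length zs) = (\<Sum>ys\<in>B. w * (1 / d ^ length ys))"
    by (subst sum.reindex)
      (auto simp: inj_on_def mult.left_commute power_mult_distrib[symmetric] w power_one_over)
  finally show ?thesis by (simp add: step_mass_def A_def B_def sum_distrib_left distrib_left)
qed

section \<open>The feasible Gram matrix and its objective value\<close>

text \<open>Outside \<open>A\<close> the vectors are replaced by 0. The unit diagonal is then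
  restored by adding \<open>1 - s i / T\<close>, which is nonnegative; geometrically, each vector is
  padded with a private orthogonal coordinate.\<close>

lemma gram_sdp_feasible:
  fixes V :: "nat \<Rightarrow> nat \<Rightarrow> real"
  assumes T: "T > 0" and A: "\<And>i. i < n \<Longrightarrow> i \<in> A \<Longrightarrow> (\<Sum>m<n. V i m * V i m) \<le> T"
  shows "Matrix.mat n n (\<lambda>(i,j). if i = j then 1 else if i \<in> A \<and> j \<in> A then (\<Sum>m<n. V i m * V j m) / T else 0)
    \<in> sdp_feasible n"
proof -
  define U where "U i m = (if i \<in> A then V i m else 0)" for i m
  define X where "X = Matrix.mat n n (\<lambda>(i,j). if i = j then 1 else if i \<in> A \<and> j \<in> A then (\<Sum>m<n. V i m * V j m) / T else 0)"
  define s where "s i = (\<Sum>m<n. U i m * U i m)" for i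
  have s: "s i \<le> T" if "i < n" for i
    using A[OF that] T by (cases "i \<in> A") (auto simp: s_def U_def)
  have X: "X $$ (i,j) = (\<Sum>m<n. U i m * U j m) / T + (if i = j then 1 - s i / T else 0)" if "i < n" "j < n" for i j
    using that by (auto simp: X_def U_def s_def)
  have "0 \<le> (\<Sum>i<n. \<Sum>j<n. z i * z j * X $$ (i,j))" for z
  proof -
    have "(\<Sum>i<n. \<Sum>j<n. z i * z j * X $$ (i,j))
        = (\<Sum>i<n. \<Sum>j<n. (\<Sum>m<n. (z i * U i m) * (z j * U j m)) / T)
          + (\<Sum>i<n. \<Sum>j<n. if i = j then z i * z i * (1 - s i / T) else 0)"
      unfolding sum.distrib[symmetric]
    proof (intro sum.cong refl)
      fix i j assume "i \<in> {..<n}" "j \<in> {..<n}"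
      moreover have "(\<Sum>m<n. (z i * U i m) * (z j * U j m)) = z i * z j * (\<Sum>m<n. U i m * U j m)"
        unfolding sum_distrib_left by (intro sum.cong refl) (simp add: mult_ac)
      ultimately show "z i * z j * X $$ (i,j) = (\<Sum>m<n. (z i * U i m) * (z j * U j m)) / T
          + (if i = j then z i * z i * (1 - s i / T) else 0)"
        by (simp add: X distrib_left)
    qed
    also have "(\<Sum>i<n. \<Sum>j<n. (\<Sum>m<n. (z i * U i m) * (z j * U j m)) / T)
        = (\<Sum>m<n. (\<Sum>i<n. z i * U i m) * (\<Sum>j<n. z j * U j m)) / T"
    proof -
      have "(\<Sum>i<n. \<Sum>j<n. (\<Sum>m<n. (z i * U i m) * (z j * U j m)) / T)
          = (\<Sum>i<n. \<Sum>j<n. \<Sum>m<n. (z i * U i m) * (z j * U j m)) / T"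
        by (simp add: sum_divide_distrib)
      also have "(\<Sum>i<n. \<Sum>j<n. \<Sum>m<n. (z i * U i m) * (z j * U j m))
          = (\<Sum>i<n. \<Sum>m<n. \<Sum>j<n. (z i * U i m) * (z j * U j m))"
        by (intro sum.cong refl sum.swap)
      also have "\<dots> = (\<Sum>m<n. \<Sum>i<n. \<Sum>j<n. (z i * U i m) * (z j * U j m))" by (rule sum.swap)
      finally show ?thesis by (simp add: sum_product)
    qed
    also have "(\<Sum>i<n. \<Sum>j<n. if i = j then z i * z i * (1 - s i / T) else 0) = (\<Sum>i<n. z i * z i * (1 - s i / T))"
      by (intro sum.cong) auto
    also have "0 \<le> (\<Sum>m<n. (\<Sum>i<n. z i * U i m) * (\<Sum>j<n. z j * U j m)) / T + (\<Sum>i<n. z i * z i * (1 - s i / T))"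
      using T s
      by (intro add_nonneg_nonneg divide_nonneg_pos[OF sum_nonneg] sum_nonneg zero_le_square
          mult_nonneg_nonneg[OF zero_le_square]) auto
    finally show ?thesis .
  qed
  moreover have "X $$ (i,j) = X $$ (j,i)" if "i < n" "j < n" for i j
    using that by (auto simp: X mult.commute)
  moreover have "X $$ (i,i) = 1" if "i < n" for i using that by (simp add: X_def)
  moreover have "X \<in> carrier_mat n n" by (simp add: X_def)
  ultimately show ?thesis unfolding X_def[symmetric] sdp_feasible_iff by blast
qed

text \<open>Nonempty paths are sorted by their first step: the empty path accounts for the -1, and
  the omitted first edge for the factor \<open>d\<close>.\<close>

lemma sum_step_mass:
  assumes L: "L > 0" and i: "i < n" and d: "d > 0"
  shows "(\<Sum>j<n. step_mass n G L d i j) = d * (path_mass n G L d i - 1)"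
proof -
  let ?R = "rooted_paths n G L i"
  have nil: "[] \<in> ?R" using L by (simp add: rooted_paths_iff)
  have "(\<Sum>j<n. step_mass n G L d i j) = (\<Sum>(j,zs)\<in>(SIGMA j:{..<n}. {zs. j # zs \<in> ?R}). 1 / d ^ length zs)"
    unfolding step_mass_def by (subst sum.Sigma) (auto simp: finite_step_paths)
  also have "\<dots> = (\<Sum>ys\<in>?R - {[]}. d * (1 / d ^ length ys))"
  proof (rule sum.reindex_bij_witness[of _ "\<lambda>ys. (hd ys, tl ys)" "\<lambda>(j,zs). j # zs"])
    fix ys assume ys: "ys \<in> ?R - {[]}"
    then obtain j zs where "ys = j # zs" by (cases ys) auto
    thus "(case (hd ys, tl ys) of (j,zs) \<Rightarrow> j # zs) = ys"
      "(hd ys, tl ys) \<in> (SIGMA j:{..<n}. {zs. j # zs \<in> ?R})"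
      using ys by (auto simp: rooted_paths_iff)
  qed (use d in \<open>auto simp: field_simps\<close>)
  also have "\<dots> = d * (\<Sum>ys\<in>?R - {[]}. 1 / d ^ length ys)" by (simp add: sum_distrib_left)
  also have "(\<Sum>ys\<in>?R - {[]}. 1 / d ^ length ys) = path_mass n G L d i - 1"
    using nil finite_rooted_paths[of n G L i] by (simp add: path_mass_eq sum_diff1)
  finally show ?thesis .
qed

text \<open>Only neighbours of \<open>j\<close> contribute, and removing the first step leaves a
  path from \<open>j\<close>. This crude bound will be applied only at exceptional vertices.\<close>

lemma sum_step_mass_le:
  assumes d: "d > 0"
  shows "(\<Sum>i<n. step_mass n G L d i j) \<le> real (card (sa_paths n G j 1)) * path_mass n G L d j"
proof -
  define S where "S = {i. i < n \<and> i \<noteq> j \<and> {j,i} \<in> G}"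
  have "sa_paths n G j 1 = (\<lambda>i. [i]) ` S"
    by (auto simp: sa_paths_iff S_def length_Suc_conv)
  hence card: "card (sa_paths n G j 1) = card S" by (simp add: card_image inj_on_def)
  have "(\<Sum>i<n. step_mass n G L d i j) = (\<Sum>i\<in>S. step_mass n G L d i j)"
  proof (rule sum.mono_neutral_right)
    show "\<forall>i\<in>{..<n} - S. step_mass n G L d i j = 0"
    proof
      fix i assume "i \<in> {..<n} - S"
      hence "{zs. j # zs \<in> rooted_paths n G L i} = {}"
        by (auto simp: S_def rooted_paths_iff insert_commute)
      thus "step_mass n G L d i j = 0" by (simp only: step_mass_def sum.empty)
    qed
  qed (auto simp: S_def)
  also have "\<dots> \<le> (\<Sum>i\<in>S. path_mass n G L d j)"
  proof (intro sum_mono)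
    fix i
    show "step_mass n G L d i j \<le> path_mass n G L d j"
      unfolding step_mass_def path_mass_eq using d
      by (intro sum_mono2 finite_rooted_paths) (auto simp: rooted_paths_iff)
  qed
  finally show ?thesis unfolding card by simp
qed

text \<open>Reversal maps the paths ending at \<open>m\<close> injectively to paths starting at
  \<open>m\<close>.\<close>

lemma sum_card_paths_to_le:
  "(\<Sum>i<n. card {ys \<in> rooted_paths n G L i. last (i # ys) = m}) \<le> card (rooted_paths n G L m)"
proof -
  let ?A = "\<lambda>i. {ys \<in> rooted_paths n G L i. last (i # ys) = m}"
  have "(\<Sum>i<n. card (?A i)) = card (SIGMA i:{..<n}. ?A i)"
    by (simp add: finite_rooted_paths)
  also have "\<dots> \<le> card (rooted_paths n G L m)"
  proof (rule card_inj_on_le[of "\<lambda>(i,ys). tl (rev (i # ys))"])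
    have rv: "rev (i # ys) = m # tl (rev (i # ys))" if "last (i # ys) = m" for i ys
    proof -
      have "hd (rev (i # ys)) = m" using that by (simp only: hd_rev)
      moreover have "rev (i # ys) \<noteq> []" by simp
      ultimately show ?thesis by (metis list.collapse)
    qed
    show "inj_on (\<lambda>(i,ys). tl (rev (i # ys))) (SIGMA i:{..<n}. ?A i)"
    proof (rule inj_onI)
      fix a b assume ab: "a \<in> (SIGMA i:{..<n}. ?A i)" "b \<in> (SIGMA i:{..<n}. ?A i)"
        "(case a of (i,ys) \<Rightarrow> tl (rev (i # ys))) = (case b of (i,ys) \<Rightarrow> tl (rev (i # ys)))"
      obtain i ys j zs where a: "a = (i,ys)" "b = (j,zs)" by (cases a, cases b) auto
      have "rev (i # ys) = rev (j # zs)"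
        using rv[of i ys] rv[of j zs] ab unfolding a by simp
      thus "a = b" unfolding a by (simp only: rev_is_rev_conv list.inject)
    qed
    show "(\<lambda>(i,ys). tl (rev (i # ys))) ` (SIGMA i:{..<n}. ?A i) \<subseteq> rooted_paths n G L m"
    proof safe
      fix i ys assume i: "i < n" and ys: "ys \<in> rooted_paths n G L i" and m: "m = last (i # ys)"
      define zs where "zs = tl (rev (i # ys))"
      have r: "m # zs = rev (i # ys)" unfolding zs_def using rv[of i ys] m by simp
      have "length (m # zs) = length (i # ys)" unfolding r by (rule length_rev)
      moreover have "set (m # zs) = set (i # ys)" unfolding r by (rule set_rev)
      moreover have "distinct (m # zs)" using ys unfolding r rooted_paths_iff by (simp only: distinct_rev)
      moreover have "path_edges (m # zs) = path_edges (i # ys)" unfolding r by (rule path_edges_rev)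
      moreover have "set zs \<subseteq> set (m # zs)" by auto
      ultimately have "zs \<in> rooted_paths n G L m"
        using ys i unfolding rooted_paths_iff by (auto simp del: path_edges.simps)
      thus "tl (rev (i # ys)) \<in> rooted_paths n G L (last (i # ys))" by (simp only: zs_def m)
    qed
  qed (rule finite_rooted_paths)
  finally show ?thesis .
qed

text \<open>At an exceptional vertex, the loss \<open>N i\<close> pays for edge weights leaving it
  and the degree term for those entering it. The sum with factor \<open>p\<close> pays for the
  subtracted mean matrix.\<close>

lemma SDP_ge_path_sums:
  assumes G: "G \<subseteq> all_edges n" and p: "0 \<le> p" "p \<le> 1" and \<sigma>: "\<bar>\<sigma>\<bar> = 1"
    and d: "1 \<le> d" and L: "L > 0" and T: "T > 0"
  defines "A \<equiv> {i. i < n \<and> \<not> lollipop n G i (2 * L) \<and> path_mass n G L d i \<le> T}"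
  defines "N \<equiv> path_mass n G L d"
  shows "(2 * sqrt d / T) * (\<Sum>i<n. (N i - 1) - of_bool (i \<notin> A) * (N i * (1 + real (card (sa_paths n G i 1)) / d)))
      - p / T * (\<Sum>m<n. (real (card (rooted_paths n G L m)))\<^sup>2)
    \<le> SDP (signed_mat n p \<sigma> G)"
proof -
  define w where "w = \<sigma> / sqrt d"
  have \<sigma>2: "\<sigma> * \<sigma> = 1" using \<sigma> by (metis abs_mult_self_eq mult_1)
  have sd: "sqrt d * sqrt d = d" "sqrt d \<ge> 1" using d by auto
  have w: "w * w = 1 / d" unfolding w_def using \<sigma>2 sd by simp
  have w1: "\<bar>w\<bar> \<le> 1" unfolding w_def using \<sigma> sd by simp
  define V where "V = path_vec n G L w"
  define S where "S = step_mass n G L d"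
  define I where "I i j = (\<Sum>m<n. V i m * V j m)" for i j
  define X where "X = Matrix.mat n n (\<lambda>(i,j). if i = j then 1 else if i \<in> A \<and> j \<in> A then (\<Sum>m<n. V i m * V j m) / T else 0)"
  define c where "c i j = (of_bool (i \<noteq> j \<and> i \<in> A \<and> j \<in> A) :: real)" for i j
  define e where "e i j = (of_bool ({i,j} \<in> G) :: real)" for i j
  have S0: "0 \<le> S i j" for i j unfolding S_def using d by (intro step_mass_nonneg) simp
  have N0: "0 \<le> N i" for i unfolding N_def using d by (intro path_mass_nonneg) simp
  have Xf: "X \<in> sdp_feasible n"
    unfolding X_def using path_vec_norm[OF _ _ w] by (intro gram_sdp_feasible T) (auto simp: A_def V_def)
  hence Xc: "X \<in> carrier_mat n n" by (simp add: sdp_feasible_def)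
  \<comment> \<open>The signed matrix has zero diagonal, so the unit entries of \<open>X\<close>
    drop out; the rest splits into an edge part and a mean part.\<close>
  have "mat_inner (signed_mat n p \<sigma> G) X = (\<Sum>i<n. \<Sum>j<n. (c i j * e i j * (\<sigma> * I i j) - p * (\<sigma> * (c i j * I i j))) / T)"
    unfolding mat_inner_eq[OF signed_mat_carrier Xc]
    by (intro sum.cong refl)
      (auto simp: signed_mat_entry[OF p G] X_def c_def e_def I_def diff_divide_distrib algebra_simps)
  also have "\<dots> = ((\<Sum>i<n. \<Sum>j<n. c i j * e i j * (\<sigma> * I i j)) - p * (\<sigma> * (\<Sum>i<n. \<Sum>j<n. c i j * I i j))) / T"
    by (simp add: sum_divide_distrib[symmetric] sum_subtractf sum_distrib_left)
  finally have inner: "mat_inner (signed_mat n p \<sigma> G) X = \<dots>" .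

  have edge: "c i j * e i j * (\<sigma> * I i j) = (c i j * e i j * S i j + c i j * e i j * S j i) / sqrt d"
    if "i < n" "j < n" for i j
  proof (cases "i \<noteq> j \<and> i \<in> A \<and> j \<in> A \<and> {i,j} \<in> G")
    case True
    hence "I i j = w * (S i j + S j i)"
      unfolding I_def V_def S_def using that by (intro path_vec_adjacent w) (auto simp: A_def)
    hence "\<sigma> * I i j = (S i j + S j i) / sqrt d"
      using \<sigma>2 by (simp add: w_def mult.assoc[symmetric])
    thus ?thesis using True by (simp add: c_def e_def)
  qed (auto simp: c_def e_def)
  have "(\<Sum>i<n. \<Sum>j<n. c i j * e i j * (\<sigma> * I i j))
      = ((\<Sum>i<n. \<Sum>j<n. c i j * e i j * S i j) + (\<Sum>i<n. \<Sum>j<n. c i j * e i j * S j i)) / sqrt d"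
    by (simp add: edge sum_divide_distrib sum.distrib add_divide_distrib)
  also have "(\<Sum>i<n. \<Sum>j<n. c i j * e i j * S j i) = (\<Sum>i<n. \<Sum>j<n. c i j * e i j * S i j)"
    by (subst sum.swap) (auto simp: c_def e_def insert_commute conj_ac eq_commute intro!: sum.cong)
  finally have E1: "(\<Sum>i<n. \<Sum>j<n. c i j * e i j * (\<sigma> * I i j))
      = 2 * (\<Sum>i<n. \<Sum>j<n. c i j * e i j * S i j) / sqrt d" by simp

  \<comment> \<open>A union bound over exceptional endpoints; if both are exceptional the weight is
    subtracted twice, which is safe as \<open>S\<close> is nonnegative.\<close>
  have "(\<Sum>i<n. \<Sum>j<n. S i j - of_bool (i \<notin> A) * S i j - of_bool (j \<notin> A) * S i j)
      \<le> (\<Sum>i<n. \<Sum>j<n. c i j * e i j * S i j)"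
  proof (intro sum_mono)
    fix i j
    show "S i j - of_bool (i \<notin> A) * S i j - of_bool (j \<notin> A) * S i j \<le> c i j * e i j * S i j"
    proof (cases "i \<noteq> j \<and> {i,j} \<in> G")
      case True
      thus ?thesis using S0[of i j] by (auto simp: c_def e_def)
    next
      case False
      hence "{zs. j # zs \<in> rooted_paths n G L i} = {}" by (auto simp: rooted_paths_iff)
      hence "S i j = 0" by (simp only: S_def step_mass_def sum.empty)
      thus ?thesis by simp
    qed
  qed
  also have "(\<Sum>i<n. \<Sum>j<n. S i j - of_bool (i \<notin> A) * S i j - of_bool (j \<notin> A) * S i j)
      = (\<Sum>i<n. \<Sum>j<n. S i j) - (\<Sum>i<n. of_bool (i \<notin> A) * (\<Sum>j<n. S i j))
        - (\<Sum>j<n. of_bool (j \<notin> A) * (\<Sum>i<n. S i j))"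
    unfolding sum_subtractf sum_distrib_left
      sum.swap[of "\<lambda>j i. of_bool (j \<notin> A) * S i j" "{..<n}" "{..<n}"] ..
  finally have E2: "(\<Sum>i<n. \<Sum>j<n. S i j) - (\<Sum>i<n. of_bool (i \<notin> A) * (\<Sum>j<n. S i j))
        - (\<Sum>j<n. of_bool (j \<notin> A) * (\<Sum>i<n. S i j)) \<le> (\<Sum>i<n. \<Sum>j<n. c i j * e i j * S i j)" .
  have row: "(\<Sum>j<n. S i j) = d * (N i - 1)" if "i < n" for i
    unfolding S_def N_def using L that d by (intro sum_step_mass) auto
  have "d * (\<Sum>i<n. (N i - 1) - of_bool (i \<notin> A) * (N i * (1 + real (card (sa_paths n G i 1)) / d)))
      = (\<Sum>i<n. d * (N i - 1)) - (\<Sum>i<n. of_bool (i \<notin> A) * (d * N i))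
        - (\<Sum>i<n. of_bool (i \<notin> A) * (real (card (sa_paths n G i 1)) * N i))"
    unfolding sum_distrib_left sum_subtractf[symmetric] using d
    by (intro sum.cong refl) (simp add: field_simps)
  also have "\<dots> \<le> (\<Sum>i<n. \<Sum>j<n. S i j) - (\<Sum>i<n. of_bool (i \<notin> A) * (\<Sum>j<n. S i j))
        - (\<Sum>j<n. of_bool (j \<notin> A) * (\<Sum>i<n. S i j))"
  proof (intro diff_mono sum_mono mult_left_mono)
    fix j assume "j \<in> {..<n}"
    show "(\<Sum>i<n. S i j) \<le> real (card (sa_paths n G j 1)) * N j"
      unfolding S_def N_def using d by (intro sum_step_mass_le) simp
  qed (use row d N0 in auto)
  finally have E3: "d * (\<Sum>i<n. (N i - 1) - of_bool (i \<notin> A) * (N i * (1 + real (card (sa_paths n G i 1)) / d)))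
      \<le> (\<Sum>i<n. \<Sum>j<n. c i j * e i j * S i j)" using E2 by linarith

  \<comment> \<open>The mean part is bounded without cancellation:
    \<open>\<bar>w\<bar> \<le> 1\<close>, so every path counts at most 1.\<close>
  define q where "q i m = real (card {ys \<in> rooted_paths n G L i. last (i # ys) = m})" for i m
  have V: "\<bar>V i m\<bar> \<le> q i m" for i m
  proof -
    have "\<bar>V i m\<bar> \<le> (\<Sum>ys\<in>{ys \<in> rooted_paths n G L i. last (i # ys) = m}. \<bar>w ^ length ys\<bar>)"
      unfolding V_def path_vec_def by (rule sum_abs)
    also have "\<dots> \<le> (\<Sum>ys\<in>{ys \<in> rooted_paths n G L i. last (i # ys) = m}. 1)"
      using w1 by (intro sum_mono) (auto simp: power_abs power_le_one)
    finally show ?thesis by (simp add: q_def)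
  qed
  have "\<bar>\<sigma> * (\<Sum>i<n. \<Sum>j<n. c i j * I i j)\<bar> = \<bar>\<Sum>i<n. \<Sum>j<n. c i j * I i j\<bar>"
    using \<sigma> by (simp add: abs_mult)
  also have "\<dots> \<le> (\<Sum>i<n. \<Sum>j<n. \<bar>c i j * I i j\<bar>)"
    by (rule order.trans[OF sum_abs]) (intro sum_mono sum_abs)
  also have "\<dots> \<le> (\<Sum>i<n. \<Sum>j<n. \<Sum>m<n. q i m * q j m)"
  proof (intro sum_mono)
    fix i j
    have "\<bar>c i j * I i j\<bar> \<le> \<bar>I i j\<bar>" by (simp add: c_def)
    also have "\<dots> \<le> (\<Sum>m<n. \<bar>V i m * V j m\<bar>)" unfolding I_def by (rule sum_abs)
    also have "\<dots> \<le> (\<Sum>m<n. q i m * q j m)"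
      unfolding abs_mult using V by (intro sum_mono mult_mono) (auto simp: q_def)
    finally show "\<bar>c i j * I i j\<bar> \<le> (\<Sum>m<n. q i m * q j m)" .
  qed
  also have "\<dots> = (\<Sum>i<n. \<Sum>m<n. \<Sum>j<n. q i m * q j m)"
    by (intro sum.cong refl sum.swap)
  also have "\<dots> = (\<Sum>m<n. \<Sum>i<n. \<Sum>j<n. q i m * q j m)" by (rule sum.swap)
  also have "\<dots> = (\<Sum>m<n. (\<Sum>i<n. q i m)\<^sup>2)" by (simp add: power2_eq_square sum_product)
  also have "\<dots> \<le> (\<Sum>m<n. (real (card (rooted_paths n G L m)))\<^sup>2)"
  proof (intro sum_mono power_mono)
    fix m
    show "(\<Sum>i<n. q i m) \<le> real (card (rooted_paths n G L m))"
      unfolding q_def of_nat_sum[symmetric] using sum_card_paths_to_le[of n G L m] by (simp only: of_nat_le_iff)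
  qed (auto simp: q_def intro!: sum_nonneg)
  finally have E4: "\<sigma> * (\<Sum>i<n. \<Sum>j<n. c i j * I i j) \<le> (\<Sum>m<n. (real (card (rooted_paths n G L m)))\<^sup>2)"
    by linarith

  let ?B = "\<Sum>i<n. (N i - 1) - of_bool (i \<notin> A) * (N i * (1 + real (card (sa_paths n G i 1)) / d))"
  have "2 * sqrt d * ?B = 2 * (d * ?B) / sqrt d" using sd by (simp add: field_simps)
  also have "\<dots> \<le> 2 * (\<Sum>i<n. \<Sum>j<n. c i j * e i j * S i j) / sqrt d"
    using E3 sd by (intro divide_right_mono mult_left_mono) auto
  finally have "2 * sqrt d * ?B - p * (\<Sum>m<n. (real (card (rooted_paths n G L m)))\<^sup>2)
      \<le> (\<Sum>i<n. \<Sum>j<n. c i j * e i j * (\<sigma> * I i j)) - p * (\<sigma> * (\<Sum>i<n. \<Sum>j<n. c i j * I i j))"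
    unfolding E1 using E4 p by (intro diff_mono mult_left_mono) auto
  hence "(2 * sqrt d * ?B - p * (\<Sum>m<n. (real (card (rooted_paths n G L m)))\<^sup>2)) / T \<le> mat_inner (signed_mat n p \<sigma> G) X"
    unfolding inner using T by (intro divide_right_mono) auto
  also have "\<dots> \<le> SDP (signed_mat n p \<sigma> G)" by (rule mat_inner_le_SDP[OF signed_mat_carrier Xf])
  finally show ?thesis by (simp add: diff_divide_distrib)
qed

section \<open>Expected contributions of a vertex\<close>

lemma expectation_erdos_renyi_mono_on:
  fixes g h :: "_ \<Rightarrow> real"
  assumes "\<And>G. G \<subseteq> all_edges n \<Longrightarrow> g G \<le> h G"
  shows "measure_pmf.expectation (erdos_renyi n p) g \<le> measure_pmf.expectation (erdos_renyi n p) h"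
proof (intro integral_mono_AE integrable_erdos_renyi)
  show "AE G in measure_pmf (erdos_renyi n p). g G \<le> h G"
    using assms edge_set_subset by (auto simp: AE_measure_pmf_iff erdos_renyi_eq)
qed

text \<open>For fixed \<open>ks\<close> the bound tends to 1 as \<open>d\<close> grows, so in the
  limit the normalised counts have moments no larger than those of the constant 1.\<close>

lemma expectation_normalized_sa_paths_le:
  assumes d: "1 \<le> d" "d \<le> real n" and i: "i < n"
  shows "measure_pmf.expectation (erdos_renyi n (d / real n))
      (\<lambda>G. \<Prod>k\<leftarrow>ks. real (card (sa_paths n G i k)) / d ^ k) \<le> (1 + 2 * real (length ks) / d) ^ sum_list ks"
proof -
  have n: "real n > 0" using d by linarith
  have "(\<Prod>k\<leftarrow>ks. real (card (sa_paths n G i k)) / d ^ k)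
      = (\<Prod>k\<leftarrow>ks. real (card (sa_paths n G i k))) / d ^ sum_list ks" for G
    by (induction ks) (auto simp: power_add)
  hence "measure_pmf.expectation (erdos_renyi n (d / real n)) (\<lambda>G. \<Prod>k\<leftarrow>ks. real (card (sa_paths n G i k)) / d ^ k)
      = measure_pmf.expectation (erdos_renyi n (d / real n)) (\<lambda>G. \<Prod>k\<leftarrow>ks. real (card (sa_paths n G i k))) / d ^ sum_list ks"
    by simp
  also have "\<dots> \<le> (real n * (d / real n) + 2 * real (length ks)) ^ sum_list ks / d ^ sum_list ks"
    using d n i by (intro divide_right_mono expectation_prod_sa_paths_le') auto
  also have "\<dots> = ((d + 2 * real (length ks)) / d) ^ sum_list ks" using n by (simp add: power_divide)
  also have "(d + 2 * real (length ks)) / d = 1 + 2 * real (length ks) / d" using d by (simp add: field_simps)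
  finally show ?thesis .
qed

lemma expectation_path_mass_ge:
  assumes d: "1 \<le> d" "d \<le> real n" and i: "i < n" and L: "L \<le> n"
  shows "real L * (1 - real L / real n) ^ L
    \<le> measure_pmf.expectation (erdos_renyi n (d / real n)) (\<lambda>G. path_mass n G L d i)"
proof -
  have n: "real n > 0" using d by linarith
  have "real L * (1 - real L / real n) ^ L = (\<Sum>k<L. (1 - real L / real n) ^ L)" by simp
  also have "\<dots> \<le> (\<Sum>k<L. measure_pmf.expectation (erdos_renyi n (d / real n)) (\<lambda>G. real (card (sa_paths n G i k))) / d ^ k)"
  proof (intro sum_mono)
    fix k assume "k \<in> {..<L}"
    hence k: "k < L" by simp
    have "(1 - real L / real n) ^ L \<le> (1 - real L / real n) ^ k"
      using k L n by (intro power_decreasing) (auto simp: field_simps)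
    also have "\<dots> \<le> (1 - real k / real n) ^ k"
      using k L n by (intro power_mono) (auto simp: field_simps)
    also have "\<dots> = (real (n - k) * (d / real n)) ^ k / d ^ k"
    proof -
      have eq: "1 - real k / real n = real (n - k) * (d / real n) / d"
        using k L n d by (simp add: of_nat_diff field_simps)
      show ?thesis unfolding eq by (rule power_divide)
    qed
    also have "\<dots> \<le> measure_pmf.expectation (erdos_renyi n (d / real n)) (\<lambda>G. real (card (sa_paths n G i k))) / d ^ k"
      using d n i k L by (intro divide_right_mono expectation_card_sa_paths_ge) auto
    finally show "(1 - real L / real n) ^ L
      \<le> measure_pmf.expectation (erdos_renyi n (d / real n)) (\<lambda>G. real (card (sa_paths n G i k))) / d ^ k" .
  qed
  also have "\<dots> = measure_pmf.expectation (erdos_renyi n (d / real n)) (\<lambda>G. path_mass n G L d i)"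
    unfolding path_mass_def by (simp add: expectation_erdos_renyi_sum)
  finally show ?thesis .
qed

lemma expectation_path_mass_sq_le:
  assumes d: "1 \<le> d" "d \<le> real n" and i: "i < n"
  shows "measure_pmf.expectation (erdos_renyi n (d / real n)) (\<lambda>G. (path_mass n G L d i)\<^sup>2)
    \<le> (real L)\<^sup>2 * (1 + 4 / d) ^ (2 * L)"
proof -
  let ?E = "measure_pmf.expectation (erdos_renyi n (d / real n))"
  have "?E (\<lambda>G. (path_mass n G L d i)\<^sup>2)
      = (\<Sum>k<L. \<Sum>l<L. ?E (\<lambda>G. \<Prod>k\<leftarrow>[k,l]. real (card (sa_paths n G i k)) / d ^ k))"
    by (simp add: path_mass_def power2_eq_square sum_product expectation_erdos_renyi_sum)
  also have "\<dots> \<le> (\<Sum>k<L. \<Sum>l<L. (1 + 4 / d) ^ (2 * L))"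
  proof (intro sum_mono)
    fix k l assume kl: "k \<in> {..<L}" "l \<in> {..<L}"
    have "?E (\<lambda>G. \<Prod>k\<leftarrow>[k,l]. real (card (sa_paths n G i k)) / d ^ k) \<le> (1 + 2 * real (length [k,l]) / d) ^ sum_list [k,l]"
      by (rule expectation_normalized_sa_paths_le[OF d i])
    also have "\<dots> \<le> (1 + 2 * real (length [k,l]) / d) ^ (2 * L)"
      using kl d by (intro power_increasing) auto
    finally show "?E (\<lambda>G. \<Prod>k\<leftarrow>[k,l]. real (card (sa_paths n G i k)) / d ^ k) \<le> (1 + 4 / d) ^ (2 * L)" by simp
  qed
  also have "\<dots> = (real L)\<^sup>2 * (1 + 4 / d) ^ (2 * L)" by (simp add: power2_eq_square)
  finally show ?thesis .
qed

text \<open>A bound uniform in \<open>d\<close> and \<open>n\<close> is the aim, since it will be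
  multiplied by a small \<open>\<theta>\<close>. At most four path counts are multiplied and
  \<open>d \<ge> 1\<close>, hence the base \<open>9 = 1 + 2 * 4\<close>.\<close>

lemma expectation_degree_path_mass_sq_le:
  assumes d: "1 \<le> d" "d \<le> real n" and i: "i < n"
  shows "measure_pmf.expectation (erdos_renyi n (d / real n))
      (\<lambda>G. (path_mass n G L d i * (1 + real (card (sa_paths n G i 1)) / d))\<^sup>2)
    \<le> 4 * (real L)\<^sup>2 * 9 ^ (2 * L + 2)"
proof -
  let ?E = "measure_pmf.expectation (erdos_renyi n (d / real n))"
  define Q where "Q ks G = (\<Prod>k\<leftarrow>ks. real (card (sa_paths n G i k)) / d ^ k)" for ks G
  have E: "?E (Q ks) \<le> 9 ^ (2 * L + 2)" if "length ks \<le> 4" "sum_list ks \<le> 2 * L + 2" for ks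
  proof -
    have "?E (Q ks) \<le> (1 + 2 * real (length ks) / d) ^ sum_list ks"
      unfolding Q_def by (rule expectation_normalized_sa_paths_le[OF d i])
    also have "\<dots> \<le> 9 ^ sum_list ks"
    proof (intro power_mono)
      have "2 * real (length ks) / d \<le> 2 * real (length ks) / 1" using d by (intro divide_left_mono) auto
      thus "1 + 2 * real (length ks) / d \<le> 9" using that by simp
    qed (use d in auto)
    also have "\<dots> \<le> 9 ^ (2 * L + 2)" using that by (intro power_increasing) auto
    finally show ?thesis .
  qed
  have "?E (\<lambda>G. (path_mass n G L d i * (1 + real (card (sa_paths n G i 1)) / d))\<^sup>2)
      \<le> ?E (\<lambda>G. \<Sum>k<L. \<Sum>l<L. 2 * Q [k,l] G + 2 * Q [k,l,1,1] G)"
  proof (intro expectation_erdos_renyi_mono)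
    fix G
    define N where "N = path_mass n G L d i"
    define t where "t = real (card (sa_paths n G i 1)) / d"
    have "(1 + t)\<^sup>2 \<le> 2 + 2 * t\<^sup>2"
      using sum_squares_bound[of 1 t] by (simp add: power2_eq_square algebra_simps)
    hence "(N * (1 + t))\<^sup>2 \<le> N\<^sup>2 * (2 + 2 * t\<^sup>2)" unfolding power_mult_distrib by (intro mult_left_mono) auto
    also have "\<dots> = (\<Sum>k<L. \<Sum>l<L. 2 * Q [k,l] G + 2 * Q [k,l,1,1] G)"
    proof -
      have N2: "N\<^sup>2 = (\<Sum>k<L. \<Sum>l<L. Q [k,l] G)"
        by (simp add: N_def path_mass_def power2_eq_square sum_product Q_def)
      have "Q [k,l,1,1] G = Q [k,l] G * t\<^sup>2" for k l
        by (simp add: Q_def t_def power2_eq_square)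
      hence "2 * Q [k,l] G + 2 * Q [k,l,1,1] G = Q [k,l] G * (2 + 2 * t\<^sup>2)" for k l
        by (simp add: algebra_simps)
      thus ?thesis unfolding N2 by (simp only: sum_distrib_right)
    qed
    finally show "(path_mass n G L d i * (1 + real (card (sa_paths n G i 1)) / d))\<^sup>2
        \<le> (\<Sum>k<L. \<Sum>l<L. 2 * Q [k,l] G + 2 * Q [k,l,1,1] G)" by (simp only: N_def t_def)
  qed
  also have "\<dots> = (\<Sum>k<L. \<Sum>l<L. 2 * ?E (Q [k,l]) + 2 * ?E (Q [k,l,1,1]))"
    by (simp add: expectation_erdos_renyi_sum integrable_erdos_renyi Bochner_Integration.integral_add)
  also have "\<dots> \<le> (\<Sum>k<L. \<Sum>l<L. 2 * 9 ^ (2 * L + 2) + 2 * 9 ^ (2 * L + 2))"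
    by (intro sum_mono add_mono mult_left_mono E) auto
  also have "\<dots> = 4 * (real L)\<^sup>2 * 9 ^ (2 * L + 2)" by (simp add: power2_eq_square)
  finally show ?thesis .
qed

lemma expectation_card_rooted_paths_sq_le:
  assumes d: "1 \<le> d" "d \<le> real n" and i: "i < n"
  shows "measure_pmf.expectation (erdos_renyi n (d / real n)) (\<lambda>G. (real (card (rooted_paths n G L i)))\<^sup>2)
    \<le> (real L)\<^sup>2 * (d + 4) ^ (2 * L)"
proof -
  let ?E = "measure_pmf.expectation (erdos_renyi n (d / real n))"
  have n: "real n > 0" using d by linarith
  have c: "real (card (rooted_paths n G L i)) = (\<Sum>k<L. real (card (sa_paths n G i k)))" for G
    using sum_rooted_paths[of "\<lambda>_. 1" n G L i] by simp
  have "?E (\<lambda>G. (real (card (rooted_paths n G L i)))\<^sup>2)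
      = (\<Sum>k<L. \<Sum>l<L. ?E (\<lambda>G. \<Prod>k\<leftarrow>[k,l]. real (card (sa_paths n G i k))))"
    by (simp add: c power2_eq_square sum_product expectation_erdos_renyi_sum)
  also have "\<dots> \<le> (\<Sum>k<L. \<Sum>l<L. (d + 4) ^ (2 * L))"
  proof (intro sum_mono)
    fix k l assume kl: "k \<in> {..<L}" "l \<in> {..<L}"
    have "?E (\<lambda>G. \<Prod>k\<leftarrow>[k,l]. real (card (sa_paths n G i k)))
        \<le> (real n * (d / real n) + 2 * real (length [k,l])) ^ sum_list [k,l]"
      using d n i by (intro expectation_prod_sa_paths_le') auto
    also have "\<dots> = (d + 4) ^ (k + l)" using n by simp
    also have "\<dots> \<le> (d + 4) ^ (2 * L)" using kl d by (intro power_increasing) auto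
    finally show "?E (\<lambda>G. \<Prod>k\<leftarrow>[k,l]. real (card (sa_paths n G i k))) \<le> (d + 4) ^ (2 * L)" .
  qed
  also have "\<dots> = (real L)\<^sup>2 * (d + 4) ^ (2 * L)" by (simp add: power2_eq_square)
  finally show ?thesis .
qed

text \<open>The main term is the expected path mass minus 1. The \<open>\<theta>\<close> term bounds
  the second moment of the loss. The quotient by \<open>\<theta>\<close> bounds the probability of
  an exceptional vertex: Chebyshev for the path mass around \<open>L\<close>, plus the lollipop
  estimate.\<close>

definition vertex_bound :: "nat \<Rightarrow> real \<Rightarrow> real \<Rightarrow> real \<Rightarrow> nat \<Rightarrow> real" where
  "vertex_bound L \<eta> \<theta> d n = real L * (1 - real L / real n) ^ L - 1 - \<theta> * (4 * (real L)\<^sup>2 * 9 ^ (2 * L + 2))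
    - (((real L)\<^sup>2 * (1 + 4 / d) ^ (2 * L) - 2 * (real L)\<^sup>2 * (1 - real L / real n) ^ L + (real L)\<^sup>2) / (real L * \<eta>)\<^sup>2
       + (real (Suc (2 * L)))\<^sup>2 * (1 + d) ^ (2 * L) * (d / real n)) / \<theta>"

text \<open>The loss \<open>x\<close> on the exceptional event is split by
  \<open>x \<le> \<theta> * x * x + 1 / \<theta>\<close>, which separates its second moment from the
  probability of that event.\<close>

lemma expectation_vertex_ge:
  assumes d: "1 \<le> d" "d \<le> real n" and i: "i < n" and L: "L > 0" "L \<le> n" and \<eta>: "\<eta> > 0" and \<theta>: "\<theta> > 0"
  defines "A \<equiv> \<lambda>G. {i. i < n \<and> \<not> lollipop n G i (2 * L) \<and> path_mass n G L d i \<le> real L * (1 + \<eta>)}"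
  shows "vertex_bound L \<eta> \<theta> d n \<le> measure_pmf.expectation (erdos_renyi n (d / real n))
    (\<lambda>G. (path_mass n G L d i - 1) - of_bool (i \<notin> A G) * (path_mass n G L d i * (1 + real (card (sa_paths n G i 1)) / d)))"
proof -
  let ?E = "measure_pmf.expectation (erdos_renyi n (d / real n))"
  have n: "real n > 0" using d by linarith
  have p: "0 \<le> d / real n" "d / real n \<le> 1" using d n by auto
  define N where "N G = path_mass n G L d i" for G
  define x where "x G = N G * (1 + real (card (sa_paths n G i 1)) / d)" for G
  define \<beta> where "\<beta> = (real L * \<eta>)\<^sup>2"
  have Lpos: "real L > 0" using L by simp
  have \<beta>: "\<beta> > 0" using Lpos \<eta> by (simp add: \<beta>_def)
  define lol where "lol G = (of_bool (lollipop n G i (2 * L)) :: real)" for G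
  \<comment> \<open>Centring Chebyshev at \<open>L\<close> instead of the mean makes
    \<open>N\<close> enter linearly with positive coefficients only, so a lower bound on its mean
    and an upper bound on its second moment are enough.\<close>
  define h where "h G = N G - 1 - \<theta> * (x G)\<^sup>2
    - (((N G)\<^sup>2 - (2 * real L) * N G + (real L)\<^sup>2) / \<beta> + lol G) / \<theta>" for G
  have "h G \<le> (N G - 1) - of_bool (i \<notin> A G) * x G" for G
  proof -
    have sq: "(N G)\<^sup>2 - (2 * real L) * N G + (real L)\<^sup>2 = (N G - real L)\<^sup>2"
      by (simp add: power2_eq_square algebra_simps)
    have bad: "of_bool (i \<notin> A G) \<le> (N G - real L)\<^sup>2 / \<beta> + lol G"
    proof (cases "i \<in> A G \<or> lollipop n G i (2 * L)")
      case True
      thus ?thesis using \<beta> by (auto simp: lol_def)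
    next
      case False
      hence "N G > real L * (1 + \<eta>)" using i by (auto simp: A_def N_def)
      hence "real L * \<eta> \<le> N G - real L" by (simp add: algebra_simps)
      hence "\<beta> \<le> (N G - real L)\<^sup>2" unfolding \<beta>_def using Lpos \<eta> by (intro power_mono) auto
      hence "1 \<le> (N G - real L)\<^sup>2 / \<beta>" using \<beta> by simp
      thus ?thesis by (simp add: lol_def)
    qed
    have "of_bool (i \<notin> A G) * x G \<le> \<theta> * (x G)\<^sup>2 + of_bool (i \<notin> A G) / \<theta>"
    proof (cases "i \<in> A G")
      case False
      have "0 \<le> (2 * (\<theta> * x G) - 1)\<^sup>2 + 3" by (intro add_nonneg_nonneg) auto
      hence "\<theta> * x G \<le> (\<theta> * x G)\<^sup>2 + 1" by (simp add: power2_eq_square algebra_simps)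
      hence "\<theta> * x G / \<theta> \<le> ((\<theta> * x G)\<^sup>2 + 1) / \<theta>" using \<theta> by (intro divide_right_mono) auto
      thus ?thesis using False \<theta> by (simp add: power2_eq_square add_divide_distrib mult_ac)
    qed (use \<theta> in auto)
    also have "\<dots> \<le> \<theta> * (x G)\<^sup>2 + ((N G - real L)\<^sup>2 / \<beta> + lol G) / \<theta>"
      using bad \<theta> by (intro add_left_mono divide_right_mono) auto
    finally show ?thesis unfolding h_def sq by linarith
  qed
  hence "?E h \<le> ?E (\<lambda>G. (N G - 1) - of_bool (i \<notin> A G) * x G)" by (rule expectation_erdos_renyi_mono)
  moreover have "?E h = ?E N - 1 - \<theta> * ?E (\<lambda>G. (x G)\<^sup>2)
      - ((?E (\<lambda>G. (N G)\<^sup>2) - (2 * real L) * ?E N + (real L)\<^sup>2) / \<beta> + ?E lol) / \<theta>"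
    unfolding h_def
    by (simp add: integrable_erdos_renyi Bochner_Integration.integral_add Bochner_Integration.integral_diff)
  moreover have "vertex_bound L \<eta> \<theta> d n \<le> ?E N - 1 - \<theta> * ?E (\<lambda>G. (x G)\<^sup>2)
      - ((?E (\<lambda>G. (N G)\<^sup>2) - (2 * real L) * ?E N + (real L)\<^sup>2) / \<beta> + ?E lol) / \<theta>"
  proof -
    have EN: "real L * (1 - real L / real n) ^ L \<le> ?E N"
      unfolding N_def by (rule expectation_path_mass_ge[OF d i L(2)])
    have EN2: "?E (\<lambda>G. (N G)\<^sup>2) \<le> (real L)\<^sup>2 * (1 + 4 / d) ^ (2 * L)"
      unfolding N_def by (rule expectation_path_mass_sq_le[OF d i])
    have Ex: "?E (\<lambda>G. (x G)\<^sup>2) \<le> 4 * (real L)\<^sup>2 * 9 ^ (2 * L + 2)"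
      unfolding x_def N_def by (rule expectation_degree_path_mass_sq_le[OF d i])
    have El: "?E lol \<le> (real (Suc (2 * L)))\<^sup>2 * (1 + d) ^ (2 * L) * (d / real n)"
      using expectation_lollipop_le[OF p i, of "2 * L"] n by (simp add: lol_def[abs_def])
    have "2 * (real L)\<^sup>2 * (1 - real L / real n) ^ L \<le> (2 * real L) * ?E N"
      using mult_left_mono[OF EN, of "2 * real L"] by (simp add: power2_eq_square mult.assoc)
    hence num: "?E (\<lambda>G. (N G)\<^sup>2) - (2 * real L) * ?E N + (real L)\<^sup>2
        \<le> (real L)\<^sup>2 * (1 + 4 / d) ^ (2 * L) - 2 * (real L)\<^sup>2 * (1 - real L / real n) ^ L + (real L)\<^sup>2"
      using EN2 by linarith
    note divide_right_mono[OF add_mono[OF divide_right_mono[OF num] El], of \<beta> \<theta>]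
    moreover have "\<theta> * ?E (\<lambda>G. (x G)\<^sup>2) \<le> \<theta> * (4 * (real L)\<^sup>2 * 9 ^ (2 * L + 2))"
      using \<theta> by (intro mult_left_mono Ex) auto
    ultimately show ?thesis unfolding vertex_bound_def \<beta>_def[symmetric] using EN \<theta> \<beta> by linarith
  qed
  ultimately show ?thesis unfolding N_def x_def by linarith
qed

lemma expectation_SDP_ge:
  assumes d: "1 \<le> d" "d \<le> real n" and L: "L > 0" "L \<le> n" and \<eta>: "\<eta> > 0" and \<theta>: "\<theta> > 0" and \<sigma>: "\<bar>\<sigma>\<bar> = 1"
  shows "(2 * sqrt d / (real L * (1 + \<eta>)) * vertex_bound L \<eta> \<theta> d n
      - d * ((real L)\<^sup>2 * (d + 4) ^ (2 * L)) / (real L * (1 + \<eta>)) / real n) * real n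
    \<le> measure_pmf.expectation (erdos_renyi n (d / real n)) (\<lambda>G. SDP (signed_mat n (d / real n) \<sigma> G))"
proof -
  let ?E = "measure_pmf.expectation (erdos_renyi n (d / real n))"
  have n: "real n > 0" using d by linarith
  have p: "0 \<le> d / real n" "d / real n \<le> 1" using d n by auto
  define T where "T = real L * (1 + \<eta>)"
  have T: "T > 0" using L \<eta> by (simp add: T_def)
  define A where "A G = {i. i < n \<and> \<not> lollipop n G i (2 * L) \<and> path_mass n G L d i \<le> T}" for G
  define y where "y i G = (path_mass n G L d i - 1)
    - of_bool (i \<notin> A G) * (path_mass n G L d i * (1 + real (card (sa_paths n G i 1)) / d))" for i G
  define r where "r m G = (real (card (rooted_paths n G L m)))\<^sup>2" for m G
  have "(2 * sqrt d / T) * (\<Sum>i<n. vertex_bound L \<eta> \<theta> d n) - d / real n / T * (\<Sum>m<n. (real L)\<^sup>2 * (d + 4) ^ (2 * L))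
      \<le> (2 * sqrt d / T) * (\<Sum>i<n. ?E (y i)) - d / real n / T * (\<Sum>m<n. ?E (r m))"
  proof (intro diff_mono mult_left_mono sum_mono)
    fix i assume "i \<in> {..<n}"
    thus "vertex_bound L \<eta> \<theta> d n \<le> ?E (y i)"
      unfolding y_def A_def T_def using expectation_vertex_ge[OF d _ L \<eta> \<theta>, of i] by simp
  next
    fix m assume "m \<in> {..<n}"
    thus "?E (r m) \<le> (real L)\<^sup>2 * (d + 4) ^ (2 * L)"
      unfolding r_def using expectation_card_rooted_paths_sq_le[OF d] by simp
  qed (use d T n in auto)
  also have "\<dots> = ?E (\<lambda>G. (2 * sqrt d / T) * (\<Sum>i<n. y i G) - d / real n / T * (\<Sum>m<n. r m G))"
    by (subst Bochner_Integration.integral_diff)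
      (simp_all only: integrable_erdos_renyi Bochner_Integration.integral_mult_right_zero expectation_erdos_renyi_sum)
  also have "\<dots> \<le> ?E (\<lambda>G. SDP (signed_mat n (d / real n) \<sigma> G))"
    unfolding y_def r_def A_def
    by (intro expectation_erdos_renyi_mono_on SDP_ge_path_sums p \<sigma> d L T)
  finally show ?thesis using n by (simp add: T_def algebra_simps)
qed

section \<open>The limit\<close>

text \<open>The limit in \<open>n\<close> is taken for fixed \<open>d\<close>: the threshold on
  \<open>n\<close> depends on \<open>d\<close>, while \<open>\<epsilon>\<close> has to be free of
  \<open>n\<close>.\<close>

definition expected_SDP_ge :: "real \<Rightarrow> real \<Rightarrow> bool" where
  "expected_SDP_ge \<epsilon> d \<longleftrightarrow> (\<forall>\<^sub>F n in sequentially. \<forall>\<sigma>\<in>{1,-1}.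
     (2 - \<epsilon>) * sqrt d * real n
       \<le> measure_pmf.expectation (erdos_renyi n (d / real n)) (\<lambda>G. SDP (signed_mat n (d / real n) \<sigma> G)))"

lemma expected_SDP_ge_mono:
  assumes "expected_SDP_ge \<epsilon> d" "\<epsilon> \<le> \<epsilon>'" "0 \<le> d"
  shows "expected_SDP_ge \<epsilon>' d"
proof -
  have "(2 - \<epsilon>') * sqrt d * real n \<le> (2 - \<epsilon>) * sqrt d * real n" for n
    using assms(2,3) by (intro mult_right_mono) auto
  thus ?thesis using assms(1) unfolding expected_SDP_ge_def
    by (auto elim!: eventually_mono intro: order.trans)
qed

text \<open>At defect 2 the left-hand side is 0 and the SDP value is nonnegative.\<close>

lemma expected_SDP_ge_2:
  assumes d: "0 < d"
  shows "expected_SDP_ge 2 d"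
  unfolding expected_SDP_ge_def
proof (rule eventually_mono[OF eventually_gt_at_top[of "nat \<lceil>d\<rceil>"]])
  fix n assume "nat \<lceil>d\<rceil> < n"
  hence "d < real n" by linarith
  hence p: "0 \<le> d / real n" "d / real n \<le> 1" using d by auto
  have "0 \<le> measure_pmf.expectation (erdos_renyi n (d / real n)) (\<lambda>G. SDP (signed_mat n (d / real n) \<sigma> G))" for \<sigma>
    using expectation_erdos_renyi_mono_on[of n "\<lambda>_. 0" "\<lambda>G. SDP (signed_mat n (d / real n) \<sigma> G)" "d / real n"]
      SDP_nonneg[OF p] by simp
  thus "\<forall>\<sigma>\<in>{1,-1}. (2 - 2) * sqrt d * real n
       \<le> measure_pmf.expectation (erdos_renyi n (d / real n)) (\<lambda>G. SDP (signed_mat n (d / real n) \<sigma> G))"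
    by simp
qed

lemma vertex_bound_tendsto:
  "(\<lambda>n. vertex_bound L \<eta> \<theta> d n) \<longlonglongrightarrow> real L - 1 - \<theta> * (4 * (real L)\<^sup>2 * 9 ^ (2 * L + 2))
    - ((real L)\<^sup>2 * (1 + 4 / d) ^ (2 * L) - (real L)\<^sup>2) / (real L * \<eta>)\<^sup>2 / \<theta>"
proof -
  have 1: "(\<lambda>n. (1 - real L / real n) ^ L) \<longlonglongrightarrow> (1 - 0) ^ L"
    by (intro tendsto_intros lim_const_over_n)
  have "(\<lambda>n. vertex_bound L \<eta> \<theta> d n) \<longlonglongrightarrow> real L * (1 - 0) ^ L - 1 - \<theta> * (4 * (real L)\<^sup>2 * 9 ^ (2 * L + 2))
    - (((real L)\<^sup>2 * (1 + 4 / d) ^ (2 * L) - 2 * (real L)\<^sup>2 * (1 - 0) ^ L + (real L)\<^sup>2) * inverse ((real L * \<eta>)\<^sup>2)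
       + (real (Suc (2 * L)))\<^sup>2 * (1 + d) ^ (2 * L) * 0) * inverse \<theta>"
    unfolding vertex_bound_def divide_inverse[of _ "(real L * \<eta>)\<^sup>2"] divide_inverse[of _ \<theta>]
    by (intro tendsto_diff tendsto_add tendsto_mult tendsto_const 1 lim_const_over_n)
  thus ?thesis by (simp add: divide_inverse)
qed

lemma eventually_expected_SDP_ge:
  assumes \<epsilon>: "0 < \<epsilon>"
  shows "\<forall>\<^sub>F d in at_top. expected_SDP_ge \<epsilon> d"
proof -
  \<comment> \<open>There are three relative losses of size \<open>\<eta>\<close>: the normalisation
    \<open>1 + \<eta>\<close>, the -1 (as \<open>1 \<le> \<eta> * L\<close>) and the second moment
    term (as \<open>\<theta> * M = \<eta> * L\<close>). Together they leave at least
    \<open>2 * (1 - 3 * \<eta>)\<close>, which exceeds \<open>2 - \<epsilon>\<close>. The Chebyshev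
    term vanishes as \<open>d\<close> grows, because \<open>L\<close>, \<open>\<eta>\<close> and
    \<open>\<theta>\<close> are fixed beforehand.\<close>
  define \<eta> where "\<eta> = \<epsilon> / 8"
  have \<eta>: "\<eta> > 0" using \<epsilon> by (simp add: \<eta>_def)
  define L where "L = Suc (nat \<lceil>1 / \<eta>\<rceil>)"
  have L: "L > 0" "1 / \<eta> \<le> real L" unfolding L_def by (simp, linarith)
  have L1: "1 \<le> \<eta> * real L" using L \<eta> by (simp add: field_simps)
  define M where "M = 4 * (real L)\<^sup>2 * 9 ^ (2 * L + 2)"
  have M: "M > 0" using L by (simp add: M_def)
  define \<theta> where "\<theta> = \<eta> * real L / M"
  have \<theta>: "\<theta> > 0" using \<eta> L M by (simp add: \<theta>_def)
  have \<theta>M: "\<theta> * M = \<eta> * real L" using M by (simp add: \<theta>_def)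
  define T where "T = real L * (1 + \<eta>)"
  have T: "T > 0" using L \<eta> by (simp add: T_def)
  define v where "v d = real L - 1 - \<theta> * M - ((real L)\<^sup>2 * (1 + 4 / d) ^ (2 * L) - (real L)\<^sup>2) / (real L * \<eta>)\<^sup>2 / \<theta>" for d
  have "((\<lambda>d. 2 / T * v d) \<longlongrightarrow> 2 / T * (real L - 1 - \<theta> * M -
      ((real L)\<^sup>2 * (1 + 0) ^ (2 * L) - (real L)\<^sup>2) * inverse ((real L * \<eta>)\<^sup>2) * inverse \<theta>)) at_top"
    unfolding v_def divide_inverse[of _ "(real L * \<eta>)\<^sup>2"] divide_inverse[of _ \<theta>]
    by (intro tendsto_diff tendsto_add tendsto_mult tendsto_power tendsto_const
        tendsto_divide_0[OF tendsto_const] filterlim_at_top_imp_at_infinity filterlim_ident)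
  hence "((\<lambda>d. 2 / T * v d) \<longlongrightarrow> 2 / T * (real L - 1 - \<eta> * real L)) at_top" by (simp add: \<theta>M)
  moreover have "2 - \<epsilon> < 2 / T * (real L - 1 - \<eta> * real L)"
  proof -
    have "(1 - 3 * \<eta>) * (1 + \<eta>) \<le> 1 - 2 * \<eta>" using \<eta> by (simp add: algebra_simps)
    hence "real L * ((1 - 3 * \<eta>) * (1 + \<eta>)) \<le> real L * (1 - 2 * \<eta>)" by (intro mult_left_mono) auto
    also have "\<dots> \<le> real L - 1 - \<eta> * real L" using L1 by (simp add: algebra_simps)
    finally have "(1 - 3 * \<eta>) * T \<le> real L - 1 - \<eta> * real L" by (simp add: T_def mult_ac)
    hence "1 - 3 * \<eta> \<le> (real L - 1 - \<eta> * real L) / T" using T by (simp add: field_simps)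
    hence le: "2 * (1 - 3 * \<eta>) \<le> 2 * ((real L - 1 - \<eta> * real L) / T)" by (intro mult_left_mono) auto
    have "2 - \<epsilon> < 2 * (1 - 3 * \<eta>)" using \<epsilon> by (simp add: \<eta>_def)
    also note le
    also have "2 * ((real L - 1 - \<eta> * real L) / T) = 2 / T * (real L - 1 - \<eta> * real L)" by simp
    finally show ?thesis .
  qed
  ultimately have "\<forall>\<^sub>F d in at_top. 2 - \<epsilon> < 2 / T * v d" by (rule order_tendstoD(1))
  thus ?thesis
  proof (rule eventually_elim2[OF _ eventually_ge_at_top[of 1]])
    fix d :: real assume d: "2 - \<epsilon> < 2 / T * v d" "1 \<le> d"
    define c where "c = d * ((real L)\<^sup>2 * (d + 4) ^ (2 * L)) / (real L * (1 + \<eta>))"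
    have "(\<lambda>n. 2 * sqrt d / T * vertex_bound L \<eta> \<theta> d n - c / real n) \<longlonglongrightarrow> 2 * sqrt d / T * v d - 0"
      unfolding v_def M_def by (intro tendsto_diff tendsto_mult tendsto_const vertex_bound_tendsto lim_const_over_n)
    moreover have "(2 - \<epsilon>) * sqrt d < 2 * sqrt d / T * v d - 0"
      using mult_strict_right_mono[OF d(1), of "sqrt d"] d(2) by (simp add: mult_ac)
    ultimately have "\<forall>\<^sub>F n in sequentially. (2 - \<epsilon>) * sqrt d < 2 * sqrt d / T * vertex_bound L \<eta> \<theta> d n - c / real n"
      by (rule order_tendstoD(1))
    thus "expected_SDP_ge \<epsilon> d" unfolding expected_SDP_ge_def
    proof (rule eventually_elim2[OF _ eventually_ge_at_top[of "max L (nat \<lceil>d\<rceil>)"]])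
      fix n assume n: "(2 - \<epsilon>) * sqrt d < 2 * sqrt d / T * vertex_bound L \<eta> \<theta> d n - c / real n" "max L (nat \<lceil>d\<rceil>) \<le> n"
      have dn: "d \<le> real n" "L \<le> n" using n(2) by linarith+
      show "\<forall>\<sigma>\<in>{1,-1}. (2 - \<epsilon>) * sqrt d * real n
        \<le> measure_pmf.expectation (erdos_renyi n (d / real n)) (\<lambda>G. SDP (signed_mat n (d / real n) \<sigma> G))"
      proof
        fix \<sigma> :: real assume "\<sigma> \<in> {1,-1}"
        hence \<sigma>: "\<bar>\<sigma>\<bar> = 1" by auto
        have "(2 - \<epsilon>) * sqrt d * real n \<le> (2 * sqrt d / T * vertex_bound L \<eta> \<theta> d n - c / real n) * real n"
          using n(1) by (intro mult_right_mono) auto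
        also have "\<dots> \<le> measure_pmf.expectation (erdos_renyi n (d / real n)) (\<lambda>G. SDP (signed_mat n (d / real n) \<sigma> G))"
          unfolding T_def c_def by (rule expectation_SDP_ge[OF d(2) dn(1) L(1) dn(2) \<eta> \<theta> \<sigma>])
        finally show "(2 - \<epsilon>) * sqrt d * real n
          \<le> measure_pmf.expectation (erdos_renyi n (d / real n)) (\<lambda>G. SDP (signed_mat n (d / real n) \<sigma> G))" .
      qed
    qed
  qed
qed

text \<open>The set below contains 2 for every \<open>d > 0\<close>, so the infimum is not a junk value.\<close>

definition SDP_defect :: "real \<Rightarrow> real" where
  "SDP_defect d = Inf {\<epsilon>. 0 \<le> \<epsilon> \<and> expected_SDP_ge \<epsilon> d}"

lemma SDP_defect_nonneg: "0 < d \<Longrightarrow> 0 \<le> SDP_defect d"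
  unfolding SDP_defect_def using expected_SDP_ge_2[of d] by (intro cInf_greatest) (auto intro!: exI[of _ "2::real"])

lemma SDP_defect_le: "0 \<le> \<epsilon> \<Longrightarrow> expected_SDP_ge \<epsilon> d \<Longrightarrow> SDP_defect d \<le> \<epsilon>"
  unfolding SDP_defect_def by (intro cInf_lower bdd_belowI[of _ 0]) auto

text \<open>The slack \<open>\<delta>\<close> is there because the infimum need not be
  attained.\<close>

lemma expected_SDP_ge_defect:
  assumes d: "0 < d" and \<delta>: "0 < \<delta>"
  shows "expected_SDP_ge (SDP_defect d + \<delta>) d"
proof -
  have "{\<epsilon>. 0 \<le> \<epsilon> \<and> expected_SDP_ge \<epsilon> d} \<noteq> {}" using expected_SDP_ge_2[OF d] by force
  then obtain \<epsilon> where "expected_SDP_ge \<epsilon> d" "\<epsilon> < SDP_defect d + \<delta>"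
    using cInf_lessD[of "{\<epsilon>. 0 \<le> \<epsilon> \<and> expected_SDP_ge \<epsilon> d}" "SDP_defect d + \<delta>"] \<delta>
    unfolding SDP_defect_def by auto
  thus ?thesis using expected_SDP_ge_mono[of \<epsilon> d] d by simp
qed

lemma SDP_defect_tendsto_0: "(SDP_defect \<longlongrightarrow> 0) at_top"
proof (rule tendstoI)
  fix e :: real assume e: "0 < e"
  have "\<forall>\<^sub>F d in at_top. expected_SDP_ge (e / 2) d" using e by (intro eventually_expected_SDP_ge) simp
  thus "\<forall>\<^sub>F d in at_top. dist (SDP_defect d) 0 < e"
  proof (rule eventually_elim2[OF _ eventually_gt_at_top[of 0]])
    fix d :: real assume "expected_SDP_ge (e / 2) d" "0 < d"
    thus "dist (SDP_defect d) 0 < e"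
      using SDP_defect_le[of "e / 2" d] SDP_defect_nonneg[of d] e by simp
  qed
qed

section \<open>Deviation at scale \<open>n\<close> and the conclusion\<close>

text \<open>The condition \<open>8 * d * l \<le> 1\<close> lets the quadratic term of the exponent
  consume at most half of the linear term \<open>l * n\<close>.\<close>

lemma SDP_deviation_prob:
  assumes d: "0 < d" "d < real n" and \<sigma>: "\<bar>\<sigma>\<bar> = 1" and l: "0 < l" "l \<le> 1 / 2" "8 * d * l \<le> 1"
  shows "measure_pmf.prob (erdos_renyi n (d / real n))
      {G. \<bar>SDP (signed_mat n (d / real n) \<sigma> G) - measure_pmf.expectation (erdos_renyi n (d / real n))
        (\<lambda>G. SDP (signed_mat n (d / real n) \<sigma> G))\<bar> \<ge> real n} \<le> 2 * exp (- (l / 2 * real n))"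
proof -
  have p: "0 \<le> d / real n" "d / real n \<le> 1" using d by auto
  have "4 * real n * (real n * (d / real n)) * l\<^sup>2 - l * real n = (8 * d * l) * (l / 2 * real n) - l * real n"
    using d by (simp add: power2_eq_square)
  also have "\<dots> \<le> 1 * (l / 2 * real n) - l * real n"
    using l by (intro diff_mono mult_right_mono) auto
  finally have "4 * real n * (real n * (d / real n)) * l\<^sup>2 - l * real n \<le> - (l / 2 * real n)" by simp
  hence "2 * exp (4 * real n * (real n * (d / real n)) * l\<^sup>2 - l * real n) \<le> 2 * exp (- (l / 2 * real n))" by simp
  moreover have "2 * l \<le> 1" using l by simp
  note SDP_concentration[OF p \<sigma> l(1) this, of n "real n"]
  ultimately show ?thesis by linarith
qed

theorem theorem1p1:
  shows "\<exists>g :: real \<Rightarrow> real.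
    (\<forall>d>0. 0 \<le> g d) \<and>
    ((\<lambda>d. g d / sqrt d) \<longlongrightarrow> 0) at_top \<and>
    (\<forall>d>0. \<exists>C>0. \<forall>n::nat. d < real n \<longrightarrow>
       measure_pmf.prob (erdos_renyi n (d / real n))
         {G. \<bar>SDP (centered_adj_mat n (d / real n) G) / real n - 2 * sqrt d\<bar> \<le> g d \<and>
             \<bar>SDP (- centered_adj_mat n (d / real n) G) / real n - 2 * sqrt d\<bar> \<le> g d}
       \<ge> 1 - C * exp (- real n / C))"
proof (intro exI[of _ "\<lambda>d. sqrt d * SDP_defect d + 2"] conjI allI impI)
  \<comment> \<open>In the witness, the summand 2 collects 1 for the slack in the defect and 1 for
    the deviation of size \<open>n\<close>, after division by \<open>n\<close>.\<close>
  fix d :: real assume "0 < d"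
  thus "0 \<le> sqrt d * SDP_defect d + 2" using SDP_defect_nonneg[of d] by simp
next
  have "((\<lambda>d. SDP_defect d + 2 / sqrt d) \<longlongrightarrow> 0 + 0) at_top"
    by (intro tendsto_add SDP_defect_tendsto_0 tendsto_divide_0[OF tendsto_const]
        filterlim_at_top_imp_at_infinity sqrt_at_top)
  hence "((\<lambda>d. SDP_defect d + 2 / sqrt d) \<longlongrightarrow> 0) at_top" by simp
  thus "((\<lambda>d. (sqrt d * SDP_defect d + 2) / sqrt d) \<longlongrightarrow> 0) at_top"
  proof (rule Lim_transform_eventually)
    show "\<forall>\<^sub>F d in at_top. SDP_defect d + 2 / sqrt d = (sqrt d * SDP_defect d + 2) / sqrt d"
      by (rule eventually_mono[OF eventually_gt_at_top[of 0]]) (simp add: add_divide_distrib)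
  qed
next
  fix d :: real assume d: "0 < d"
  \<comment> \<open>The slack is chosen to cost exactly 1 after multiplication by
    \<open>sqrt d\<close>.\<close>
  define \<delta> where "\<delta> = 1 / sqrt d"
  have \<delta>: "\<delta> > 0" "\<delta> * sqrt d = 1" using d by (auto simp: \<delta>_def)
  from expected_SDP_ge_defect[OF d \<delta>(1)] obtain n0 where n0: "\<And>n \<sigma>. n \<ge> n0 \<Longrightarrow> \<sigma> \<in> {1,-1} \<Longrightarrow>
     (2 - (SDP_defect d + \<delta>)) * sqrt d * real n
       \<le> measure_pmf.expectation (erdos_renyi n (d / real n)) (\<lambda>G. SDP (signed_mat n (d / real n) \<sigma> G))"
    unfolding expected_SDP_ge_def eventually_sequentially by blast
  define l where "l = min (1 / 2) (1 / (8 * d))"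
  have l: "0 < l" "l \<le> 1 / 2" "8 * d * l \<le> 1"
  proof -
    have "l \<le> 1 / (8 * d)" by (simp add: l_def)
    hence "8 * d * l \<le> 8 * d * (1 / (8 * d))" using d by (intro mult_left_mono) auto
    thus "8 * d * l \<le> 1" using d by simp
  qed (use d in \<open>auto simp: l_def\<close>)
  \<comment> \<open>The 4 counts two signs with two tails each, \<open>2 / l\<close> gives the decay
    rate \<open>l / 2\<close>, and \<open>exp (real n0)\<close> makes the claim void for
    \<open>n < n0\<close>.\<close>
  define C where "C = 4 + 2 / l + exp (real n0)"
  have C: "C \<ge> 4" "C \<ge> 2 / l" "C \<ge> exp (real n0)" using l by (auto simp: C_def add_nonneg_nonneg)
  show "\<exists>C>0. \<forall>n::nat. d < real n \<longrightarrow>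
       measure_pmf.prob (erdos_renyi n (d / real n))
         {G. \<bar>SDP (centered_adj_mat n (d / real n) G) / real n - 2 * sqrt d\<bar> \<le> sqrt d * SDP_defect d + 2 \<and>
             \<bar>SDP (- centered_adj_mat n (d / real n) G) / real n - 2 * sqrt d\<bar> \<le> sqrt d * SDP_defect d + 2}
       \<ge> 1 - C * exp (- real n / C)"
  proof (intro exI[of _ C] conjI allI impI)
    fix n :: nat assume n: "d < real n"
    let ?P = "measure_pmf.prob (erdos_renyi n (d / real n))"
    let ?E = "\<lambda>\<sigma>. measure_pmf.expectation (erdos_renyi n (d / real n)) (\<lambda>G. SDP (signed_mat n (d / real n) \<sigma> G))"
    let ?good = "{G. \<bar>SDP (centered_adj_mat n (d / real n) G) / real n - 2 * sqrt d\<bar> \<le> sqrt d * SDP_defect d + 2 \<and>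
             \<bar>SDP (- centered_adj_mat n (d / real n) G) / real n - 2 * sqrt d\<bar> \<le> sqrt d * SDP_defect d + 2}"
    let ?bad = "\<lambda>\<sigma>. {G. \<bar>SDP (signed_mat n (d / real n) \<sigma> G) - ?E \<sigma>\<bar> \<ge> real n}"
    show "1 - C * exp (- real n / C) \<le> ?P ?good"
    proof (cases "n0 \<le> n")
      case False
      have "real n / C \<le> real n / 1" using C by (intro divide_left_mono) auto
      also have "\<dots> \<le> real n0" using False by simp
      finally have "exp (real n0) * exp (- real n0) \<le> C * exp (- real n / C)"
        using C by (intro mult_mono) auto
      hence "1 - C * exp (- real n / C) \<le> 0" by (simp add: exp_minus)
      also have "0 \<le> ?P ?good" by simp
      finally show ?thesis .
    next
      case True
      have n': "real n > 0" using d n by linarith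
      have dev: "\<bar>SDP (signed_mat n (d / real n) \<sigma> G) / real n - 2 * sqrt d\<bar> \<le> sqrt d * SDP_defect d + 2"
        if \<sigma>: "\<sigma> \<in> {1,-1}" and G: "G \<notin> ?bad \<sigma>" for \<sigma> G
      proof -
        define s where "s = SDP (signed_mat n (d / real n) \<sigma> G)"
        have \<sigma>': "\<bar>\<sigma>\<bar> = 1" using \<sigma> by auto
        have "?E \<sigma> \<le> 2 * sqrt (real n * (d / real n)) * real n"
          using d n n' by (intro expectation_SDP_le \<sigma>') auto
        hence up: "?E \<sigma> \<le> 2 * sqrt d * real n" using n' by simp
        have "(2 * sqrt d - sqrt d * SDP_defect d - 1) * real n = (2 - (SDP_defect d + \<delta>)) * sqrt d * real n"
          using \<delta>(2) by (simp add: algebra_simps)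
        also have "\<dots> \<le> ?E \<sigma>" by (rule n0[OF True \<sigma>])
        finally have lo: "(2 * sqrt d - sqrt d * SDP_defect d - 1) * real n \<le> ?E \<sigma>" .
        have s: "\<bar>s - ?E \<sigma>\<bar> < real n" using G by (simp add: s_def)
        have "s \<le> (2 * sqrt d + 1) * real n" using s up by (simp add: algebra_simps)
        hence 1: "s / real n \<le> 2 * sqrt d + 1" using n' by (simp add: field_simps)
        have "(2 * sqrt d - sqrt d * SDP_defect d - 2) * real n \<le> s" using s lo by (simp add: algebra_simps)
        hence 2: "2 * sqrt d - sqrt d * SDP_defect d - 2 \<le> s / real n" using n' by (simp add: field_simps)
        have "0 \<le> sqrt d * SDP_defect d" using SDP_defect_nonneg[OF d] d by simp
        thus ?thesis using 1 2 unfolding s_def[symmetric] by linarith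
      qed
      have "- ?good \<subseteq> ?bad 1 \<union> ?bad (-1)"
      proof (rule ccontr)
        assume "\<not> ?thesis"
        then obtain G where "G \<notin> ?good" "G \<notin> ?bad 1" "G \<notin> ?bad (-1)" by blast
        thus False using dev[of 1 G] dev[of "-1" G] by (simp add: signed_mat_1 signed_mat_minus_1)
      qed
      hence "?P (- ?good) \<le> ?P (?bad 1 \<union> ?bad (-1))" by (intro measure_pmf.finite_measure_mono) auto
      also have "\<dots> \<le> ?P (?bad 1) + ?P (?bad (-1))" by (intro measure_Un_le) auto
      also have "\<dots> \<le> 2 * exp (- (l / 2 * real n)) + 2 * exp (- (l / 2 * real n))"
        using l by (intro add_mono SDP_deviation_prob d n) auto
      also have "\<dots> = 4 * exp (- (l / 2 * real n))" by simp
      also have "\<dots> \<le> C * exp (- real n / C)"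
      proof -
        have "1 / C \<le> l / 2" using C l by (simp add: field_simps)
        hence "1 / C * real n \<le> l / 2 * real n" by (intro mult_right_mono) auto
        hence "- (l / 2 * real n) \<le> - real n / C" by simp
        thus ?thesis using C by (intro mult_mono) auto
      qed
      finally have "?P (- ?good) \<le> C * exp (- real n / C)" .
      moreover have "?P (- ?good) = 1 - ?P ?good"
        using measure_pmf.prob_compl[of ?good "erdos_renyi n (d / real n)"] by (simp add: Compl_eq_Diff_UNIV)
      ultimately show ?thesis by linarith
    qed
  qed (use C in auto)
qed

end
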